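(* Let $(h_k)$, $(\varepsilon_k)$ be scales such that $(h_k/\varepsilon_k)$ is bounded and let $(U^{h_k})$ be an $h_k$-bounded sequence of discrete functions. Then $(M^{\varepsilon_k}[U^{h_k}])$ is bounded in $\mathcal{S}'(\mathbb{R}^d\times\mathbb{R}^d)$ and, given any of its (weakly) convergent subsequences $(M^{\varepsilon_{k_n}}[U^{h_{k_n}}])$, there exists a positive measure $\mu$ on $\mathbb{R}^d\times\mathbb{R}^d$ such that $$\lim_{n\to\infty}\langle M^{\varepsilon_{k_n}}[U^{h_{k_n}}],a\rangle_{\mathcal{S}'\times\mathcal{S}}=\int_{\mathbb{R}^d\times\mathbb{R}^d}a(x,\xi)\,d\mu(x,\xi)$$ for every $a\in\mathcal{S}(\mathbb{R}^d\times\mathbb{R}^d)$.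
   Context: A scale is a sequence of positive numbers tending to $0$. $L^2(h\mathbb{Z}^d)$ is the space of functions $U:\mathbb{Z}^d\to\mathbb{C}$ with $\|U\|_h=(h^d\sum_{n\in\mathbb{Z}^d}|U_n|^2)^{1/2}<\infty$. A sequence $(U^{h_k})$ is $h_k$-bounded if $U^{h_k}\in L^2(h_k\mathbb{Z}^d)$ and $\|U^{h_k}\|_{h_k}\le C$ for all $k$, with $C$ independent of $k$. The discrete Fourier transform is $\widehat U(\xi)=\sum_{n\in\mathbb{Z}^d}U_ne^{-in\cdot\xi}$. For $U\in L^2(h\mathbb{Z}^d)$ and $\varepsilon>0$, $$M^\varepsilon[U](x,\xi)=\frac{h^{2d}}{(2\pi\varepsilon)^d}\sum_{m\in\mathbb{Z}^d}\overline{U_m}\,\widehat U\Big(\frac h\varepsilon\xi\Big)e^{im\cdot(h/\varepsilon)\xi}\,\delta_{hm}(x)\in\mathcal{S}'(\mathbb{R}^d\times\mathbb{R}^d),$$ where $\delta_{hm}$ is the Dirac mass at $hm$. Measures are Radon measures. *)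

theory Defs
  imports "HOL-Analysis.Analysis"
begin

section \<open>Schwartz functions and tempered distributions\<close>

text \<open>Partial derivatives along the list of coordinate directions \<open>bs\<close>; lists with entries in
  \<open>Basis\<close> play the role of multi-indices.\<close>

primrec iter_partial ::
  "'a::euclidean_space list \<Rightarrow> ('a \<Rightarrow> complex) \<Rightarrow> 'a \<Rightarrow> complex" where
  "iter_partial [] f = f"
| "iter_partial (b # bs) f = (\<lambda>x. frechet_derivative (iter_partial bs f) (at x) b)"

definition smooth :: "('a::euclidean_space \<Rightarrow> complex) \<Rightarrow> bool" where
  "smooth f \<longleftrightarrow>
     (\<forall>bs. set bs \<subseteq> Basis \<longrightarrow> (\<forall>x. iter_partial bs f differentiable (at x)))"

definition schwartz :: "('a::euclidean_space \<Rightarrow> complex) set" where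
  "schwartz = {f. smooth f \<and>
     (\<forall>N bs. set bs \<subseteq> Basis \<longrightarrow>
        bounded (range (\<lambda>x. (1 + norm x) ^ N * norm (iter_partial bs f x))))}"

text \<open>The increasing family of seminorms defining the Frechet topology of the Schwartz space.
  The supremum in \<open>real\<close> is meaningful for functions in \<open>schwartz\<close>.\<close>

definition schwartz_seminorm :: "nat \<Rightarrow> ('a::euclidean_space \<Rightarrow> complex) \<Rightarrow> real" where
  "schwartz_seminorm N f =
     (\<Sum>bs | set bs \<subseteq> Basis \<and> length bs \<le> N.
        SUP x. (1 + norm x) ^ N * norm (iter_partial bs f x))"

text \<open>A distribution is represented by a functional on all functions, of which only the values on
  \<open>schwartz\<close> matter.\<close>

definition tempered_distribution :: "(('a::euclidean_space \<Rightarrow> complex) \<Rightarrow> complex) \<Rightarrow> bool" where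
  "tempered_distribution T \<longleftrightarrow>
     (\<forall>f\<in>schwartz. \<forall>g\<in>schwartz. T (\<lambda>x. f x + g x) = T f + T g) \<and>
     (\<forall>c. \<forall>f\<in>schwartz. T (\<lambda>x. c * f x) = c * T f) \<and>
     (\<exists>N C. \<forall>f\<in>schwartz. norm (T f) \<le> C * schwartz_seminorm N f)"

definition schwartz_bounded :: "('a::euclidean_space \<Rightarrow> complex) set \<Rightarrow> bool" where
  "schwartz_bounded B \<longleftrightarrow> B \<subseteq> schwartz \<and> (\<forall>N. bounded (schwartz_seminorm N ` B))"

text \<open>Boundedness is taken in the strong dual topology (uniformly on bounded sets of test
  functions); since the Schwartz space is barrelled, weak-* boundedness is the same thing.\<close>

definition bounded_distributions ::
  "(nat \<Rightarrow> ('a::euclidean_space \<Rightarrow> complex) \<Rightarrow> complex) \<Rightarrow> bool" where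
  "bounded_distributions T \<longleftrightarrow>
     (\<forall>k. tempered_distribution (T k)) \<and>
     (\<forall>B. schwartz_bounded B \<longrightarrow> (\<exists>C. \<forall>k. \<forall>a\<in>B. norm (T k a) \<le> C))"

definition weakly_convergent_distributions ::
  "(nat \<Rightarrow> ('a::euclidean_space \<Rightarrow> complex) \<Rightarrow> complex) \<Rightarrow> bool" where
  "weakly_convergent_distributions T \<longleftrightarrow>
     (\<exists>T0. tempered_distribution T0 \<and> (\<forall>a\<in>schwartz. (\<lambda>n. T n a) \<longlonglongrightarrow> T0 a))"

text \<open>On a Euclidean space every Borel measure that is finite on compact sets is regular.\<close>

definition radon_measure :: "'a::euclidean_space measure \<Rightarrow> bool" where
  "radon_measure M \<longleftrightarrow>
     sets M = sets borel \<and> (\<forall>K. compact K \<longrightarrow> emeasure M K < \<infinity>)"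


section \<open>Discrete functions\<close>

definition scale :: "(nat \<Rightarrow> real) \<Rightarrow> bool" where
  "scale h \<longleftrightarrow> (\<forall>k. h k > 0) \<and> h \<longlonglongrightarrow> 0"

definition lattice_vec :: "int ^ 'd \<Rightarrow> real ^ 'd" where
  "lattice_vec n = (\<chi> i. real_of_int (n $ i))"

text \<open>Membership in \<open>L\<^sup>2(h\<int>\<^sup>d)\<close> does not depend on \<open>h > 0\<close>; only the norm does.\<close>

definition discrete_L2 :: "(int ^ 'd::finite \<Rightarrow> complex) set" where
  "discrete_L2 = {U. (\<lambda>n. (norm (U n))\<^sup>2) summable_on UNIV}"

definition discrete_norm :: "real \<Rightarrow> (int ^ 'd::finite \<Rightarrow> complex) \<Rightarrow> real" where
  "discrete_norm h U = sqrt (h ^ CARD('d) * (\<Sum>\<^sub>\<infinity>n. (norm (U n))\<^sup>2))"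

definition h_bounded :: "(nat \<Rightarrow> real) \<Rightarrow> (nat \<Rightarrow> int ^ 'd::finite \<Rightarrow> complex) \<Rightarrow> bool" where
  "h_bounded h U \<longleftrightarrow>
     (\<forall>k. U k \<in> discrete_L2) \<and> (\<exists>C. \<forall>k. discrete_norm (h k) (U k) \<le> C)"

text \<open>For square-summable \<open>U\<close> the Fourier series \<open>\<Sum>n. U n * exp (- \<i> n \<bullet> \<xi>)\<close> is understood in
  \<open>L\<^sup>2\<close> of the period cell, extended periodically. The sum is therefore determined only up to
  null sets, and \<open>dft\<close> chooses one representative.\<close>

definition is_dft :: "(int ^ 'd::finite \<Rightarrow> complex) \<Rightarrow> (real ^ 'd \<Rightarrow> complex) \<Rightarrow> bool" where
  "is_dft U F \<longleftrightarrow>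
     F \<in> borel_measurable borel \<and>
     (\<forall>\<xi> n. F (\<xi> + (2 * pi) *\<^sub>R lattice_vec n) = F \<xi>) \<and>
     ((\<lambda>A. \<integral>\<^sup>+\<xi>\<in>cbox (\<chi> i. - pi) (\<chi> i. pi).
          ennreal ((norm (F \<xi> - (\<Sum>n\<in>A. U n * cis (- (lattice_vec n \<bullet> \<xi>)))))\<^sup>2) \<partial>lborel)
        \<longlongrightarrow> 0) (finite_subsets_at_top UNIV)"

definition dft :: "(int ^ 'd::finite \<Rightarrow> complex) \<Rightarrow> real ^ 'd \<Rightarrow> complex" where
  "dft U = (SOME F. is_dft U F)"

text \<open>The pairing of \<open>M\<^sup>\<epsilon>[U]\<close> with a test function \<open>a\<close>: the Dirac mass at \<open>h m\<close> acts on the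
  position variable, and the locally square-integrable factor acts on the frequency variable by
  integration. The duality bracket is bilinear.\<close>

definition M_distr ::
  "real \<Rightarrow> real \<Rightarrow> (int ^ 'd::finite \<Rightarrow> complex) \<Rightarrow> ((real ^ 'd) \<times> (real ^ 'd) \<Rightarrow> complex) \<Rightarrow> complex" where
  "M_distr h \<epsilon> U a =
     of_real (h ^ (2 * CARD('d)) / (2 * pi * \<epsilon>) ^ CARD('d)) *
     (\<Sum>\<^sub>\<infinity>m. cnj (U m) *
        (\<integral>\<xi>. dft U ((h / \<epsilon>) *\<^sub>R \<xi>) * cis (lattice_vec m \<bullet> ((h / \<epsilon>) *\<^sub>R \<xi>))
              * a (h *\<^sub>R lattice_vec m, \<xi>) \<partial>lborel))"

end

theory Submission
  imports Defs "HOL-Probability.Helly_Selection"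
begin

text \<open>Write \<open>A(x,p) = \<integral> exp(i p\<xi>) a(x,\<xi>) d\<xi>\<close> and \<open>c = h/\<epsilon>\<close>. The pairing of \<open>M\<^sup>\<epsilon>[U]\<close> with \<open>a\<close> is
  \<open>h\<^sup>d (c/2\<pi>)\<^sup>d \<Sum>m,n. cnj U\<^sub>m U\<^sub>n A(hm, c(m - n))\<close>. Integration by parts bounds \<open>A(x,p)\<close> by a
  multiple of \<open>\<Prod>i. 1 / (1 + p\<^sub>i\<^sup>2)\<close>, whose Riemann sums \<open>c\<^sup>d \<Sum>n. \<dots>(cn)\<close> are bounded as long as \<open>c\<close> is,
  so Schur's test yields boundedness.

  For positivity, replace \<open>A(hm, p)\<close> by the average of \<open>A(y, p)\<close> against
  \<open>w(y - hm) w(y - hn)\<close>, where \<open>w\<close> is a Lipschitz window of width \<open>\<delta>\<close>, normalised in \<open>L\<^sup>2\<close>. The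
  resulting form is the integral of \<open>a\<close> against the nonnegative density
  \<open>|\<Sum>m. U\<^sub>m w(y - hm) exp(-i m c\<xi>)|\<^sup>2\<close>. Since \<open>h(m - n) = \<epsilon>p\<close>, the error is
  \<open>O(\<delta> + \<epsilon>/\<delta>)\<close>, which vanishes for \<open>\<delta> = sqrt \<epsilon>\<close>. Weighted by \<open>\<Prod>i. 1 / (1 + \<xi>\<^sub>i\<^sup>2)\<close>, these densities
  have bounded mass, because the trigonometric sums are periodic in \<open>\<xi>\<close>; hence a
  subsequence converges vaguely, and the limit measure represents the limit distribution.

  Vague compactness in several dimensions is pulled back to Helly's theorem on the line along
  Schoenberg's space-filling curve.\<close>

section \<open>Vague compactness of bounded sequences of finite measures\<close>

text \<open>At a fixed scale the pairing is not positive: its kernel evaluates \<open>a\<close> at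
  the left point hm only, so it is not Hermitian in m and n even for real \<open>a\<close>.
  Positivity can only emerge in the limit. The window has to be wide compared with eps, so that the
  windows at hm and hn nearly coincide, yet narrow enough for \<open>a\<close> to be almost constant
  on it. The first demand costs a factor \<open>norm p\<close>, which is why
  \<open>freq_ft_decay\<close> carries one power beyond the Lorentz weight.

  The sequences are merely square summable, so each density is built from a finite piece of U whose
  complement has squared norm at most eps^2. Being periodic in frequency, the densities have
  infinite total mass in general. The weight makes the mass finite and is divided out of the limit,
  which is therefore a Radon measure but possibly an infinite one.

  The space-filling curve is continuous and has a Borel right inverse. Measures are pushed to the
  line by the inverse and test functions are pulled back by the curve, so the weak limit on the line
  only meets continuous functions.\<close>

definition schoenberg_wave :: "real \<Rightarrow> real" where
  "schoenberg_wave t = max 0 (min 1 (1/2 - cos (pi * t)))"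

definition binary_digit :: "nat \<Rightarrow> real \<Rightarrow> real" where
  "binary_digit k y = real_of_int (\<lfloor>2 ^ Suc k * y\<rfloor> mod 2)"

lemma binary_digit_01: "binary_digit k y = 0 \<or> binary_digit k y = 1"
proof -
  have "\<lfloor>2 ^ Suc k * y\<rfloor> mod 2 = 0 \<or> \<lfloor>2 ^ Suc k * y\<rfloor> mod 2 = 1"
    by presburger
  then show ?thesis unfolding binary_digit_def by auto
qed

lemma binary_digit_partial_sum:
  assumes "0 \<le> y" "y < 1"
  shows "(\<Sum>k<n. binary_digit k y / 2 ^ Suc k) = \<lfloor>2 ^ n * y\<rfloor> / 2 ^ n"
proof (induction n)
  case 0
  have "\<lfloor>y\<rfloor> = 0" using assms by (simp add: floor_eq_iff)
  then show ?case by simp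
next
  case (Suc n)
  have *: "\<lfloor>2 ^ Suc n * y\<rfloor> div 2 = \<lfloor>2 ^ n * y\<rfloor>"
    using floor_divide_real_eq_div[of 2 "2 ^ Suc n * y"] by simp
  have "\<lfloor>2 ^ Suc n * y\<rfloor> = 2 * \<lfloor>2 ^ n * y\<rfloor> + \<lfloor>2 ^ Suc n * y\<rfloor> mod 2"
    using * mult_div_mod_eq[of 2 "\<lfloor>2 ^ Suc n * y\<rfloor>"] by simp
  then have "real_of_int \<lfloor>2 ^ Suc n * y\<rfloor> = 2 * real_of_int \<lfloor>2 ^ n * y\<rfloor> + binary_digit n y"
    unfolding binary_digit_def by linarith
  then show ?case using Suc by (simp add: field_simps)
qed

lemma binary_digit_sums:
  assumes "0 \<le> y" "y < 1"
  shows "(\<lambda>k. binary_digit k y / 2 ^ Suc k) sums y"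
  unfolding sums_def binary_digit_partial_sum[OF assms]
proof (rule tendsto_sandwich)
  show "\<forall>\<^sub>F n in sequentially. y - (1/2) ^ n \<le> real_of_int \<lfloor>2 ^ n * y\<rfloor> / 2 ^ n"
  proof (intro always_eventually allI)
    fix n
    have "2 ^ n * y - 1 \<le> \<lfloor>2 ^ n * y\<rfloor>" by linarith
    then have "(2 ^ n * y - 1) / 2 ^ n \<le> \<lfloor>2 ^ n * y\<rfloor> / 2 ^ n" by (intro divide_right_mono) auto
    then show "y - (1/2) ^ n \<le> real_of_int \<lfloor>2 ^ n * y\<rfloor> / 2 ^ n"
      by (simp add: diff_divide_distrib power_one_over)
  qed
  show "\<forall>\<^sub>F n in sequentially. real_of_int \<lfloor>2 ^ n * y\<rfloor> / 2 ^ n \<le> y"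
    by (intro always_eventually allI) (simp add: field_simps)
  have "(\<lambda>n. y - (1/2) ^ n) \<longlonglongrightarrow> y - 0"
    by (intro tendsto_intros LIMSEQ_realpow_zero) auto
  then show "(\<lambda>n. y - (1/2) ^ n) \<longlonglongrightarrow> y" by simp
qed auto

lemma ternary_tail_sums: "(\<lambda>i. 2 / 3 ^ Suc (i + n) :: real) sums (1 / 3 ^ n)"
proof -
  have "(\<lambda>i. (2 / 3 ^ Suc n) * (1/3) ^ i :: real) sums ((2 / 3 ^ Suc n) * (1 / (1 - 1/3)))"
    by (intro sums_mult geometric_sums) simp
  then show ?thesis by (simp add: power_add field_simps)
qed

lemma ternary_summable:
  assumes "\<And>i. 0 \<le> c i \<and> c i \<le> (1::real)"
  shows "summable (\<lambda>i. 2 * c i / 3 ^ Suc i)"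
proof (rule summable_comparison_test)
  show "summable (\<lambda>i. 2 / 3 ^ Suc i :: real)" using ternary_tail_sums[of 0] by (auto dest: sums_summable)
qed (use assms in \<open>auto intro!: exI[of _ 0] divide_right_mono\<close>)

text \<open>Multiplication by 3^j shifts the ternary digits, all of which are 0 or 2. The digits
  before position j become an even integer, which disappears because the wave has period 2; digit j
  contributes 0 or 2/3, and the tail at most 1/3. The argument thus lies in [0, 1/3] or [2/3, 1],
  where the clipped cosine is constantly 0 or 1.\<close>

lemma schoenberg_wave_ternary:
  assumes c: "\<And>j. c j = 0 \<or> c j = (1::real)"
  shows "schoenberg_wave (3 ^ j * (\<Sum>i. 2 * c i / 3 ^ Suc i)) = c j"
proof -
  have c': "0 \<le> c i" "c i \<le> 1" for i using c[of i] by auto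
  have sm: "summable (\<lambda>i. 2 * c i / 3 ^ Suc i)" using c' by (intro ternary_summable) auto
  define r where "r = (\<Sum>i. 2 * c (i + Suc j) / 3 ^ Suc (i + Suc j))"
  have sm': "summable (\<lambda>i. 2 * c (i + Suc j) / 3 ^ Suc (i + Suc j))"
    using sm by (subst summable_iff_shift[where f="\<lambda>i. 2 * c i / 3 ^ Suc i"])
  have r0: "0 \<le> r" unfolding r_def using sm' c' by (intro suminf_nonneg) auto
  have r1: "r \<le> 1 / 3 ^ Suc j"
    unfolding r_def
    by (rule order_trans[OF suminf_le[OF _ sm' sums_summable[OF ternary_tail_sums[of "Suc j"]]]])
      (use c' ternary_tail_sums[of "Suc j"] in \<open>auto simp: sums_iff intro!: divide_right_mono\<close>)
  have "\<exists>m::int. 3 ^ j * (\<Sum>i<j. 2 * c i / 3 ^ Suc i) = 2 * of_int m"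
  proof (induction j)
    case 0 show ?case by (intro exI[of _ 0]) simp
  next
    case (Suc j)
    then obtain m :: int where "3 ^ j * (\<Sum>i<j. 2 * c i / 3 ^ Suc i) = 2 * of_int m" by blast
    moreover obtain d :: int where "c j = of_int d" using c[of j] by (metis of_int_0 of_int_1)
    ultimately have "3 ^ Suc j * (\<Sum>i<Suc j. 2 * c i / 3 ^ Suc i) = 2 * of_int (3 * m + d)"
      by (simp add: distrib_left)
    then show ?case by blast
  qed
  then obtain m :: int where m: "3 ^ j * (\<Sum>i<j. 2 * c i / 3 ^ Suc i) = 2 * of_int m" by blast
  have "(\<Sum>i. 2 * c i / 3 ^ Suc i) = r + (\<Sum>i<Suc j. 2 * c i / 3 ^ Suc i)"
    unfolding r_def by (rule suminf_split_initial_segment[OF sm])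
  then have e: "3 ^ j * (\<Sum>i. 2 * c i / 3 ^ Suc i) = (2 * c j / 3 + 3 ^ j * r) + 2 * of_int m"
    using m by (simp add: distrib_left)
  define u where "u = 2 * c j / 3 + 3 ^ j * r"
  have u: "2 * c j / 3 \<le> u" "u \<le> 2 * c j / 3 + 1/3"
  proof -
    show "2 * c j / 3 \<le> u" unfolding u_def using r0 by simp
    have "3 ^ j * r \<le> 3 ^ j * (1 / 3 ^ Suc j)" using r1 by (intro mult_left_mono) auto
    then show "u \<le> 2 * c j / 3 + 1/3" unfolding u_def by simp
  qed
  have "cos (pi * (u + 2 * of_int m)) = cos (pi * u)"
    using cos_add[of "pi * u" "2 * pi * of_int m"] by (simp only: cos_int_2pin sin_int_2pin) (simp add: algebra_simps)
  then have *: "schoenberg_wave (3 ^ j * (\<Sum>i. 2 * c i / 3 ^ Suc i)) = max 0 (min 1 (1/2 - cos (pi * u)))"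
    unfolding schoenberg_wave_def e u_def by simp
  show ?thesis
  proof (cases "c j = 0")
    case True
    then have "cos (pi / 3) \<le> cos (pi * u)"
      using u by (intro cos_monotone_0_pi_le) auto
    then show ?thesis unfolding * using True by (simp add: cos_60)
  next
    case False
    then have "c j = 1" using c by blast
    then have "cos (pi * u) \<le> cos (2 * pi / 3)"
      using u by (intro cos_monotone_0_pi_le) (auto simp: field_simps)
    then show ?thesis unfolding * using \<open>c j = 1\<close> by (simp add: cos_120)
  qed
qed

text \<open>The positions of the binary digits of the coordinates are interleaved by \<^const>\<open>prod_encode\<close>;
  this is Schoenberg's space-filling curve in dimension \<open>DIM('a)\<close>.\<close>

definition schoenberg_curve :: "real \<Rightarrow> 'a::euclidean_space" where
  "schoenberg_curve t = (\<Sum>b\<in>Basis.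
     (\<Sum>k. schoenberg_wave (3 ^ prod_encode (to_nat_on Basis b, k) * t) / 2 ^ Suc k) *\<^sub>R b)"

text \<open>A right inverse of the curve on the half-open unit cube, with values in the Cantor set:
  binary digits of the coordinates become ternary digits 0 and 2. It is discontinuous but Borel,
  being made of floors. At positions whose first index is no coordinate number,
  \<open>from_nat_into\<close> supplies some basis vector; the curve never reads these
  digits.\<close>

definition schoenberg_section :: "'a::euclidean_space \<Rightarrow> real" where
  "schoenberg_section y = (\<Sum>j. 2 * binary_digit (snd (prod_decode j))
      (y \<bullet> from_nat_into Basis (fst (prod_decode j))) / 3 ^ Suc j)"

lemma borel_measurable_schoenberg_section [measurable]:
  "schoenberg_section \<in> borel_measurable (borel :: 'a::euclidean_space measure)"
  unfolding schoenberg_section_def binary_digit_def by measurable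

lemma continuous_on_schoenberg_curve:
  "continuous_on UNIV (schoenberg_curve :: real \<Rightarrow> 'a::euclidean_space)"
proof -
  have "continuous_on UNIV (\<lambda>t. \<Sum>k. schoenberg_wave (3 ^ prod_encode (i, k) * t) / 2 ^ Suc k)" for i
  proof (rule uniform_limit_theorem[OF _ Weierstrass_m_test[where M="\<lambda>k. 1 / 2 ^ Suc k"]])
    show "\<forall>\<^sub>F n in sequentially. continuous_on UNIV
        (\<lambda>t. \<Sum>k<n. schoenberg_wave (3 ^ prod_encode (i, k) * t) / 2 ^ Suc k)"
      unfolding schoenberg_wave_def by (intro always_eventually allI continuous_intros) auto
    show "norm (schoenberg_wave (3 ^ prod_encode (i, k) * t) / 2 ^ Suc k) \<le> 1 / 2 ^ Suc k" for k t
      unfolding schoenberg_wave_def by (auto intro!: divide_right_mono)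
    show "summable (\<lambda>k. 1 / 2 ^ Suc k :: real)"
      using power_half_series by (auto simp: sums_iff power_one_over)
  qed auto
  then show ?thesis
    unfolding schoenberg_curve_def by (intro continuous_intros)
qed

lemma schoenberg_curve_section:
  assumes "\<And>b. b \<in> Basis \<Longrightarrow> 0 \<le> y \<bullet> b \<and> y \<bullet> b < 1"
  shows "schoenberg_curve (schoenberg_section y) = (y :: 'a::euclidean_space)"
proof -
  have "(\<Sum>k. schoenberg_wave (3 ^ prod_encode (to_nat_on Basis b, k) * schoenberg_section y) / 2 ^ Suc k)
      = y \<bullet> b" if b: "b \<in> Basis" for b :: 'a
  proof -
    have "schoenberg_wave (3 ^ prod_encode (to_nat_on Basis b, k) * schoenberg_section y)
        = binary_digit k (y \<bullet> b)" for k
      unfolding schoenberg_section_def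
      using b by (subst schoenberg_wave_ternary) (auto simp: binary_digit_01 countable_finite)
    then show ?thesis using binary_digit_sums[of "y \<bullet> b"] assms[OF b] by (simp add: sums_iff)
  qed
  then have "schoenberg_curve (schoenberg_section y) = (\<Sum>b\<in>Basis. (y \<bullet> b) *\<^sub>R b)"
    unfolding schoenberg_curve_def by simp
  then show ?thesis by (simp add: euclidean_representation)
qed

section \<open>A homeomorphism of the space with an open cube\<close>

definition to_cube :: "'a::euclidean_space \<Rightarrow> 'a" where
  "to_cube x = (\<Sum>b\<in>Basis. (1/2 + arctan (x \<bullet> b) / pi) *\<^sub>R b)"

definition from_cube :: "'a::euclidean_space \<Rightarrow> 'a" where
  "from_cube u = (\<Sum>b\<in>Basis. tan (pi * (u \<bullet> b - 1/2)) *\<^sub>R b)"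

definition open_cube :: "'a::euclidean_space set" where
  "open_cube = {u. \<forall>b\<in>Basis. 0 < u \<bullet> b \<and> u \<bullet> b < 1}"

lemma open_open_cube [intro]: "open (open_cube :: 'a::euclidean_space set)"
proof -
  have "open_cube = box 0 (\<Sum>Basis :: 'a)"
    unfolding open_cube_def box_def by (auto simp: inner_sum_left_Basis)
  then show ?thesis by (metis open_box)
qed

lemma to_cube_inner: "b \<in> Basis \<Longrightarrow> to_cube x \<bullet> b = 1/2 + arctan (x \<bullet> b) / pi"
  unfolding to_cube_def by simp

lemma from_cube_inner: "b \<in> Basis \<Longrightarrow> from_cube u \<bullet> b = tan (pi * (u \<bullet> b - 1/2))"
  unfolding from_cube_def by simp

lemma to_cube_in: "to_cube x \<in> open_cube"
  unfolding open_cube_def using arctan_bounded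
  by (auto simp: to_cube_inner field_simps) (smt (verit) arctan_bounded)+

lemma from_to_cube: "from_cube (to_cube x) = x"
  by (rule euclidean_eqI) (simp add: from_cube_inner to_cube_inner tan_arctan)

lemma to_from_cube:
  assumes "u \<in> open_cube" shows "to_cube (from_cube u) = u"
proof (rule euclidean_eqI)
  fix b :: 'a assume b: "b \<in> Basis"
  then have u: "0 < u \<bullet> b" "u \<bullet> b < 1" using assms by (auto simp: open_cube_def)
  have "pi * (u \<bullet> b) < pi * 1" using u by (intro mult_strict_left_mono) auto
  then have "arctan (tan (pi * (u \<bullet> b - 1/2))) = pi * (u \<bullet> b - 1/2)"
    using u by (intro arctan_tan) (auto simp: field_simps)
  then show "to_cube (from_cube u) \<bullet> b = u \<bullet> b"
    using b by (simp add: from_cube_inner to_cube_inner)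
qed

lemma continuous_on_to_cube: "continuous_on UNIV to_cube"
  unfolding to_cube_def by (intro continuous_intros) auto

lemma continuous_on_from_cube: "continuous_on open_cube from_cube"
proof -
  have "cos (pi * (u \<bullet> b - 1/2)) \<noteq> 0" if "u \<in> open_cube" "b \<in> Basis" for u b :: 'a
  proof -
    have u: "0 < u \<bullet> b" "u \<bullet> b < 1" using that by (auto simp: open_cube_def)
    have "pi * (u \<bullet> b) < pi * 1" using u by (intro mult_strict_left_mono) auto
    then have "0 < cos (pi * (u \<bullet> b - 1/2))"
      using u by (intro cos_gt_zero_pi) (auto simp: field_simps)
    then show ?thesis by simp
  qed
  then show ?thesis
    unfolding from_cube_def tan_def
    by (intro continuous_on_sum continuous_on_scaleR continuous_intros ballI) auto
qed

lemma borel_measurable_to_cube [measurable]: "to_cube \<in> borel_measurable borel"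
  by (rule borel_measurable_continuous_onI[OF continuous_on_to_cube])

lemma borel_measurable_from_cube [measurable]: "from_cube \<in> borel_measurable borel"
  unfolding from_cube_def tan_def by measurable

text \<open>Outside a large ball f is small, and the image of that ball is a compact subset of the
  open cube. A point outside the open cube has a neighbourhood that avoids this image, so the
  extension by 0 is continuous there. Mass that escapes to infinity then approaches the boundary of
  the cube, where test functions vanish.\<close>

lemma continuous_on_vanishing_extension:
  fixes f :: "'a::euclidean_space \<Rightarrow> 'b::real_normed_vector"
  assumes f: "continuous_on UNIV f" and v: "(f \<longlongrightarrow> 0) at_infinity"
  shows "continuous_on UNIV (\<lambda>u. if u \<in> open_cube then f (from_cube u) else 0)" (is "continuous_on _ ?T")
proof (rule continuous_at_imp_continuous_on, intro ballI)
  fix u :: 'a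
  show "isCont ?T u"
  proof (cases "u \<in> open_cube")
    case True
    have "continuous_on open_cube ?T"
      by (rule continuous_on_eq[where f="\<lambda>u. f (from_cube u)"])
        (auto intro!: continuous_on_compose2[OF f] continuous_on_from_cube)
    then show ?thesis using True continuous_on_eq_continuous_at[OF open_open_cube] by blast
  next
    case False
    show ?thesis unfolding isCont_def
    proof (rule tendstoI)
      fix e :: real assume "0 < e"
      then have "\<forall>\<^sub>F x in at_infinity. dist (f x) 0 < e" using v by (rule tendstoD[rotated])
      then obtain R where R: "\<And>x. R \<le> norm x \<Longrightarrow> norm (f x) < e"
        by (auto simp: eventually_at_infinity)
      let ?K = "to_cube ` cball (0::'a) R"
      have "compact ?K"
        by (rule compact_continuous_image) (auto intro: continuous_on_subset[OF continuous_on_to_cube])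
      then have "open (- ?K)" using compact_imp_closed by blast
      moreover have "u \<in> - ?K" using False to_cube_in by auto
      moreover have "dist (?T w) 0 < e" if "w \<in> - ?K" for w
      proof (cases "w \<in> open_cube")
        case True
        then have "from_cube w \<notin> cball 0 R" using that to_from_cube[OF True] by (metis ComplD imageI)
        then show ?thesis using R[of "from_cube w"] True by simp
      qed (use \<open>0 < e\<close> in simp)
      ultimately have "\<forall>\<^sub>F w in nhds u. dist (?T w) 0 < e"
        unfolding eventually_nhds by blast
      then show "\<forall>\<^sub>F w in at u. dist (?T w) (?T u) < e"
        using False by (simp add: eventually_nhds_conv_at)
    qed
  qed
qed

text \<open>The measures are normalised along a subsequence of convergent masses and pushed to
  [0, 1] by \<open>schoenberg_section\<close> after \<open>to_cube\<close>. Tightness is automatic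
  there, so a weak limit exists; the curve followed by \<open>from_cube\<close> carries it
  back.\<close>

theorem vague_compactness:
  fixes \<mu> :: "nat \<Rightarrow> 'a::euclidean_space measure"
  assumes sets: "\<And>k. sets (\<mu> k) = sets borel"
    and mass: "\<And>k. emeasure (\<mu> k) UNIV \<le> ennreal C"
  obtains s :: "nat \<Rightarrow> nat" and \<nu> :: "'a measure"
  where "strict_mono s" "finite_measure \<nu>" "sets \<nu> = sets borel"
    "\<And>f :: 'a \<Rightarrow> complex. continuous_on UNIV f \<Longrightarrow> (f \<longlongrightarrow> 0) at_infinity \<Longrightarrow>
       (\<lambda>k. \<integral>x. f x \<partial>\<mu> (s k)) \<longlonglongrightarrow> (\<integral>x. f x \<partial>\<nu>)"
proof -
  note [measurable_cong] = sets
  have sp: "space (\<mu> k) = UNIV" for k using sets_eq_imp_space_eq[OF sets[of k]] by simp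
  have fin: "finite_measure (\<mu> k)" for k
    by (rule finite_measureI) (use mass[of k] in \<open>auto simp: sp top_unique\<close>)
  interpret M: finite_measure "\<mu> k" for k by (rule fin)
  define m where "m k = measure (\<mu> k) UNIV" for k
  have m0: "0 \<le> m k" for k by (simp add: m_def)
  have m1: "m k \<le> max C 0" for k
    using mass[of k] unfolding M.emeasure_eq_measure m_def
    by (auto simp: ennreal_le_iff2)
  have "bounded (range m)" using m0 m1 by (auto simp: bounded_iff intro!: exI[of _ "max C 0"])
  then obtain m\<^sub>0 s1 where s1: "strict_mono s1" "(m \<circ> s1) \<longlonglongrightarrow> m\<^sub>0"
    using bounded_imp_convergent_subsequence by blast
  have bdd: "\<exists>B\<ge>0. \<forall>x. norm (f x) \<le> B" if "continuous_on UNIV f" "(f \<longlongrightarrow> 0) at_infinity" for f :: "'a \<Rightarrow> complex"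
  proof -
    have "\<forall>\<^sub>F x in at_infinity. dist (f x) 0 < 1" using that(2) by (rule tendstoD) simp
    then obtain R where R: "\<And>x. R \<le> norm x \<Longrightarrow> norm (f x) < 1"
      by (auto simp: eventually_at_infinity)
    have "compact (f ` cball 0 R)" by (intro compact_continuous_image continuous_on_subset[OF that(1)]) auto
    then obtain B where B: "\<And>x. norm x \<le> R \<Longrightarrow> norm (f x) \<le> B"
      using compact_imp_bounded bounded_iff by (metis image_eqI mem_cball_0)
    have "norm (f x) \<le> max 1 B" for x
      using B[of x] R[of x] by (cases "R \<le> norm x") auto
    then show ?thesis by (intro exI[of _ "max 1 B"]) auto
  qed
  have m\<^sub>0: "0 \<le> m\<^sub>0" by (rule LIMSEQ_le_const[OF s1(2)]) (auto simp: m0)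
  show thesis
  \<comment> \<open>If the masses tend to 0 there is nothing to normalise: all integrals tend to 0
    and the null measure is the limit.\<close>
  proof (cases "m\<^sub>0 = 0")
    case True
    show thesis
    proof
      show "strict_mono s1" by fact
      show "finite_measure (null_measure (borel :: 'a measure))" by (rule finite_measureI) simp
      fix f :: "'a \<Rightarrow> complex" assume f: "continuous_on UNIV f" "(f \<longlongrightarrow> 0) at_infinity"
      obtain B where B: "\<And>x. norm (f x) \<le> B" "0 \<le> B" using bdd[OF f] by blast
      have "norm (\<integral>x. f x \<partial>\<mu> k) \<le> B * m k" for k
      proof -
        have "f \<in> borel_measurable (\<mu> k)"
          unfolding measurable_cong_sets[OF sets refl] by (rule borel_measurable_continuous_onI[OF f(1)])
        then have "norm (\<integral>x. f x \<partial>\<mu> k) \<le> (\<integral>x. B \<partial>\<mu> k)"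
          using B by (intro Bochner_Integration.integral_norm_bound_integral M.integrable_const_bound[where B=B]) auto
        then show ?thesis by (simp add: m_def sp mult.commute)
      qed
      moreover have "(\<lambda>k. B * m (s1 k)) \<longlonglongrightarrow> 0"
        using tendsto_mult_left[OF s1(2), of B] True by (simp add: o_def)
      ultimately show "(\<lambda>k. \<integral>x. f x \<partial>\<mu> (s1 k)) \<longlonglongrightarrow> (\<integral>x. f x \<partial>null_measure borel)"
        by (simp add: integral_null_measure) (rule Lim_null_comparison[OF always_eventually], auto)
    qed simp
  next
    case False
    then have "0 < m\<^sub>0" using m\<^sub>0 by simp
    then have "\<forall>\<^sub>F k in sequentially. 0 < (m \<circ> s1) k" using order_tendstoD(1)[OF s1(2)] by blast
    then obtain K where K: "\<And>k. K \<le> k \<Longrightarrow> 0 < m (s1 k)" by (auto simp: eventually_sequentially)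
    \<comment> \<open>Dropping finitely many indices makes every mass positive, so that each
      \<open>P k\<close> is a probability measure.\<close>
    define s2 where "s2 k = s1 (k + K)" for k
    have s2: "strict_mono s2" unfolding s2_def using s1(1) by (auto simp: strict_mono_def)
    have ms2: "0 < m (s2 k)" for k unfolding s2_def by (rule K) simp
    have ms2_lim: "(\<lambda>k. m (s2 k)) \<longlonglongrightarrow> m\<^sub>0"
      unfolding s2_def using LIMSEQ_ignore_initial_segment[OF s1(2), of K] by (simp add: o_def)
    define \<sigma> where "\<sigma> x = schoenberg_section (to_cube x)" for x :: 'a
    have \<sigma>_meas[measurable]: "\<sigma> \<in> borel_measurable borel" unfolding \<sigma>_def by measurable
    have curve_meas[measurable]: "(schoenberg_curve :: real \<Rightarrow> 'a) \<in> borel_measurable borel"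
      by (rule borel_measurable_continuous_onI[OF continuous_on_schoenberg_curve])
    have \<sigma>: "schoenberg_curve (\<sigma> x) = to_cube x" for x
      unfolding \<sigma>_def using to_cube_in[of x]
      by (intro schoenberg_curve_section) (auto simp: open_cube_def less_imp_le)
    define P where "P k = distr (density (\<mu> (s2 k)) (\<lambda>_. ennreal (1 / m (s2 k)))) borel \<sigma>" for k
    have P_real: "real_distribution (P k)" for k
    proof -
      have "prob_space (density (\<mu> (s2 k)) (\<lambda>_. ennreal (1 / m (s2 k))))"
        using ms2[of k]
        by (intro prob_spaceI) (simp add: emeasure_density_const sp M.emeasure_eq_measure sets m_def ennreal_mult'[symmetric])
      then have "prob_space (P k)" unfolding P_def
        by (rule prob_space.prob_space_distr) simp
      then show ?thesis unfolding real_distribution_def real_distribution_axioms_def P_def by simp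
    qed
    \<comment> \<open>The section takes values in [0, 1]; the half-open interval around it has the
      shape demanded by \<open>tight\<close>.\<close>
    have P_bound: "measure (P k) {-1<..2} = 1" for k
    proof -
      interpret real_distribution "P k" by (rule P_real)
      have "0 \<le> \<sigma> x \<and> \<sigma> x \<le> 1" for x
      proof -
        let ?c = "\<lambda>j. binary_digit (snd (prod_decode j)) (to_cube x \<bullet> from_nat_into Basis (fst (prod_decode j)))"
        have c: "0 \<le> ?c j" "?c j \<le> 1" for j using binary_digit_01 by (smt (verit))+
        have geo: "(\<lambda>i. 2 / 3 ^ Suc i :: real) sums 1" using ternary_tail_sums[of 0] by simp
        have sm: "summable (\<lambda>i. 2 * ?c i / 3 ^ Suc i)" using c by (intro ternary_summable) auto
        have "(\<Sum>i. 2 * ?c i / 3 ^ Suc i) \<le> (\<Sum>i. 2 / 3 ^ Suc i)"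
          using c by (intro suminf_le sm sums_summable[OF geo]) (auto intro!: divide_right_mono)
        moreover have "0 \<le> (\<Sum>i. 2 * ?c i / 3 ^ Suc i)"
          using c by (intro suminf_nonneg sm) auto
        ultimately show ?thesis
          using geo unfolding \<sigma>_def schoenberg_section_def by (simp add: sums_iff)
      qed
      then have *: "\<sigma> x \<in> {-1<..2}" for x by (smt (verit) greaterThanAtMost_iff)
      have "AE x in P k. x \<in> {-1<..2}"
        unfolding P_def by (subst AE_distr_iff) (use * in auto)
      then show ?thesis by (subst prob_eq_1) auto
    qed
    have "tight P"
      unfolding tight_def using P_real P_bound
      by (intro conjI allI impI exI[of _ "-1::real"] exI[of _ "2::real"]) auto
    from tight_imp_convergent_subsubsequence[OF this, of id]
    obtain r Q where r: "strict_mono r" and Q: "real_distribution Q" and wc: "weak_conv_m (P \<circ> id \<circ> r) Q"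
      by (auto simp: strict_mono_def)
    interpret Q: real_distribution Q by (rule Q)
    \<comment> \<open>The parameters left out are mapped to the boundary of the cube. They carry the
      mass lost at infinity, so \<open>\<nu>\<close> can be lighter than the limit of the
      masses.\<close>
    define I where "I = {t. (schoenberg_curve t :: 'a) \<in> open_cube}"
    have I[measurable]: "I \<in> sets borel"
    proof -
      have "open_cube \<in> sets (borel :: 'a measure)" by (rule borel_open[OF open_open_cube])
      from measurable_sets[OF curve_meas this] show ?thesis by (simp add: I_def vimage_def)
    qed
    define \<nu> where "\<nu> = distr (density Q (\<lambda>t. ennreal m\<^sub>0 * indicator I t)) borel
      (\<lambda>t. from_cube (schoenberg_curve t) :: 'a)"
    show thesis
    proof
      show "strict_mono (s2 \<circ> r)" using s2 r by (rule strict_mono_o)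
      show "sets \<nu> = sets borel" by (simp add: \<nu>_def)
      have "finite_measure (density Q (\<lambda>t. ennreal m\<^sub>0 * indicator I t))"
      proof (rule finite_measureI)
        have "emeasure (density Q (\<lambda>t. ennreal m\<^sub>0 * indicator I t)) UNIV = ennreal m\<^sub>0 * emeasure Q I"
          by (subst emeasure_density) (auto simp: nn_integral_cmult)
        then show "emeasure (density Q (\<lambda>t. ennreal m\<^sub>0 * indicator I t))
            (space (density Q (\<lambda>t. ennreal m\<^sub>0 * indicator I t))) \<noteq> \<infinity>"
          by (simp add: Q.emeasure_eq_measure ennreal_mult_eq_top_iff)
      qed
      then show "finite_measure \<nu>" unfolding \<nu>_def
        by (rule finite_measure.finite_measure_distr) simp
      fix f :: "'a \<Rightarrow> complex" assume f: "continuous_on UNIV f" "(f \<longlongrightarrow> 0) at_infinity"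
      have [measurable]: "f \<in> borel_measurable borel" using f by (simp add: borel_measurable_continuous_onI)
      \<comment> \<open>\<open>H\<close> is continuous although \<open>\<sigma>\<close> is not, and
        \<open>H (\<sigma> x) = f x\<close> because the curve undoes the section. Integrals of
        \<open>f\<close> thus become integrals of a bounded continuous function on the line.\<close>
      define H where "H t = (if (schoenberg_curve t :: 'a) \<in> open_cube then f (from_cube (schoenberg_curve t)) else 0)" for t
      have Hc: "isCont H t" for t
      proof -
        have "continuous_on UNIV H" unfolding H_def
          using continuous_on_compose2[OF continuous_on_vanishing_extension[OF f]
              continuous_on_schoenberg_curve[where 'a='a]] by simp
        then show ?thesis by (simp add: continuous_on_eq_continuous_at)
      qed
      have [measurable]: "H \<in> borel_measurable borel"
        using Hc by (auto intro!: borel_measurable_continuous_onI continuous_at_imp_continuous_on)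
      obtain B where B: "\<And>x. norm (f x) \<le> B" "0 \<le> B" using bdd[OF f] by blast
      have HB: "norm (H t) \<le> B" for t using B by (simp add: H_def)
      have 1: "(\<integral>x. f x \<partial>\<mu> (s2 k)) = m (s2 k) *\<^sub>R (\<integral>t. H t \<partial>P k)" for k
      proof -
        have "(\<integral>t. H t \<partial>P k) = (\<integral>x. H (\<sigma> x) \<partial>density (\<mu> (s2 k)) (\<lambda>_. ennreal (1 / m (s2 k))))"
          unfolding P_def by (rule integral_distr) auto
        also have "\<dots> = (1 / m (s2 k)) *\<^sub>R (\<integral>x. H (\<sigma> x) \<partial>\<mu> (s2 k))"
          using ms2[of k] by (subst integral_density) auto
        also have "\<dots> = (1 / m (s2 k)) *\<^sub>R (\<integral>x. f x \<partial>\<mu> (s2 k))"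
          by (simp add: H_def \<sigma> to_cube_in from_to_cube)
        finally show ?thesis using ms2[of k] by simp
      qed
      have "(\<lambda>k. \<integral>t. H t \<partial>(P \<circ> id \<circ> r) k) \<longlonglongrightarrow> (\<integral>t. H t \<partial>Q)"
        by (rule weak_conv_imp_integral_bdd_continuous_conv[OF _ Q wc Hc HB]) (simp add: P_real)
      moreover have "(\<lambda>k. m (s2 (r k))) \<longlonglongrightarrow> m\<^sub>0"
        using LIMSEQ_subseq_LIMSEQ[OF ms2_lim r] by (simp add: o_def)
      ultimately have "(\<lambda>k. m (s2 (r k)) *\<^sub>R (\<integral>t. H t \<partial>P (r k))) \<longlonglongrightarrow> m\<^sub>0 *\<^sub>R (\<integral>t. H t \<partial>Q)"
        by (intro tendsto_scaleR) auto
      moreover have "(\<integral>x. f x \<partial>\<nu>) = m\<^sub>0 *\<^sub>R (\<integral>t. H t \<partial>Q)"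
      proof -
        have "(\<integral>x. f x \<partial>\<nu>) = (\<integral>t. f (from_cube (schoenberg_curve t)) \<partial>density Q (\<lambda>t. ennreal (m\<^sub>0 * indicator I t)))"
          unfolding \<nu>_def using m\<^sub>0
          by (subst integral_distr) (auto simp: ennreal_mult' ennreal_indicator)
        also have "\<dots> = (\<integral>t. (m\<^sub>0 * indicator I t) *\<^sub>R f (from_cube (schoenberg_curve t)) \<partial>Q)"
          using m\<^sub>0 by (subst integral_density) auto
        also have "\<dots> = (\<integral>t. m\<^sub>0 *\<^sub>R H t \<partial>Q)"
          by (intro Bochner_Integration.integral_cong) (auto simp: H_def I_def indicator_def)
        finally show ?thesis by simp
      qed
      ultimately show "(\<lambda>k. \<integral>x. f x \<partial>\<mu> ((s2 \<circ> r) k)) \<longlonglongrightarrow> (\<integral>x. f x \<partial>\<nu>)"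
        by (simp add: 1)
    qed
  qed
qed

section \<open>Lattice sums\<close>

lemma lattice_vec_diff: "lattice_vec (m - n) = lattice_vec m - lattice_vec n"
  by (simp add: lattice_vec_def vec_eq_iff)

lemma lattice_vec_nth [simp]: "lattice_vec n $ i = real_of_int (n $ i)"
  by (simp add: lattice_vec_def)

section \<open>The product weight and its lattice sums\<close>

text \<open>The product form, rather than a power of 1 + |p|^2, lets sums over boxes of lattice
  points factor into one-dimensional sums with an explicit arctan bound. The same weight serves the
  frequency and its dual variable.\<close>

definition lorentz :: "real ^ 'd::finite \<Rightarrow> real" where
  "lorentz p = (\<Prod>i\<in>UNIV. 1 / (1 + (p $ i)\<^sup>2))"

lemma lorentz_pos: "0 < lorentz p"
  unfolding lorentz_def by (intro prod_pos ballI) (simp add: add_pos_nonneg)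

lemma lorentz_nonneg [simp]: "0 \<le> lorentz p"
  using lorentz_pos[of p] by simp

lemma continuous_on_lorentz: "continuous_on UNIV lorentz"
proof -
  have "1 + (x $ i)\<^sup>2 \<noteq> 0" for x :: "real ^ 'a" and i
    by (smt (verit) zero_le_power2)
  then show ?thesis unfolding lorentz_def by (intro continuous_intros) auto
qed

lemma borel_measurable_lorentz [measurable]: "lorentz \<in> borel_measurable borel"
  by (rule borel_measurable_continuous_onI[OF continuous_on_lorentz])

lemma continuous_on_lorentz_snd:
  "continuous_on UNIV (\<lambda>z :: (real ^ 'd::finite) \<times> (real ^ 'd). lorentz (snd z))"
  by (rule continuous_on_compose2[OF continuous_on_lorentz]) (auto intro!: continuous_intros)

text \<open>Each factor satisfies 1 + p_i^2 \<le> (1 + q)^2. This converts 2d powers of polynomial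
  decay into one Lorentz weight.\<close>

lemma one_le_power_lorentz:
  fixes p :: "real ^ 'd::finite"
  assumes q: "\<And>i. \<bar>p $ i\<bar> \<le> q"
  shows "1 \<le> (1 + q) ^ (2 * CARD('d)) * lorentz p"
proof -
  have q0: "0 \<le> q" by (rule order_trans[OF abs_ge_zero q])
  have "(\<Prod>i\<in>(UNIV :: 'd set). 1) \<le> (\<Prod>i\<in>UNIV. (1 + q)\<^sup>2 * (1 / (1 + (p $ i)\<^sup>2)))"
  proof (rule prod_mono, intro conjI)
    fix i
    have "\<bar>p $ i\<bar>\<^sup>2 \<le> q\<^sup>2" using q[of i] by (rule power_mono) simp
    then have "1 + (p $ i)\<^sup>2 \<le> (1 + q)\<^sup>2" using q0 by (simp add: power2_sum)
    then show "1 \<le> (1 + q)\<^sup>2 * (1 / (1 + (p $ i)\<^sup>2))" by (simp add: add_pos_nonneg)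
  qed simp
  also have "\<dots> = ((1 + q)\<^sup>2) ^ CARD('d) * lorentz p"
    by (simp only: lorentz_def prod.distrib prod_constant)
  finally show ?thesis by (simp add: power_mult)
qed

lemma lorentz_mono:
  assumes "\<And>i. \<bar>q $ i\<bar> \<le> \<bar>p $ i\<bar>"
  shows "lorentz p \<le> lorentz q"
  unfolding lorentz_def
proof (rule prod_mono)
  fix i
  have "(q $ i)\<^sup>2 \<le> (p $ i)\<^sup>2" using assms[of i] by (simp add: abs_le_square_iff)
  then show "0 \<le> 1 / (1 + (p $ i)\<^sup>2) \<and> 1 / (1 + (p $ i)\<^sup>2) \<le> 1 / (1 + (q $ i)\<^sup>2)"
    by (auto intro!: divide_left_mono mult_pos_pos simp: add_pos_nonneg)
qed

text \<open>Apart from \<open>j = 0\<close>, the terms form lower Riemann sums of \<open>arctan'\<close> on both half-lines.\<close>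

lemma arctan_riemann_sum:
  fixes c :: real
  assumes "0 < c"
  shows "(\<Sum>j\<in>{- int R..int R}. c / (1 + (c * j)\<^sup>2)) \<le> c + pi"
proof -
  have "(\<Sum>j\<in>{- int R..int R}. c / (1 + (c * j)\<^sup>2)) \<le> c + 2 * arctan (c * R)"
  proof (induction R)
    case (Suc R)
    have e: "{- int (Suc R)..int (Suc R)} = insert (- int (Suc R)) (insert (int (Suc R)) {- int R..int R})"
      by auto
    let ?x = "c * real R" and ?y = "c * real (Suc R)"
    have "?x < ?y" using assms by simp
    then have "\<exists>z. z > ?x \<and> z < ?y \<and> arctan ?y - arctan ?x = (?y - ?x) * (1 / (1 + z\<^sup>2))"
      by (intro MVT2) (auto intro!: derivative_eq_intros simp: inverse_eq_divide)
    then obtain z where z: "?x < z" "z < ?y" "arctan ?y - arctan ?x = (?y - ?x) * (1 / (1 + z\<^sup>2))"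
      by blast
    have "0 \<le> ?x" using assms by simp
    then have "z\<^sup>2 \<le> ?y\<^sup>2" using z by (intro power_mono) auto
    then have "1 / (1 + ?y\<^sup>2) \<le> 1 / (1 + z\<^sup>2)"
      by (intro divide_left_mono) (auto simp: add_pos_nonneg)
    then have "c * (1 / (1 + ?y\<^sup>2)) \<le> c * (1 / (1 + z\<^sup>2))"
      using assms by (intro mult_left_mono) auto
    then have "c / (1 + ?y\<^sup>2) \<le> arctan ?y - arctan ?x" using z(3) by (simp add: algebra_simps)
    moreover have "(c * real_of_int (- int (Suc R)))\<^sup>2 = ?y\<^sup>2"
      by (simp add: power2_eq_square algebra_simps)
    ultimately show ?case unfolding e using Suc.IH by simp
  qed simp
  moreover have "arctan (c * R) \<le> pi / 2" using arctan_ubound[of "c * R"] by simp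
  ultimately show ?thesis by simp
qed

text \<open>A finite set lies in a box, over which the sum of products is the product of d
  one-dimensional sums, each at most c + pi. The summand pi is the total variation of arctan and c
  is the term at 0.\<close>

lemma lorentz_lattice_sum:
  fixes B :: "(int ^ 'd::finite) set"
  assumes "finite B" "0 < c"
  shows "c ^ CARD('d) * (\<Sum>n\<in>B. lorentz (c *\<^sub>R lattice_vec n)) \<le> (c + pi) ^ CARD('d)"
proof -
  define g where "g j = c / (1 + (c * real_of_int j)\<^sup>2)" for j
  have g0: "0 \<le> g j" for j using assms(2) by (auto simp: g_def)
  have "finite ((\<lambda>(n, i). nat \<bar>n $ i\<bar>) ` (B \<times> UNIV))" using assms(1) by simp
  then obtain R where "\<And>k. k \<in> (\<lambda>(n, i). nat \<bar>n $ i\<bar>) ` (B \<times> UNIV) \<Longrightarrow> k \<le> R"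
    using finite_nat_set_iff_bounded_le by metis
  then have R: "nat \<bar>n $ i\<bar> \<le> R" if "n \<in> B" for n i using that by force
  have sub: "(\<lambda>n i. n $ i) ` B \<subseteq> PiE UNIV (\<lambda>_. {- int R..int R})"
  proof (clarsimp simp: PiE_iff)
    fix n i assume "n \<in> B"
    with R[of n i] show "- int R \<le> n $ i \<and> n $ i \<le> int R" by linarith
  qed
  have "c ^ CARD('d) * lorentz (c *\<^sub>R lattice_vec n) = (\<Prod>i\<in>UNIV. g (n $ i))" for n :: "int ^ 'd"
    unfolding lorentz_def g_def by (simp add: prod_dividef)
  then have "c ^ CARD('d) * (\<Sum>n\<in>B. lorentz (c *\<^sub>R lattice_vec n)) = (\<Sum>n\<in>B. \<Prod>i\<in>UNIV. g (n $ i))"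
    by (simp add: sum_distrib_left)
  also have "\<dots> = (\<Sum>f\<in>(\<lambda>n i. n $ i) ` B. \<Prod>i\<in>UNIV. g (f i))"
    by (subst sum.reindex) (auto simp: inj_on_def vec_eq_iff fun_eq_iff)
  also have "\<dots> \<le> (\<Sum>f\<in>PiE (UNIV :: 'd set) (\<lambda>_. {- int R..int R}). \<Prod>i\<in>UNIV. g (f i))"
    using sub g0 by (intro sum_mono2) (auto intro!: finite_PiE prod_nonneg)
  also have "\<dots> = (\<Prod>i\<in>(UNIV::'d set). \<Sum>j\<in>{- int R..int R}. g j)"
    by (rule prod_sum_PiE[symmetric]) auto
  also have "\<dots> \<le> (\<Prod>i\<in>(UNIV::'d set). c + pi)"
    using arctan_riemann_sum[OF assms(2), of R] g0
    by (intro prod_mono) (auto simp: g_def intro!: sum_nonneg)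
  finally show ?thesis by simp
qed

section \<open>Schur's test\<close>

lemma am_gm_weighted:
  fixes x y t :: real
  assumes "0 < t" shows "x * y \<le> (t * x\<^sup>2 + y\<^sup>2 / t) / 2"
proof -
  have "0 \<le> (t * x - y)\<^sup>2 / t" using assms by simp
  also have "\<dots> = t * x\<^sup>2 + y\<^sup>2 / t - 2 * (x * y)"
    using assms by (simp add: power2_diff field_simps power2_eq_square)
  finally show ?thesis by simp
qed

text \<open>Rows and columns of the kernel have the same lattice-sum bound after translation, and
  the weighted arithmetic-geometric inequality separates u from v. The free parameter t matters when
  one factor is a small tail: a suitable t then makes both terms small.\<close>

lemma schur_lorentz:
  fixes u v :: "int ^ 'd::finite \<Rightarrow> real"
  assumes fin: "finite P" "finite B" and c: "0 < c" and t: "0 < t"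
  shows "c ^ CARD('d) * (\<Sum>m\<in>P. \<Sum>n\<in>B. \<bar>u m\<bar> * \<bar>v n\<bar> * lorentz (c *\<^sub>R lattice_vec (m - n)))
    \<le> (c + pi) ^ CARD('d) / 2 * (t * (\<Sum>m\<in>P. (u m)\<^sup>2) + (\<Sum>n\<in>B. (v n)\<^sup>2) / t)"
proof -
  let ?w = "\<lambda>m n. lorentz (c *\<^sub>R lattice_vec (m - n))" and ?K = "(c + pi) ^ CARD('d)"
  have am_gm: "\<bar>x\<bar> * \<bar>y\<bar> \<le> (t * x\<^sup>2 + y\<^sup>2 / t) / 2" for x y :: real
    using am_gm_weighted[OF t, of "\<bar>x\<bar>" "\<bar>y\<bar>"] by simp
  have row: "c ^ CARD('d) * (\<Sum>n\<in>B. ?w m n) \<le> ?K" for m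
  proof -
    have "(\<Sum>n\<in>B. ?w m n) = (\<Sum>k\<in>(\<lambda>n. m - n) ` B. lorentz (c *\<^sub>R lattice_vec k))"
      by (subst sum.reindex) (auto simp: inj_on_def)
    then show ?thesis using lorentz_lattice_sum[OF finite_imageI[OF fin(2)] c] by simp
  qed
  have col: "c ^ CARD('d) * (\<Sum>m\<in>P. ?w m n) \<le> ?K" for n
  proof -
    have "(\<Sum>m\<in>P. ?w m n) = (\<Sum>k\<in>(\<lambda>m. m - n) ` P. lorentz (c *\<^sub>R lattice_vec k))"
      by (subst sum.reindex) (auto simp: inj_on_def)
    then show ?thesis using lorentz_lattice_sum[OF finite_imageI[OF fin(1)] c] by simp
  qed
  have "(\<Sum>m\<in>P. \<Sum>n\<in>B. \<bar>u m\<bar> * \<bar>v n\<bar> * ?w m n)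
      \<le> (\<Sum>m\<in>P. \<Sum>n\<in>B. (t * (u m)\<^sup>2 + (v n)\<^sup>2 / t) / 2 * ?w m n)"
    by (intro sum_mono mult_right_mono am_gm) auto
  also have "\<dots> = t / 2 * (\<Sum>m\<in>P. (u m)\<^sup>2 * (\<Sum>n\<in>B. ?w m n)) + (\<Sum>m\<in>P. \<Sum>n\<in>B. (v n)\<^sup>2 / t / 2 * ?w m n)"
    by (simp add: sum.distrib distrib_right add_divide_distrib sum_distrib_left algebra_simps)
  also have "(\<Sum>m\<in>P. \<Sum>n\<in>B. (v n)\<^sup>2 / t / 2 * ?w m n) = 1 / (2 * t) * (\<Sum>n\<in>B. (v n)\<^sup>2 * (\<Sum>m\<in>P. ?w m n))"
    by (subst sum.swap) (simp add: sum_distrib_left mult_ac)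
  finally have "c ^ CARD('d) * (\<Sum>m\<in>P. \<Sum>n\<in>B. \<bar>u m\<bar> * \<bar>v n\<bar> * ?w m n)
      \<le> c ^ CARD('d) * (t / 2 * (\<Sum>m\<in>P. (u m)\<^sup>2 * (\<Sum>n\<in>B. ?w m n))
        + 1 / (2 * t) * (\<Sum>n\<in>B. (v n)\<^sup>2 * (\<Sum>m\<in>P. ?w m n)))"
    using c by (intro mult_left_mono) auto
  also have "\<dots> = t / 2 * (\<Sum>m\<in>P. (u m)\<^sup>2 * (c ^ CARD('d) * (\<Sum>n\<in>B. ?w m n)))
        + 1 / (2 * t) * (\<Sum>n\<in>B. (v n)\<^sup>2 * (c ^ CARD('d) * (\<Sum>m\<in>P. ?w m n)))"
    by (simp add: distrib_left sum_distrib_left mult_ac)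
  also have "\<dots> \<le> t / 2 * (\<Sum>m\<in>P. (u m)\<^sup>2 * ?K) + 1 / (2 * t) * (\<Sum>n\<in>B. (v n)\<^sup>2 * ?K)"
    using t by (intro add_mono mult_left_mono sum_mono row col) auto
  also have "\<dots> = ?K / 2 * (t * (\<Sum>m\<in>P. (u m)\<^sup>2) + (\<Sum>n\<in>B. (v n)\<^sup>2) / t)"
    by (simp add: sum_distrib_right[symmetric] field_simps)
  finally show ?thesis .
qed

section \<open>Periodic functions integrated against the weight\<close>

abbreviation (input) torus_cell :: "(real ^ 'd::finite) set" where
  "torus_cell \<equiv> cbox (\<chi> i. - pi) (\<chi> i. pi)"

lemma lattice_translates_cover:
  fixes x :: "real ^ 'd::finite"
  obtains n :: "int ^ 'd" where "x - (2 * pi) *\<^sub>R lattice_vec n \<in> torus_cell"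
proof
  let ?n = "(\<chi> i. \<lfloor>(x $ i + pi) / (2 * pi)\<rfloor>) :: int ^ 'd"
  have "- pi \<le> x $ i - 2 * pi * \<lfloor>(x $ i + pi) / (2 * pi)\<rfloor> \<and>
      x $ i - 2 * pi * \<lfloor>(x $ i + pi) / (2 * pi)\<rfloor> \<le> pi" for i
  proof -
    let ?f = "\<lfloor>(x $ i + pi) / (2 * pi)\<rfloor>"
    have "?f \<le> (x $ i + pi) / (2 * pi)" "(x $ i + pi) / (2 * pi) \<le> ?f + 1" by linarith+
    then have "?f * (2 * pi) \<le> x $ i + pi" "x $ i + pi \<le> (?f + 1) * (2 * pi)"
      using pi_gt_zero by (simp_all only: pos_le_divide_eq pos_divide_le_eq mult_pos_pos zero_less_numeral)
    then show ?thesis by (simp add: algebra_simps)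
  qed
  then show "x - (2 * pi) *\<^sub>R lattice_vec ?n \<in> torus_cell"
    by (simp add: mem_box_cart)
qed

text \<open>For n_i \<noteq> 0 one has |y_i + 2 pi n_i| \<ge> 2 pi |n_i| - pi \<ge> pi |n_i|. On
  each translated cell the weight is thus bounded by a lattice term that depends on
  \<open>c0\<close> only.\<close>

lemma lorentz_translate_le:
  fixes y :: "real ^ 'd::finite"
  assumes y: "y \<in> torus_cell" and c: "0 < c" "c \<le> c0"
  shows "lorentz ((1 / c) *\<^sub>R (y + (2 * pi) *\<^sub>R lattice_vec n)) \<le> lorentz ((pi / c0) *\<^sub>R lattice_vec n)"
proof (rule lorentz_mono)
  fix i
  have yi: "\<bar>y $ i\<bar> \<le> pi" using y by (auto simp: mem_box_cart abs_le_iff)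
       (metis minus_le_iff)
  have "pi * \<bar>real_of_int (n $ i)\<bar> \<le> \<bar>y $ i + 2 * pi * real_of_int (n $ i)\<bar>"
  proof (cases "n $ i = 0")
    case False
    then have "1 \<le> \<bar>real_of_int (n $ i)\<bar>" by linarith
    then have "pi * 1 \<le> pi * \<bar>real_of_int (n $ i)\<bar>" by (intro mult_left_mono) auto
    moreover have "\<bar>2 * pi * real_of_int (n $ i)\<bar> = 2 * (pi * \<bar>real_of_int (n $ i)\<bar>)"
      by (simp add: abs_mult)
    ultimately show ?thesis using yi by linarith
  qed simp
  then have "pi * \<bar>real_of_int (n $ i)\<bar> / c0 \<le> \<bar>y $ i + 2 * pi * real_of_int (n $ i)\<bar> / c"
    using c by (intro frac_le) auto
  then show "\<bar>((pi / c0) *\<^sub>R lattice_vec n) $ i\<bar> \<le> \<bar>((1 / c) *\<^sub>R (y + (2 * pi) *\<^sub>R lattice_vec n)) $ i\<bar>"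
    using c by (simp add: abs_mult abs_divide)
qed

lemma infinite_UNIV_int_vec: "infinite (UNIV :: (int ^ 'd::finite) set)"
proof
  assume "finite (UNIV :: (int ^ 'd) set)"
  then have "finite (range (\<lambda>k. (\<chi> i. k) :: int ^ 'd))" by (rule finite_subset[rotated]) simp
  then have "finite (UNIV :: int set)" by (rule finite_imageD) (auto simp: inj_on_def vec_eq_iff)
  then show False by simp
qed

lemma nn_integral_lborel_scaleR:
  fixes f :: "'a::euclidean_space \<Rightarrow> ennreal"
  assumes [measurable]: "f \<in> borel_measurable borel" and c: "0 < c"
  shows "(\<integral>\<^sup>+x. f x \<partial>lborel) = ennreal (c ^ DIM('a)) * (\<integral>\<^sup>+x. f (c *\<^sub>R x) \<partial>lborel)"
  using c by (subst lborel_affine[of c 0])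
    (auto simp: nn_integral_density nn_integral_distr nn_integral_cmult ennreal_power[symmetric])

lemma nn_integral_lborel_translate:
  fixes f :: "'a::euclidean_space \<Rightarrow> ennreal"
  assumes [measurable]: "f \<in> borel_measurable borel"
  shows "(\<integral>\<^sup>+x. f (a + x) \<partial>lborel) = (\<integral>\<^sup>+x. f x \<partial>lborel)"
  by (subst (2) lborel_distr_plus[of a, symmetric]) (simp add: nn_integral_distr)

text \<open>Substituting y = c x produces the factor 1 / c^d. The space is then covered by
  translated cells; periodicity leaves the same cell integral on each, multiplied by the bound of
  the weight there. By \<open>lorentz_lattice_sum\<close> with spacing pi / c0 these bounds add up
  to at most (1 + c0)^d.\<close>

lemma nn_integral_periodic_lorentz:
  fixes g :: "real ^ 'd::finite \<Rightarrow> ennreal"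
  assumes [measurable]: "g \<in> borel_measurable borel"
    and per: "\<And>x n. g (x + (2 * pi) *\<^sub>R lattice_vec n) = g x"
    and c: "0 < c" "c \<le> c0"
  shows "(\<integral>\<^sup>+x. g (c *\<^sub>R x) * ennreal (lorentz x) \<partial>lborel)
    \<le> ennreal ((1 + c0) ^ CARD('d) / c ^ CARD('d)) * (\<integral>\<^sup>+x\<in>torus_cell. g x \<partial>lborel)"
proof -
  have c0: "0 < c0" using c by simp
  define G where "G y = g y * ennreal (lorentz ((1 / c) *\<^sub>R y))" for y
  have [measurable]: "G \<in> borel_measurable borel" unfolding G_def by measurable
  \<comment> \<open>Enumerating the lattice by naturals turns the cover into a series, which may be
    integrated term by term.\<close>
  define e where "e = from_nat_into (UNIV :: (int ^ 'd) set)"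
  have e: "bij_betw e UNIV UNIV"
    unfolding e_def by (rule bij_betw_from_nat_into) (auto simp: infinite_UNIV_int_vec)
  have inj_e: "inj_on e A" for A using e by (auto simp: bij_betw_def inj_on_def)
  let ?cell = "torus_cell :: (real ^ 'd) set"
  let ?I = "\<integral>\<^sup>+x\<in>?cell. g x \<partial>lborel"
  let ?w = "\<lambda>n. lorentz ((pi / c0) *\<^sub>R lattice_vec n)"
  let ?K = "((1 + c0) ^ CARD('d))"
  \<comment> \<open>The closed cells share faces; the overlap is harmless in an upper bound.\<close>
  have cover: "G y \<le> (\<Sum>k. indicator ?cell (- ((2 * pi) *\<^sub>R lattice_vec (e k)) + y) * G y)" for y
  proof -
    obtain n where n: "y - (2 * pi) *\<^sub>R lattice_vec n \<in> ?cell" by (rule lattice_translates_cover)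
    obtain k where "e k = n" using e by (metis bij_betw_imp_surj surjD)
    then have "G y = (\<Sum>k\<in>{k}. indicator ?cell (- ((2 * pi) *\<^sub>R lattice_vec (e k)) + y) * G y)"
      using n by simp
    also have "\<dots> \<le> (\<Sum>k. indicator ?cell (- ((2 * pi) *\<^sub>R lattice_vec (e k)) + y) * G y)"
      by (rule sum_le_suminf) auto
    finally show ?thesis .
  qed
  have piece: "(\<integral>\<^sup>+y. indicator ?cell (- ((2 * pi) *\<^sub>R lattice_vec n) + y) * G y \<partial>lborel) \<le> ennreal (?w n) * ?I" for n :: "int ^ 'd"
  proof -
    have "(\<integral>\<^sup>+y. indicator ?cell (- ((2 * pi) *\<^sub>R lattice_vec n) + y) * G y \<partial>lborel)
        = (\<integral>\<^sup>+y. indicator ?cell y * G ((2 * pi) *\<^sub>R lattice_vec n + y) \<partial>lborel)"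
      by (subst nn_integral_lborel_translate[of _ "(2 * pi) *\<^sub>R lattice_vec n", symmetric]) auto
    also have "\<dots> \<le> (\<integral>\<^sup>+y. ennreal (?w n) * (g y * indicator ?cell y) \<partial>lborel)"
    proof (rule nn_integral_mono)
      fix y :: "real ^ 'd"
      show "indicator ?cell y * G ((2 * pi) *\<^sub>R lattice_vec n + y) \<le> ennreal (?w n) * (g y * indicator ?cell y)"
      proof (cases "y \<in> ?cell")
        case True
        have "G ((2 * pi) *\<^sub>R lattice_vec n + y) = g y * ennreal (lorentz ((1 / c) *\<^sub>R (y + (2 * pi) *\<^sub>R lattice_vec n)))"
          unfolding G_def using per[of y n] by (simp add: add.commute)
        also have "\<dots> \<le> g y * ennreal (?w n)"
          by (intro mult_left_mono ennreal_leI lorentz_translate_le[OF True c]) auto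
        finally show ?thesis using True by (simp add: mult.commute)
      qed simp
    qed
    also have "\<dots> = ennreal (?w n) * ?I" by (rule nn_integral_cmult) simp
    finally show ?thesis .
  qed
  have wsum: "(\<Sum>k. ennreal (?w (e k))) \<le> ennreal ?K"
  proof (rule suminf_le_const)
    fix N
    have "(pi / c0) ^ CARD('d) * (\<Sum>n\<in>e ` {..<N}. ?w n) \<le> (pi / c0 + pi) ^ CARD('d)"
      using c0 by (intro lorentz_lattice_sum) auto
    also have "\<dots> = (pi / c0) ^ CARD('d) * ?K"
      using c0 by (simp add: power_mult_distrib[symmetric] field_simps)
    finally have "(\<Sum>n\<in>e ` {..<N}. ?w n) \<le> ?K"
      using c0 by (simp add: zero_less_power)
    then have "(\<Sum>k<N. ?w (e k)) \<le> ?K" by (simp add: sum.reindex inj_e)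
    then show "(\<Sum>k<N. ennreal (?w (e k))) \<le> ennreal ?K"
      by (simp add: sum_ennreal ennreal_leI)
  qed simp
  have "(\<integral>\<^sup>+y. G y \<partial>lborel) \<le> (\<integral>\<^sup>+y. (\<Sum>k. indicator ?cell (- ((2 * pi) *\<^sub>R lattice_vec (e k)) + y) * G y) \<partial>lborel)"
    by (intro nn_integral_mono cover)
  also have "\<dots> = (\<Sum>k. \<integral>\<^sup>+y. indicator ?cell (- ((2 * pi) *\<^sub>R lattice_vec (e k)) + y) * G y \<partial>lborel)"
    by (rule nn_integral_suminf) measurable
  also have "\<dots> \<le> (\<Sum>k. ennreal (?w (e k)) * ?I)"
    by (intro suminf_le piece) auto
  also have "\<dots> = (\<Sum>k. ennreal (?w (e k))) * ?I" by (rule ennreal_suminf_multc)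
  also have "\<dots> \<le> ennreal ?K * ?I" by (intro mult_right_mono wsum) auto
  finally have *: "(\<integral>\<^sup>+y. G y \<partial>lborel) \<le> ennreal ?K * ?I" .
  have "(\<integral>\<^sup>+x. g (c *\<^sub>R x) * ennreal (lorentz x) \<partial>lborel) = (\<integral>\<^sup>+x. G (c *\<^sub>R x) \<partial>lborel)"
    unfolding G_def using c by simp
  also have "\<dots> = ennreal (1 / c ^ CARD('d)) * (ennreal (c ^ CARD('d)) * (\<integral>\<^sup>+x. G (c *\<^sub>R x) \<partial>lborel))"
    using c by (simp add: mult.assoc[symmetric] ennreal_mult[symmetric])
  also have "ennreal (c ^ CARD('d)) * (\<integral>\<^sup>+x. G (c *\<^sub>R x) \<partial>lborel) = (\<integral>\<^sup>+x. G x \<partial>lborel)"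
    using nn_integral_lborel_scaleR[of G c] c by simp
  also have "ennreal (1 / c ^ CARD('d)) * (\<integral>\<^sup>+x. G x \<partial>lborel) \<le> ennreal (1 / c ^ CARD('d)) * (ennreal ?K * ?I)"
    by (intro mult_left_mono *) auto
  also have "\<dots> = ennreal (?K / c ^ CARD('d)) * ?I"
    using c c0 by (simp add: mult.assoc[symmetric] ennreal_mult[symmetric])
  finally show ?thesis .
qed

lemma integrable_lorentz: "integrable lborel (lorentz :: real ^ 'd::finite \<Rightarrow> real)"
proof (rule integrableI_nonneg)
  have "(\<integral>\<^sup>+x. ennreal (lorentz (x :: real ^ 'd)) \<partial>lborel)
      \<le> ennreal ((1 + 1) ^ CARD('d) / 1 ^ CARD('d)) * (\<integral>\<^sup>+x\<in>(torus_cell :: (real ^ 'd) set). 1 \<partial>lborel)"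
    using nn_integral_periodic_lorentz[of "\<lambda>_. 1 :: ennreal" 1 1] by simp
  also have "\<dots> < \<infinity>"
    using emeasure_lborel_cbox_finite[of "(\<chi> i. - pi) :: real ^ 'd" "\<chi> i. pi"]
    by (simp add: ennreal_mult_less_top)
  finally show "(\<integral>\<^sup>+x. ennreal (lorentz (x :: real ^ 'd)) \<partial>lborel) < \<infinity>" .
qed auto

section \<open>Square-summable Fourier series\<close>

lemma integral_cis_period:
  "(\<integral>t. indicator {-pi..pi} t *\<^sub>R cis (of_int n * t) \<partial>lborel) = (if n = 0 then of_real (2 * pi) else 0)"
proof (cases "n = 0")
  case True
  have "(\<integral>t. indicator {-pi..pi} t *\<^sub>R (1::complex) \<partial>lborel) = of_real pi - of_real (- pi)"
    by (rule integral_FTC_atLeastAtMost) (auto intro!: derivative_eq_intros has_vector_derivative_real_field)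
  then show ?thesis using True by (simp add: scaleR_conv_of_real)
next
  case False
  let ?F = "\<lambda>t::real. cis (of_int n * t) / (\<i> * of_int n)"
  have "(\<integral>t. indicator {-pi..pi} t *\<^sub>R cis (of_int n * t) \<partial>lborel) = ?F pi - ?F (- pi)"
  proof (rule integral_FTC_atLeastAtMost)
    fix x :: real
    have "((\<lambda>t. exp (\<i> * of_int n * of_real t) / (\<i> * of_int n)) has_vector_derivative
        exp (\<i> * of_int n * of_real x)) (at x within {-pi..pi})"
      by (rule has_vector_derivative_real_field) (use False in \<open>auto intro!: derivative_eq_intros\<close>)
    then show "(?F has_vector_derivative cis (of_int n * x)) (at x within {-pi..pi})"
      by (simp add: cis_conv_exp mult_ac)
  qed (auto intro!: continuous_intros)
  moreover have "cis (of_int n * pi) = cis (- (of_int n * pi))"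
    by (simp add: complex_eq_iff sin_times_pi_eq_0)
  ultimately show ?thesis using False by simp
qed

lemma cis_sum: "cis (\<Sum>i\<in>I. f i) = (\<Prod>i\<in>I. cis (f i))"
  by (induction I rule: infinite_finite_induct) (auto simp: cis_mult[symmetric])

lemma vec_const_inner_Basis:
  "b \<in> Basis \<Longrightarrow> (\<chi> i. c) \<bullet> b = (c :: real)" for b :: "real ^ 'd::finite"
  by (auto simp: Basis_vec_def inner_axis)

text \<open>\<open>lborel\<close> is the image of a product measure over the basis, and both the
  indicator of the cell and the character factor over coordinates.\<close>

lemma integral_torus_character:
  fixes k :: "int ^ 'd::finite"
  shows "(\<integral>x. indicator torus_cell x *\<^sub>R cis (lattice_vec k \<bullet> x) \<partial>lborel)
    = (if k = 0 then of_real ((2 * pi) ^ CARD('d)) else 0)"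
proof -
  interpret product_sigma_finite "\<lambda>_::real^'d. lborel :: real measure" ..
  let ?g = "\<lambda>b t. indicator {-pi..pi} t *\<^sub>R cis ((lattice_vec k \<bullet> b) * t)"
  let ?PM = "\<Pi>\<^sub>M b\<in>(Basis :: (real^'d) set). (lborel :: real measure)"
  have int: "integrable lborel (?g b)" for b
    by (rule borel_integrable_compact) (auto intro!: continuous_intros)
  have g: "integral\<^sup>L lborel (?g (axis i 1)) = (if k $ i = 0 then of_real (2 * pi) else 0)" for i
    using integral_cis_period[of "k $ i"] by (simp add: inner_axis)
  have "(\<integral>x. indicator torus_cell x *\<^sub>R cis (lattice_vec k \<bullet> x) \<partial>lborel)
      = (\<integral>f. (\<Prod>b\<in>Basis. ?g b (f b)) \<partial>?PM)"
  proof (subst lborel_eq, subst integral_distr)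
    show "(\<integral>f. indicator torus_cell (\<Sum>b\<in>Basis. f b *\<^sub>R b) *\<^sub>R cis (lattice_vec k \<bullet> (\<Sum>b\<in>Basis. f b *\<^sub>R b)) \<partial>?PM)
      = (\<integral>f. (\<Prod>b\<in>Basis. ?g b (f b)) \<partial>?PM)"
    proof (intro Bochner_Integration.integral_cong refl)
      fix f :: "real ^ 'd \<Rightarrow> real"
      have "(indicator torus_cell (\<Sum>b\<in>Basis. f b *\<^sub>R b) :: real) = (\<Prod>b\<in>(Basis :: (real^'d) set). indicator {-pi..pi} (f b))"
      proof (cases "(\<Sum>b\<in>Basis. f b *\<^sub>R b) \<in> (torus_cell :: (real ^ 'd) set)")
        case True
        then have "\<And>b. b \<in> (Basis :: (real^'d) set) \<Longrightarrow> f b \<in> {-pi..pi}"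
          by (auto simp: mem_box vec_const_inner_Basis inner_sum_left_Basis)
        then show ?thesis using True by simp
      next
        case False
        then obtain b where "b \<in> (Basis :: (real^'d) set)" "f b \<notin> {-pi..pi}"
          by (auto simp: mem_box vec_const_inner_Basis inner_sum_left_Basis)
        then have "(\<Prod>b\<in>(Basis :: (real^'d) set). indicator {-pi..pi} (f b)) = (0 :: real)"
          by (intro prod_zero) (auto intro!: bexI[of _ b])
        then show ?thesis using False by simp
      qed
      moreover have "cis (lattice_vec k \<bullet> (\<Sum>b\<in>Basis. f b *\<^sub>R b)) = (\<Prod>b\<in>Basis. cis ((lattice_vec k \<bullet> b) * f b))"
        by (simp add: inner_sum_right cis_sum mult.commute)
      ultimately show "indicator torus_cell (\<Sum>b\<in>Basis. f b *\<^sub>R b) *\<^sub>R cis (lattice_vec k \<bullet> (\<Sum>b\<in>Basis. f b *\<^sub>R b))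
          = (\<Prod>b\<in>Basis. ?g b (f b))"
        by (simp add: scaleR_conv_of_real prod.distrib)
    qed
    show "(\<lambda>x. indicator torus_cell x *\<^sub>R cis (lattice_vec k \<bullet> x)) \<in> borel_measurable (borel :: (real^'d) measure)"
      by (intro borel_measurable_scaleR borel_measurable_indicator borel_measurable_continuous_onI[of "\<lambda>x. cis (lattice_vec k \<bullet> x)"] continuous_intros) auto
  qed auto
  also have "\<dots> = (\<Prod>b\<in>Basis. integral\<^sup>L lborel (?g b))"
    by (rule product_integral_prod) (auto intro: int)
  also have "\<dots> = (\<Prod>i\<in>UNIV. if k $ i = 0 then of_real (2 * pi) else 0)"
  proof -
    have B: "(Basis :: (real^'d) set) = range (\<lambda>i. axis i 1)" by (auto simp: Basis_vec_def)
    have inj: "inj (\<lambda>i. axis i (1::real) :: real^'d)" by (auto simp: inj_on_def axis_eq_axis)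
    have "(\<Prod>b\<in>(Basis :: (real^'d) set). G b) = (\<Prod>i\<in>UNIV. G (axis i 1))" for G :: "real^'d \<Rightarrow> complex"
      unfolding B by (simp add: prod.reindex[OF inj])
    then show ?thesis by (simp only: g)
  qed
  also have "\<dots> = (if k = 0 then of_real ((2 * pi) ^ CARD('d)) else 0)"
  proof (cases "k = 0")
    case False
    then obtain i where "k $ i \<noteq> 0" by (auto simp: vec_eq_iff)
    then have "(\<Prod>i\<in>UNIV. if k $ i = 0 then of_real (2 * pi) else (0::complex)) = 0"
      by (intro prod_zero) auto
    then show ?thesis using False by simp
  qed simp
  finally show ?thesis .
qed

definition trig_sum :: "(int ^ 'd::finite \<Rightarrow> complex) \<Rightarrow> (int ^ 'd) set \<Rightarrow> real ^ 'd \<Rightarrow> complex" where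
  "trig_sum V A x = (\<Sum>n\<in>A. V n * cis (- (lattice_vec n \<bullet> x)))"

lemma continuous_on_trig_sum: "continuous_on UNIV (trig_sum V A)"
  unfolding trig_sum_def by (intro continuous_intros)

lemma borel_measurable_trig_sum [measurable]: "trig_sum V A \<in> borel_measurable borel"
  by (rule borel_measurable_continuous_onI[OF continuous_on_trig_sum])

lemma cis_lattice_periodic:
  "cis (- (lattice_vec n \<bullet> (x + (2 * pi) *\<^sub>R lattice_vec k))) = cis (- (lattice_vec n \<bullet> x))"
proof -
  define j where "j = - (\<Sum>i\<in>UNIV. n $ i * k $ i)"
  have "- (lattice_vec n \<bullet> (x + (2 * pi) *\<^sub>R lattice_vec k)) = - (lattice_vec n \<bullet> x) + 2 * pi * of_int j"
    unfolding j_def by (simp add: inner_vec_def distrib_left sum.distrib sum_distrib_left mult_ac)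
  then show ?thesis by (simp only: cis_mult[symmetric]) (simp add: complex_eq_iff)
qed

lemma trig_sum_periodic: "trig_sum V A (x + (2 * pi) *\<^sub>R lattice_vec k) = trig_sum V A x"
  unfolding trig_sum_def cis_lattice_periodic ..

lemma parseval_trig_sum:
  fixes V :: "int ^ 'd::finite \<Rightarrow> complex"
  assumes A: "finite A"
  shows "(\<integral>\<^sup>+x\<in>torus_cell. ennreal ((norm (trig_sum V A x))\<^sup>2) \<partial>lborel)
    = ennreal ((2 * pi) ^ CARD('d) * (\<Sum>n\<in>A. (norm (V n))\<^sup>2))"
proof -
  let ?cell = "torus_cell :: (real ^ 'd) set"
  have int1: "integrable lborel (\<lambda>x. indicator ?cell x *\<^sub>R cis (lattice_vec k \<bullet> x))" for k :: "int ^ 'd"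
    by (rule borel_integrable_compact) (auto intro!: continuous_intros)
  have int: "integrable lborel (\<lambda>x. indicator ?cell x *\<^sub>R (norm (trig_sum V A x))\<^sup>2)"
    by (rule borel_integrable_compact) (auto intro!: continuous_intros continuous_on_subset[OF continuous_on_trig_sum])
  have "of_real ((norm (trig_sum V A x))\<^sup>2) = (\<Sum>m\<in>A. \<Sum>n\<in>A. (V m * cnj (V n)) * cis (lattice_vec (n - m) \<bullet> x))" for x
  proof -
    have "of_real ((norm (trig_sum V A x))\<^sup>2) = trig_sum V A x * cnj (trig_sum V A x)"
      by (rule complex_norm_square)
    also have "\<dots> = (\<Sum>m\<in>A. \<Sum>n\<in>A. (V m * cnj (V n)) * (cis (- (lattice_vec m \<bullet> x)) * cis (lattice_vec n \<bullet> x)))"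
      unfolding trig_sum_def by (simp add: sum_product cnj_sum cis_cnj mult_ac)
    finally show ?thesis by (simp add: cis_mult lattice_vec_diff inner_diff_left)
  qed
  then have "of_real (indicator ?cell x *\<^sub>R (norm (trig_sum V A x))\<^sup>2)
      = (\<Sum>m\<in>A. \<Sum>n\<in>A. (V m * cnj (V n)) * (indicator ?cell x *\<^sub>R cis (lattice_vec (n - m) \<bullet> x)))" for x
    by (cases "x \<in> ?cell") simp_all
  then have "of_real (\<integral>x. indicator ?cell x *\<^sub>R (norm (trig_sum V A x))\<^sup>2 \<partial>lborel)
      = (\<integral>x. (\<Sum>m\<in>A. \<Sum>n\<in>A. (V m * cnj (V n)) * (indicator ?cell x *\<^sub>R cis (lattice_vec (n - m) \<bullet> x))) \<partial>lborel)"
    by (subst integral_complex_of_real[symmetric]) (simp only:)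
  also have "\<dots> = (\<Sum>m\<in>A. \<Sum>n\<in>A. (V m * cnj (V n)) * (if n - m = 0 then of_real ((2 * pi) ^ CARD('d)) else 0))"
    by (subst integral_torus_character[symmetric])
      (simp add: Bochner_Integration.integral_sum int1 del: mult_scaleR_right)
  also have "\<dots> = (\<Sum>m\<in>A. V m * cnj (V m) * of_real ((2 * pi) ^ CARD('d)))"
    using A by (intro sum.cong) (auto simp: if_distrib sum.delta cong: if_cong)
  also have "\<dots> = of_real ((2 * pi) ^ CARD('d) * (\<Sum>n\<in>A. (norm (V n))\<^sup>2))"
    by (simp only: complex_norm_square[symmetric] of_real_mult[symmetric] of_real_sum[symmetric] sum_distrib_left mult.commute)
  finally have "(\<integral>x. indicator ?cell x *\<^sub>R (norm (trig_sum V A x))\<^sup>2 \<partial>lborel)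
      = (2 * pi) ^ CARD('d) * (\<Sum>n\<in>A. (norm (V n))\<^sup>2)"
    by (simp only: of_real_eq_iff)
  moreover have "(\<integral>\<^sup>+x\<in>?cell. ennreal ((norm (trig_sum V A x))\<^sup>2) \<partial>lborel)
      = (\<integral>\<^sup>+x. ennreal (indicator ?cell x *\<^sub>R (norm (trig_sum V A x))\<^sup>2) \<partial>lborel)"
    by (intro nn_integral_cong) (auto simp: indicator_def)
  ultimately show ?thesis by (subst (asm) nn_integral_eq_integral[OF int]) auto
qed

text \<open>The common terms cancel, and a sign records which set a remaining term comes from. Signs
  do not change the moduli of the coefficients, so Parseval measures the difference of two partial
  sums.\<close>

lemma trig_sum_diff:
  assumes "finite A" "finite B"
  shows "trig_sum V A x - trig_sum V B x = trig_sum (\<lambda>n. if n \<in> A then V n else - V n) ((A - B) \<union> (B - A)) x"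
proof -
  have "trig_sum V A x = trig_sum V (A \<inter> B) x + trig_sum V (A - B) x"
    unfolding trig_sum_def using assms(1) by (subst sum.union_disjoint[symmetric]) (auto intro: sum.cong)
  moreover have "trig_sum V B x = trig_sum V (A \<inter> B) x + trig_sum V (B - A) x"
    unfolding trig_sum_def using assms(2) by (subst sum.union_disjoint[symmetric]) (auto intro: sum.cong)
  moreover have "trig_sum (\<lambda>n. if n \<in> A then V n else - V n) ((A - B) \<union> (B - A)) x
      = trig_sum V (A - B) x - trig_sum V (B - A) x"
    unfolding trig_sum_def using assms by (subst sum.union_disjoint) (auto simp: sum_negf)
  ultimately show ?thesis by simp
qed

lemma parseval_trig_sum_diff:
  fixes V :: "int ^ 'd::finite \<Rightarrow> complex"
  assumes "finite A" "finite B"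
  shows "(\<integral>\<^sup>+x\<in>torus_cell. ennreal ((norm (trig_sum V A x - trig_sum V B x))\<^sup>2) \<partial>lborel)
    = ennreal ((2 * pi) ^ CARD('d) * (\<Sum>n\<in>(A - B) \<union> (B - A). (norm (V n))\<^sup>2))"
proof -
  define D where "D = (A - B) \<union> (B - A)"
  define W where "W n = (if n \<in> A then V n else - V n)" for n
  have D: "finite D" unfolding D_def using assms by blast
  have W: "norm (W n) = norm (V n)" for n by (simp add: W_def)
  have "trig_sum V A x - trig_sum V B x = trig_sum W D x" for x
    unfolding D_def W_def[abs_def] by (rule trig_sum_diff[OF assms])
  then show ?thesis unfolding D_def[symmetric] using parseval_trig_sum[OF D, of W] by (simp only: W)
qed

section \<open>Existence of the Fourier series in mean square\<close>

lemma discrete_L2_tail: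
  assumes "U \<in> discrete_L2" "0 < e"
  obtains A where "finite A"
    "\<And>B. finite B \<Longrightarrow> B \<inter> A = {} \<Longrightarrow> (\<Sum>n\<in>B. (norm (U n))\<^sup>2) \<le> e"
proof -
  let ?f = "\<lambda>n. (norm (U n))\<^sup>2"
  have "?f summable_on UNIV" using assms(1) by (simp add: discrete_L2_def)
  then have "(sum ?f \<longlongrightarrow> infsum ?f UNIV) (finite_subsets_at_top UNIV)"
    by (simp add: has_sum_def[symmetric])
  then have "\<forall>\<^sub>F F in finite_subsets_at_top UNIV. dist (sum ?f F) (infsum ?f UNIV) < e / 2"
    by (rule tendstoD) (use assms in simp)
  then obtain A where "finite A \<and> (\<forall>F. finite F \<and> A \<subseteq> F \<and> F \<subseteq> UNIV \<longrightarrow> dist (sum ?f F) (infsum ?f UNIV) < e / 2)"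
    unfolding eventually_finite_subsets_at_top by (elim exE) auto
  then have A: "finite A" "\<And>F. finite F \<Longrightarrow> A \<subseteq> F \<Longrightarrow> dist (sum ?f F) (infsum ?f UNIV) < e / 2"
    by auto
  show thesis
  proof (rule that[OF A(1)])
    fix B :: "(int ^ 'a) set" assume B: "finite B" "B \<inter> A = {}"
    have "sum ?f (A \<union> B) = sum ?f A + sum ?f B" using A B by (intro sum.union_disjoint) auto
    moreover have "dist (sum ?f (A \<union> B)) (infsum ?f UNIV) < e / 2" using A B by auto
    moreover have "dist (sum ?f A) (infsum ?f UNIV) < e / 2" using A by auto
    ultimately show "sum ?f B \<le> e" unfolding dist_real_def by linarith
  qed
qed

text \<open>Riesz--Fischer: along rapidly exhausting finite sets the partial sums converge almost
  everywhere, and the pointwise limit is periodic by construction.\<close>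

theorem is_dft_dft:
  fixes U :: "int ^ 'd::finite \<Rightarrow> complex"
  assumes U: "U \<in> discrete_L2"
  shows "is_dft U (dft U)"
proof -
  let ?cell = "torus_cell :: (real ^ 'd) set"
  let ?K = "(2 * pi) ^ CARD('d)"
  \<comment> \<open>Squared tails of size 4^-j give mean-square distances of order 2^-j, which are
    summable.\<close>
  have "\<exists>A. finite A \<and> (\<forall>B. finite B \<longrightarrow> B \<inter> A = {} \<longrightarrow> (\<Sum>n\<in>B. (norm (U n))\<^sup>2) \<le> (1/4) ^ j)" for j :: nat
    using discrete_L2_tail[OF U, of "(1/4) ^ j"] by (metis zero_less_divide_1_iff zero_less_numeral zero_less_power)
  then obtain E where E: "\<And>j. finite (E j)"
    "\<And>j B. finite B \<Longrightarrow> B \<inter> E j = {} \<Longrightarrow> (\<Sum>n\<in>B. (norm (U n))\<^sup>2) \<le> (1/4) ^ j"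
    by metis
  define A where "A j = (\<Union>i\<le>j. E i)" for j
  have finA: "finite (A j)" for j unfolding A_def using E by auto
  have close: "(\<integral>\<^sup>+x\<in>?cell. ennreal ((norm (trig_sum U B x - trig_sum U B' x))\<^sup>2) \<partial>lborel) \<le> ennreal (?K * (1/4) ^ j)"
    if "finite B" "finite B'" "E j \<subseteq> B" "E j \<subseteq> B'" for B B' j
    unfolding parseval_trig_sum_diff[OF that(1,2)]
    using that by (intro ennreal_leI mult_left_mono E(2)) auto
  define S where "S j = trig_sum U (A j)" for j
  have [measurable]: "S j \<in> borel_measurable borel" for j unfolding S_def by simp
  \<comment> \<open>\<open>lim\<close> depends only on the sequence of values, so \<open>F\<close>
    inherits periodicity even at points where the sums diverge.\<close>
  define F where "F x = lim (\<lambda>j. S j x)" for x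
  let ?s = "\<lambda>j x. ennreal ((norm (S (Suc j) x - S j x))\<^sup>2)"
  have step: "(\<integral>\<^sup>+x\<in>?cell. ennreal (norm (S (Suc j) x - S j x)) \<partial>lborel) \<le> ennreal (?K * (1/2) ^ j)" for j
  proof -
    \<comment> \<open>Weighting the square by 2^j turns the squared bound 4^-j into a first-power
      bound of order 2^-j on the cell.\<close>
    have am: "y \<le> ((1/2) ^ j + 2 ^ j * y\<^sup>2) / 2" for y :: real
      using am_gm_weighted[of "2 ^ j" y 1] by (simp add: power_one_over add.commute)
    have vol: "emeasure lborel ?cell = ennreal ?K"
      using parseval_trig_sum[of "{0 :: int ^ 'd}" "\<lambda>_. 1"] by (simp add: trig_sum_def)
    have "(\<integral>\<^sup>+x\<in>?cell. ennreal (norm (S (Suc j) x - S j x)) \<partial>lborel)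
      \<le> (\<integral>\<^sup>+x. ennreal ((1/2) ^ j / 2) * indicator ?cell x + ennreal (2 ^ j / 2) *
          (?s j x * indicator ?cell x) \<partial>lborel)"
    proof (rule nn_integral_mono)
      fix x
      have "ennreal (norm (S (Suc j) x - S j x)) \<le> ennreal ((1/2) ^ j / 2 + (2 ^ j / 2) * (norm (S (Suc j) x - S j x))\<^sup>2)"
        using am[of "norm (S (Suc j) x - S j x)"] by (intro ennreal_leI) (simp add: add_divide_distrib)
      also have "\<dots> = ennreal ((1/2) ^ j / 2) + ennreal (2 ^ j / 2) * ?s j x"
        by (subst ennreal_mult[symmetric]) (auto simp: ennreal_plus)
      finally show "ennreal (norm (S (Suc j) x - S j x)) * indicator ?cell x \<le> ennreal ((1/2) ^ j / 2) * indicator ?cell x + ennreal (2 ^ j / 2) *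
          (?s j x * indicator ?cell x)"
        by (auto simp: indicator_def)
    qed
    also have "\<dots> = ennreal ((1/2) ^ j / 2) * ennreal ?K + ennreal (2 ^ j / 2) *
        (\<integral>\<^sup>+x\<in>?cell. ?s j x \<partial>lborel)"
      by (subst nn_integral_add) (auto simp: nn_integral_cmult vol)
    also have "\<dots> \<le> ennreal ((1/2) ^ j / 2) * ennreal ?K + ennreal (2 ^ j / 2) * ennreal (?K * (1/4) ^ j)"
      unfolding S_def by (intro add_left_mono mult_left_mono close finA) (auto simp: A_def intro: exI[of _ j] le_SucI)
    also have "\<dots> = ennreal (?K * (1/2) ^ j)"
    proof -
      have p: "(2::real) ^ j * (1/4) ^ j = (1/2) ^ j" by (simp add: power_mult_distrib[symmetric])
      have eq: "x / 2 * K + p / 2 * (K * q) = K * x" if "p * q = x" for p q x K :: real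
        unfolding that[symmetric] by (simp add: algebra_simps)
      have "ennreal a * ennreal b + ennreal c * ennreal d = ennreal (a * b + c * d)"
        if "0 \<le> a" "0 \<le> b" "0 \<le> c" "0 \<le> d" for a b c d
        using that by (simp add: ennreal_mult ennreal_plus)
      from this[of "(1/2) ^ j / 2" ?K "2 ^ j / 2" "?K * (1/4) ^ j"] show ?thesis
        unfolding eq[OF p] by simp
    qed
    finally show ?thesis .
  qed
  have conv: "AE x in lborel. x \<in> ?cell \<longrightarrow> convergent (\<lambda>j. S j x)"
  proof -
    have "(\<integral>\<^sup>+x. (\<Sum>j. ennreal (norm (S (Suc j) x - S j x)) * indicator ?cell x) \<partial>lborel)
        = (\<Sum>j. \<integral>\<^sup>+x\<in>?cell. ennreal (norm (S (Suc j) x - S j x)) \<partial>lborel)"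
      by (rule nn_integral_suminf) measurable
    also have "\<dots> \<le> (\<Sum>j. ennreal (?K * (1/2) ^ j))" by (intro suminf_le step) auto
    also have "\<dots> < \<infinity>"
      by (subst suminf_ennreal2) (auto intro!: summable_mult summable_geometric)
    finally have "AE x in lborel. (\<Sum>j. ennreal (norm (S (Suc j) x - S j x)) * indicator ?cell x) \<noteq> \<infinity>"
      by (intro nn_integral_PInf_AE) auto
    then show ?thesis
    proof eventually_elim
      case (elim x)
      show ?case
      proof
        assume x: "x \<in> ?cell"
        have "summable (\<lambda>j. norm (S (Suc j) x - S j x))"
          using elim x by (intro summable_suminf_not_top) auto
        then have "summable (\<lambda>j. S (Suc j) x - S j x)" by (rule summable_norm_cancel)
        then have "convergent (\<lambda>n. \<Sum>j<n. S (Suc j) x - S j x)" by (simp add: summable_iff_convergent)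
        then have "convergent (\<lambda>n. S n x - S 0 x)" by (simp only: sum_lessThan_telescope[of "\<lambda>j. S j x"])
        from convergent_add[OF this convergent_const[of "S 0 x"]] show "convergent (\<lambda>j. S j x)" by simp
      qed
    qed
  qed
  \<comment> \<open>Fatou's lemma transfers the Cauchy estimate to the limit. It holds for every
    finite superset of \<open>E j\<close>, not just along the sets \<open>A j\<close>, which gives
    convergence along the net of finite sets.\<close>
  have tail: "(\<integral>\<^sup>+x\<in>?cell. ennreal ((norm (F x - trig_sum U B x))\<^sup>2) \<partial>lborel) \<le> ennreal (?K * (1/4) ^ j)"
    if B: "finite B" "E j \<subseteq> B" for B j
  proof -
    have "(\<integral>\<^sup>+x\<in>?cell. ennreal ((norm (F x - trig_sum U B x))\<^sup>2) \<partial>lborel)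
      \<le> (\<integral>\<^sup>+x. liminf (\<lambda>i. ennreal ((norm (S i x - trig_sum U B x))\<^sup>2) * indicator ?cell x) \<partial>lborel)"
    proof (rule nn_integral_mono_AE)
      show "AE x in lborel. ennreal ((norm (F x - trig_sum U B x))\<^sup>2) * indicator ?cell x
          \<le> liminf (\<lambda>i. ennreal ((norm (S i x - trig_sum U B x))\<^sup>2) * indicator ?cell x)"
        using conv
      proof eventually_elim
        case (elim x)
        show ?case
        proof (cases "x \<in> ?cell")
          case True
          then have "(\<lambda>j. S j x) \<longlonglongrightarrow> F x" using elim unfolding F_def by (simp add: convergent_LIMSEQ_iff)
          then have "(\<lambda>i. ennreal ((norm (S i x - trig_sum U B x))\<^sup>2)) \<longlonglongrightarrow> ennreal ((norm (F x - trig_sum U B x))\<^sup>2)"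
            by (intro tendsto_intros tendsto_ennrealI)
          then have "liminf (\<lambda>i. ennreal ((norm (S i x - trig_sum U B x))\<^sup>2)) = ennreal ((norm (F x - trig_sum U B x))\<^sup>2)"
            by (intro lim_imp_Liminf) auto
          then show ?thesis using True by simp
        qed simp
      qed
    qed
    also have "\<dots> \<le> liminf (\<lambda>i. \<integral>\<^sup>+x\<in>?cell. ennreal ((norm (S i x - trig_sum U B x))\<^sup>2) \<partial>lborel)"
      by (rule nn_integral_liminf) measurable
    also have "\<dots> \<le> ennreal (?K * (1/4) ^ j)"
    proof -
      have "\<forall>\<^sub>F i in sequentially. (\<integral>\<^sup>+x\<in>?cell. ennreal ((norm (S i x - trig_sum U B x))\<^sup>2) \<partial>lborel) \<le> ennreal (?K * (1/4) ^ j)"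
        using eventually_ge_at_top[of j]
      proof eventually_elim
        case (elim i)
        then have "E j \<subseteq> A i" by (auto simp: A_def)
        then show ?case unfolding S_def using B by (intro close finA) auto
      qed
      then show ?thesis
        by (intro Liminf_le) auto
    qed
    finally show ?thesis .
  qed
  have "is_dft U F"
    unfolding is_dft_def
  proof (intro conjI allI)
    show "F \<in> borel_measurable borel" unfolding F_def by measurable
    show "F (x + (2 * pi) *\<^sub>R lattice_vec n) = F x" for x n
      unfolding F_def S_def trig_sum_periodic ..
    show "((\<lambda>A. \<integral>\<^sup>+x\<in>?cell. ennreal ((norm (F x - (\<Sum>n\<in>A. U n * cis (- (lattice_vec n \<bullet> x)))))\<^sup>2) \<partial>lborel)
        \<longlongrightarrow> 0) (finite_subsets_at_top UNIV)"
    proof (rule order_tendstoI)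
      fix e :: ennreal assume e: "0 < e"
      have "(\<lambda>j. ennreal (?K * (1/4) ^ j)) \<longlonglongrightarrow> ennreal (?K * 0)"
        by (intro tendsto_ennrealI tendsto_mult_left LIMSEQ_realpow_zero) auto
      then have "\<forall>\<^sub>F j in sequentially. ennreal (?K * (1/4) ^ j) < e"
        using e by (intro order_tendstoD(2)) auto
      then obtain j where j: "ennreal (?K * (1/4) ^ j) < e" using eventually_happens by force
      show "\<forall>\<^sub>F A in finite_subsets_at_top UNIV. (\<integral>\<^sup>+x\<in>?cell. ennreal ((norm (F x - (\<Sum>n\<in>A. U n * cis (- (lattice_vec n \<bullet> x)))))\<^sup>2) \<partial>lborel) < e"
        unfolding eventually_finite_subsets_at_top
        using E(1)[of j] tail[of _ j] j by (auto intro!: exI[of _ "E j"] simp: trig_sum_def intro: le_less_trans)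
    qed simp
  qed
  then show ?thesis unfolding dft_def by (rule someI[of "is_dft U"])
qed

section \<open>Partial Fourier transforms of Schwartz functions\<close>

lemma schwartz_seminorm_bound:
  fixes a :: "'a::euclidean_space \<Rightarrow> complex"
  assumes a: "a \<in> schwartz" and bs: "set bs \<subseteq> Basis" "length bs \<le> N"
  shows "(1 + norm z) ^ N * norm (iter_partial bs a z) \<le> schwartz_seminorm N a"
proof -
  let ?f = "\<lambda>bs. SUP x. (1 + norm x) ^ N * norm (iter_partial bs a x)"
  have ub: "(1 + norm z) ^ N * norm (iter_partial bs a z) \<le> ?f bs" if "set bs \<subseteq> Basis" for bs z
  proof (rule cSUP_upper)
    have "bounded (range (\<lambda>x. (1 + norm x) ^ N * norm (iter_partial bs a x)))"
      using a that by (simp add: schwartz_def)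
    then show "bdd_above (range (\<lambda>x. (1 + norm x) ^ N * norm (iter_partial bs a x)))"
      by (rule bounded_imp_bdd_above)
  qed simp
  have nonneg: "0 \<le> ?f bs" if "set bs \<subseteq> Basis" for bs
    using ub[OF that, of 0] by (rule order_trans[rotated]) simp
  have "finite {bs. set bs \<subseteq> (Basis :: 'a set) \<and> length bs \<le> N}"
    by (rule finite_lists_length_le) simp
  then have "?f bs \<le> schwartz_seminorm N a"
    unfolding schwartz_seminorm_def using bs nonneg by (intro member_le_sum) auto
  with ub[OF bs(1), of z] show ?thesis by (rule order_trans)
qed

lemma inverse_lorentz_le: "1 \<le> (1 + norm (x, \<xi>)) ^ (2 * CARD('d)) * lorentz \<xi>"
  for x :: "real ^ 'd::finite" and \<xi> :: "real ^ 'd"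
  using component_le_norm_cart[of \<xi>] norm_snd_le[of \<xi> x]
  by (intro one_le_power_lorentz) (meson order_trans)

text \<open>Of the N powers of decay, 2d pay for the Lorentz weight in frequency and k remain as
  decay in both variables.\<close>

lemma schwartz_lorentz_bound:
  fixes a :: "(real ^ 'd::finite) \<times> (real ^ 'd) \<Rightarrow> complex"
  assumes a: "a \<in> schwartz" and bs: "set bs \<subseteq> Basis" "length bs \<le> N" and N: "2 * CARD('d) + k \<le> N"
  shows "(1 + norm (x, \<xi>)) ^ k * norm (iter_partial bs a (x, \<xi>)) \<le> schwartz_seminorm N a * lorentz \<xi>"
proof -
  let ?r = "1 + norm (x, \<xi>)" and ?v = "norm (iter_partial bs a (x, \<xi>))"
  have "?r ^ k * ?v = 1 * (?r ^ k * ?v)" by simp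
  also have "\<dots> \<le> (?r ^ (2 * CARD('d)) * lorentz \<xi>) * (?r ^ k * ?v)"
    by (intro mult_right_mono inverse_lorentz_le) auto
  also have "\<dots> = ?r ^ (2 * CARD('d) + k) * ?v * lorentz \<xi>" by (simp add: power_add)
  also have "\<dots> \<le> ?r ^ N * ?v * lorentz \<xi>"
    using N by (intro mult_right_mono power_increasing) auto
  also have "\<dots> \<le> schwartz_seminorm N a * lorentz \<xi>"
    by (intro mult_right_mono schwartz_seminorm_bound[OF a bs]) auto
  finally show ?thesis .
qed

lemma schwartz_has_derivative:
  assumes "a \<in> schwartz" "set bs \<subseteq> Basis"
  shows "(iter_partial bs a has_derivative frechet_derivative (iter_partial bs a) (at z)) (at z)"
  using assms frechet_derivative_works unfolding schwartz_def smooth_def by blast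

lemma schwartz_continuous:
  assumes "a \<in> schwartz" "set bs \<subseteq> Basis"
  shows "continuous_on UNIV (iter_partial bs a)"
  using schwartz_has_derivative[OF assms]
  by (auto intro!: continuous_at_imp_continuous_on has_derivative_continuous)

lemma vector_derivative_along_line:
  assumes "\<And>z. (f has_derivative f' z) (at z)"
  shows "((\<lambda>t. f (z + t *\<^sub>R v)) has_vector_derivative f' (z + t *\<^sub>R v) v) (at t)"
proof -
  have "((\<lambda>t. z + t *\<^sub>R v) has_derivative (\<lambda>t. t *\<^sub>R v)) (at t)"
    by (auto intro!: derivative_eq_intros)
  from diff_chain_at[OF this assms]
  have "((\<lambda>t. f (z + t *\<^sub>R v)) has_derivative (\<lambda>s. f' (z + t *\<^sub>R v) (s *\<^sub>R v))) (at t)"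
    by (simp add: o_def)
  moreover have "f' (z + t *\<^sub>R v) (s *\<^sub>R v) = s *\<^sub>R f' (z + t *\<^sub>R v) v" for s
    using has_derivative_linear[OF assms] by (rule linear_cmul)
  ultimately show ?thesis unfolding has_vector_derivative_def by simp
qed

lemma vector_derivative_increment_bound:
  fixes \<phi> :: "real \<Rightarrow> complex"
  assumes "0 < t" and d: "\<And>s. (\<phi> has_vector_derivative \<phi>' s) (at s)"
    and B: "\<And>s. 0 < s \<Longrightarrow> s < t \<Longrightarrow> norm (\<phi>' s) \<le> B"
  shows "norm (\<phi> t - \<phi> 0) \<le> t * B"
proof -
  have "\<exists>s\<in>{0<..<t}. norm (\<phi> t - \<phi> 0) \<le> norm ((t - 0) *\<^sub>R \<phi>' s)"
    by (rule mvt_general[OF \<open>0 < t\<close>])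
      (use d in \<open>auto simp: has_vector_derivative_def intro!: continuous_at_imp_continuous_on has_derivative_continuous\<close>)
  then obtain s where s: "0 < s" "s < t" "norm (\<phi> t - \<phi> 0) \<le> t * norm (\<phi>' s)"
    using assms(1) by auto
  have "t * norm (\<phi>' s) \<le> t * B" using B[OF s(1,2)] assms(1) by (intro mult_left_mono) auto
  with s(3) show ?thesis by (rule order_trans)
qed

text \<open>Shifts of length at most 1 change the weight by a constant factor only, so one
  integrable function dominates all difference quotients in the integration by parts.\<close>

lemma lorentz_shift_le:
  fixes x e :: "real ^ 'd::finite"
  assumes "norm e \<le> 1"
  shows "lorentz (x + e) \<le> 3 ^ CARD('d) * lorentz x"
proof -
  have "lorentz (x + e) \<le> (\<Prod>i\<in>(UNIV::'d set). 3 * (1 / (1 + (x $ i)\<^sup>2)))"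
    unfolding lorentz_def
  proof (rule prod_mono, intro conjI)
    fix i
    let ?u = "x $ i" and ?s = "e $ i"
    have "\<bar>?s\<bar> \<le> 1" using component_le_norm_cart[of e i] assms by simp
    then have "?s\<^sup>2 \<le> 1" by (simp add: abs_square_le_1)
    \<comment> \<open>Completing the square; since the squared shift is at most 1, the part outside
      the square is at least 1/2.\<close>
    moreover have "3 * (1 + (?u + ?s)\<^sup>2) - (1 + ?u\<^sup>2) = 2 - 3 / 2 * ?s\<^sup>2 + (2 * ?u + 3 * ?s)\<^sup>2 / 2"
      by (simp add: power2_eq_square field_simps)
    moreover have "0 \<le> (2 * ?u + 3 * ?s)\<^sup>2 / 2" by simp
    ultimately have "1 + ?u\<^sup>2 \<le> 3 * (1 + (?u + ?s)\<^sup>2)" by linarith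
    moreover have "1 / b \<le> 3 * (1 / c)" if "0 < b" "0 < c" "c \<le> 3 * b" for b c :: real
      using that by (simp add: field_simps)
    ultimately show "1 / (1 + ((x + e) $ i)\<^sup>2) \<le> 3 * (1 / (1 + (x $ i)\<^sup>2))"
      by (simp add: add_pos_nonneg)
    show "0 \<le> 1 / (1 + ((x + e) $ i)\<^sup>2)" by simp
  qed
  then show ?thesis by (simp add: lorentz_def prod_dividef)
qed

lemma integrable_lorentz_bounded:
  fixes g :: "real ^ 'd::finite \<Rightarrow> 'b::{banach, second_countable_topology}"
  assumes "g \<in> borel_measurable borel" "\<And>x. norm (g x) \<le> C * lorentz x"
  shows "integrable lborel g"
proof (rule Bochner_Integration.integrable_bound[where f="\<lambda>x. C * lorentz x"])
  show "integrable lborel (\<lambda>x :: real ^ 'd. C * lorentz x)" by (intro integrable_mult_right integrable_lorentz)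
  show "AE x in lborel. norm (g x) \<le> norm (C * lorentz x)"
    using assms(2) by (intro AE_I2) (metis abs_ge_self order_trans real_norm_def)
qed (use assms in simp)

lemma lborel_integral_translate:
  fixes f :: "'a::euclidean_space \<Rightarrow> 'b::{banach, second_countable_topology}"
  assumes [measurable]: "f \<in> borel_measurable borel"
  shows "(\<integral>x. f (a + x) \<partial>lborel) = (\<integral>x. f x \<partial>lborel)"
  by (subst (2) lborel_distr_plus[of a, symmetric]) (simp add: integral_distr)

text \<open>The difference quotients integrate to zero by translation invariance.\<close>

lemma integral_directional_derivative_eq_0:
  fixes g g' :: "real ^ 'd::finite \<Rightarrow> complex"
  assumes d: "\<And>x t. ((\<lambda>t. g (x + t *\<^sub>R e)) has_vector_derivative g' (x + t *\<^sub>R e)) (at t)"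
    and e: "norm e \<le> 1"
    and g: "\<And>x. norm (g x) \<le> C * lorentz x" and g': "\<And>x. norm (g' x) \<le> C * lorentz x"
    and [measurable]: "g \<in> borel_measurable borel"
  shows "(\<integral>x. g' x \<partial>lborel) = 0"
proof -
  have "0 \<le> C * lorentz (0 :: real ^ 'd)" by (rule order_trans[OF norm_ge_zero g])
  then have C: "0 \<le> C" using lorentz_pos[of "0 :: real ^ 'd"] by (simp add: zero_le_mult_iff)
  define q where "q n x = (g (x + (1 / Suc n) *\<^sub>R e) - g x) /\<^sub>R (1 / Suc n)" for n x
  have [measurable]: "q n \<in> borel_measurable borel" for n unfolding q_def by measurable
  have lim: "(\<lambda>n. q n x) \<longlonglongrightarrow> g' x" for x
  proof -
    have "((\<lambda>t. g (x + t *\<^sub>R e)) has_vector_derivative g' x) (at 0)" using d[of x 0] by simp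
    then have "((\<lambda>t. (1 / \<bar>t - 0\<bar>) *\<^sub>R (g (x + t *\<^sub>R e) - (g (x + 0 *\<^sub>R e) + (t - 0) *\<^sub>R g' x))) \<longlongrightarrow> 0) (at 0)"
      unfolding has_vector_derivative_def has_derivative_within by simp
    then have "(\<lambda>n. (1 / \<bar>1 / real (Suc n) - 0\<bar>) *\<^sub>R (g (x + (1 / real (Suc n)) *\<^sub>R e) - (g (x + 0 *\<^sub>R e) + (1 / real (Suc n) - 0) *\<^sub>R g' x))) \<longlonglongrightarrow> 0" (is "?X \<longlonglongrightarrow> 0")
      by (rule filterlim_compose)
        (use LIMSEQ_inverse_real_of_nat in \<open>auto simp: filterlim_at inverse_eq_divide\<close>)
    moreover have "?X n = q n x - g' x" for n
    proof -
      have "(1 / \<bar>h - 0\<bar>) *\<^sub>R (A - (B + (h - 0) *\<^sub>R G)) = (A - B) /\<^sub>R h - G" if "0 < h" for h and A B G :: complex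
        using that by (simp add: scaleR_right_diff_distrib scaleR_right_distrib divide_inverse_commute)
      from this[of "1 / real (Suc n)"] show ?thesis unfolding q_def by simp
    qed
    ultimately have "(\<lambda>n. q n x - g' x) \<longlonglongrightarrow> 0" by (simp only:)
    then show ?thesis by (simp add: LIM_zero_iff)
  qed
  have "g' \<in> borel_measurable borel"
    by (rule borel_measurable_LIMSEQ_metric[OF _ lim]) simp
  \<comment> \<open>The mean value inequality reduces the quotient to the derivative at a nearby
    point, and the shift lemma returns the weight to x. This is the dominating function.\<close>
  have bound: "norm (q n x) \<le> 3 ^ CARD('d) * C * lorentz x" for n x
  proof -
    have "norm (g (x + (1 / Suc n) *\<^sub>R e) - g (x + 0 *\<^sub>R e)) \<le> (1 / Suc n) * (3 ^ CARD('d) * C * lorentz x)"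
    proof (rule vector_derivative_increment_bound[OF _ d])
      fix s :: real assume s: "0 < s" "s < 1 / Suc n"
      then have "s \<le> 1" by (smt (verit) of_nat_0_le_iff of_nat_Suc divide_le_eq_1)
      then have "norm (s *\<^sub>R e) \<le> 1" using e s by (simp add: mult_le_one)
      then have "C * lorentz (x + s *\<^sub>R e) \<le> C * (3 ^ CARD('d) * lorentz x)"
        by (intro mult_left_mono lorentz_shift_le C)
      with g'[of "x + s *\<^sub>R e"] show "norm (g' (x + s *\<^sub>R e)) \<le> 3 ^ CARD('d) * C * lorentz x"
        by (simp add: mult_ac)
    qed simp
    then show ?thesis unfolding q_def by (simp add: divide_simps mult_ac)
  qed
  have "(\<lambda>n. \<integral>x. q n x \<partial>lborel) \<longlonglongrightarrow> (\<integral>x. g' x \<partial>lborel)"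
    by (rule integral_dominated_convergence[where w="\<lambda>x. 3 ^ CARD('d) * C * lorentz x"])
      (use lim bound integrable_lorentz \<open>g' \<in> _\<close> in auto)
  moreover have "(\<integral>x. q n x \<partial>lborel) = 0" for n
  proof -
    have ig: "integrable lborel g" by (rule integrable_lorentz_bounded[OF _ g]) simp
    have "integrable lborel (\<lambda>x. g (x + (1 / Suc n) *\<^sub>R e))"
    proof (rule integrable_lorentz_bounded)
      fix x
      have "norm ((1 / real (Suc n)) *\<^sub>R e) \<le> 1" using e by (simp add: divide_le_eq)
      then have "C * lorentz (x + (1 / Suc n) *\<^sub>R e) \<le> C * (3 ^ CARD('d) * lorentz x)"
        by (intro mult_left_mono lorentz_shift_le C)
      then show "norm (g (x + (1 / Suc n) *\<^sub>R e)) \<le> (C * 3 ^ CARD('d)) * lorentz x"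
        using g[of "x + (1 / Suc n) *\<^sub>R e"] by (simp add: mult_ac)
    qed simp
    moreover have "(\<integral>x. g (x + (1 / Suc n) *\<^sub>R e) \<partial>lborel) = (\<integral>x. g x \<partial>lborel)"
      using lborel_integral_translate[of g "(1 / Suc n) *\<^sub>R e"] by (simp add: add.commute)
    ultimately show ?thesis unfolding q_def using ig by simp
  qed
  ultimately show ?thesis by (simp add: LIMSEQ_const_iff)
qed

lemma scaleR_complex_conv: "r *\<^sub>R z = of_real r * z" for z :: complex
  by (rule scaleR_conv_of_real)

section \<open>Integration by parts and decay of Fourier integrals\<close>

text \<open>The directional derivative of \<open>cis (p \<bullet> x) * f x\<close> has integral
  zero; the product rule splits it into the two integrals of the claim.\<close>

lemma integral_by_parts_cis:
  fixes f f' :: "real ^ 'd::finite \<Rightarrow> complex"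
  assumes d: "\<And>x t. ((\<lambda>t. f (x + t *\<^sub>R e)) has_vector_derivative f' (x + t *\<^sub>R e)) (at t)"
    and e: "norm e \<le> 1"
    and f: "\<And>x. norm (f x) \<le> C * lorentz x" and f': "\<And>x. norm (f' x) \<le> C * lorentz x"
    and [measurable]: "f \<in> borel_measurable borel" "f' \<in> borel_measurable borel"
  shows "of_real (p \<bullet> e) * (\<integral>x. cis (p \<bullet> x) * f x \<partial>lborel) = \<i> * (\<integral>x. cis (p \<bullet> x) * f' x \<partial>lborel)"
proof -
  have "0 \<le> C * lorentz (0 :: real ^ 'd)" by (rule order_trans[OF norm_ge_zero f])
  then have C: "0 \<le> C" using lorentz_pos[of "0 :: real ^ 'd"] by (simp add: zero_le_mult_iff)
  have [measurable]: "(\<lambda>x. cis (p \<bullet> x)) \<in> borel_measurable borel"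
    by (intro borel_measurable_continuous_onI continuous_intros)
  have i: "integrable lborel (\<lambda>x. cis (p \<bullet> x) * f x)" "integrable lborel (\<lambda>x. cis (p \<bullet> x) * f' x)"
    by (rule integrable_lorentz_bounded[where C=C], use f f' in \<open>auto simp: norm_mult\<close>)+
  have "(\<integral>x. (\<i> * of_real (p \<bullet> e)) * (cis (p \<bullet> x) * f x) + cis (p \<bullet> x) * f' x \<partial>lborel) = 0"
  proof (rule integral_directional_derivative_eq_0[where g="\<lambda>x. cis (p \<bullet> x) * f x" and e=e
        and C="(\<bar>p \<bullet> e\<bar> + 1) * C"])
    fix x t
    have 1: "((\<lambda>t. cis (p \<bullet> x + t * (p \<bullet> e))) has_vector_derivative
        (p \<bullet> e) *\<^sub>R (\<i> * cis (p \<bullet> (x + t *\<^sub>R e)))) (at t)"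
    proof -
      have "((\<lambda>z. exp (\<i> * (of_real (p \<bullet> x) + z * of_real (p \<bullet> e)))) has_field_derivative
         exp (\<i> * (of_real (p \<bullet> x) + of_real t * of_real (p \<bullet> e))) * (\<i> * of_real (p \<bullet> e))) (at (of_real t))"
        by (auto intro!: derivative_eq_intros)
      from has_vector_derivative_real_field[OF this]
      show ?thesis by (simp add: cis_conv_exp inner_add_right scaleR_complex_conv mult_ac)
    qed
    have "((\<lambda>t. cis (p \<bullet> x + t * (p \<bullet> e)) * f (x + t *\<^sub>R e)) has_vector_derivative
       cis (p \<bullet> x + t * (p \<bullet> e)) * f' (x + t *\<^sub>R e) + (p \<bullet> e) *\<^sub>R (\<i> * cis (p \<bullet> (x + t *\<^sub>R e))) * f (x + t *\<^sub>R e)) (at t)"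
      by (rule has_vector_derivative_mult[OF 1 d])
    then show "((\<lambda>t. cis (p \<bullet> (x + t *\<^sub>R e)) * f (x + t *\<^sub>R e)) has_vector_derivative
      (\<i> * of_real (p \<bullet> e)) * (cis (p \<bullet> (x + t *\<^sub>R e)) * f (x + t *\<^sub>R e)) + cis (p \<bullet> (x + t *\<^sub>R e)) * f' (x + t *\<^sub>R e)) (at t)"
      by (simp add: inner_add_right scaleR_complex_conv algebra_simps)
  next
    fix x :: "real ^ 'd"
    have CC: "C * lorentz x \<le> (\<bar>p \<bullet> e\<bar> + 1) * C * lorentz x"
      using C by (intro mult_right_mono) (auto simp: distrib_right)
    show "norm (cis (p \<bullet> x) * f x) \<le> (\<bar>p \<bullet> e\<bar> + 1) * C * lorentz x"
      using f[of x] CC by (simp add: norm_mult)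
    have "norm ((\<i> * of_real (p \<bullet> e)) * (cis (p \<bullet> x) * f x) + cis (p \<bullet> x) * f' x) \<le> \<bar>p \<bullet> e\<bar> * norm (f x) + norm (f' x)"
      by (rule order_trans[OF norm_triangle_ineq]) (simp add: norm_mult)
    also have "\<dots> \<le> \<bar>p \<bullet> e\<bar> * (C * lorentz x) + C * lorentz x"
      by (intro add_mono mult_left_mono f f') auto
    finally show "norm ((\<i> * of_real (p \<bullet> e)) * (cis (p \<bullet> x) * f x) + cis (p \<bullet> x) * f' x) \<le> (\<bar>p \<bullet> e\<bar> + 1) * C * lorentz x"
      by (simp add: algebra_simps)
  qed (use e in auto)
  then have "\<i> * of_real (p \<bullet> e) * (\<integral>x. cis (p \<bullet> x) * f x \<partial>lborel) + (\<integral>x. cis (p \<bullet> x) * f' x \<partial>lborel) = 0"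
    using i by (simp add: Bochner_Integration.integral_add)
  then have "\<i> * (\<i> * of_real (p \<bullet> e) * (\<integral>x. cis (p \<bullet> x) * f x \<partial>lborel) + (\<integral>x. cis (p \<bullet> x) * f' x \<partial>lborel)) = 0"
    by simp
  then show ?thesis by (simp add: algebra_simps)
qed

lemma borel_measurable_character [measurable]: "(\<lambda>x. cis (p \<bullet> x)) \<in> borel_measurable borel"
  by (intro borel_measurable_continuous_onI continuous_intros)

lemma norm_integral_cis_le:
  fixes f :: "real ^ 'd::finite \<Rightarrow> complex"
  assumes "\<And>x. norm (f x) \<le> C * lorentz x" and [measurable]: "f \<in> borel_measurable borel"
  shows "norm (\<integral>x. cis (p \<bullet> x) * f x \<partial>lborel) \<le> C * (\<integral>x. lorentz x \<partial>(lborel :: (real ^ 'd) measure))"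
proof -
  have "norm (\<integral>x. cis (p \<bullet> x) * f x \<partial>lborel) \<le> (\<integral>x. C * lorentz x \<partial>(lborel :: (real ^ 'd) measure))"
    by (rule Bochner_Integration.integral_norm_bound_integral[OF integrable_lorentz_bounded[where C=C]])
      (use assms(1) integrable_lorentz in \<open>auto simp: norm_mult\<close>)
  then show ?thesis by simp
qed

text \<open>Each integration by parts trades a factor \<open>p \<bullet> e\<close> for one more
  derivative along e.\<close>

lemma iterated_by_parts_bound:
  fixes G :: "nat \<Rightarrow> real ^ 'd::finite \<Rightarrow> complex"
  assumes d: "\<And>j x t. ((\<lambda>t. G j (x + t *\<^sub>R e)) has_vector_derivative G (Suc j) (x + t *\<^sub>R e)) (at t)"
    and e: "norm e \<le> 1"
    and b: "\<And>j x. j \<le> K \<Longrightarrow> norm (G j x) \<le> C * lorentz x"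
    and m: "\<And>j. G j \<in> borel_measurable borel"
  shows "\<bar>p \<bullet> e\<bar> ^ K * norm (\<integral>x. cis (p \<bullet> x) * G 0 x \<partial>lborel)
    \<le> C * (\<integral>x. lorentz x \<partial>(lborel :: (real ^ 'd) measure))"
proof -
  have "j \<le> K \<Longrightarrow> \<bar>p \<bullet> e\<bar> ^ j * norm (\<integral>x. cis (p \<bullet> x) * G 0 x \<partial>lborel) = norm (\<integral>x. cis (p \<bullet> x) * G j x \<partial>lborel)" for j
  proof (induction j)
    case (Suc j)
    have "of_real (p \<bullet> e) * (\<integral>x. cis (p \<bullet> x) * G j x \<partial>lborel) = \<i> * (\<integral>x. cis (p \<bullet> x) * G (Suc j) x \<partial>lborel)"
      using Suc.prems by (intro integral_by_parts_cis[OF d e b b m m]) auto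
    then have "norm (of_real (p \<bullet> e) * (\<integral>x. cis (p \<bullet> x) * G j x \<partial>lborel)) = norm (\<i> * (\<integral>x. cis (p \<bullet> x) * G (Suc j) x \<partial>lborel))"
      by simp
    then show ?case using Suc by (simp add: norm_mult mult_ac)
  qed simp
  from this[of K] norm_integral_cis_le[OF b[of K] m] show ?thesis by simp
qed

text \<open>Let q be the largest coordinate modulus. Then 1 + norm p \<le> d (1 + q), and of the 2d
  + 1 powers of 1 + q one controls this factor and 2d pay for the weight. The powers of 2 come from
  (1 + q)^(2d+1) \<le> 2^(2d+1) (1 + q^(2d+1)) and from adding the two bounds by T.\<close>

lemma lorentz_decay:
  fixes p :: "real ^ 'd::finite"
  assumes K: "\<And>i. \<bar>p $ i\<bar> ^ (2 * CARD('d) + 1) * A \<le> T" and "A \<le> T" and A: "0 \<le> A"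
  shows "(1 + norm p) * A \<le> 2 ^ (2 * CARD('d) + 2) * real CARD('d) * T * lorentz p"
proof -
  let ?d = "CARD('d)"
  define q where "q = Max (range (\<lambda>i. \<bar>p $ i\<bar>))"
  have q: "\<bar>p $ i\<bar> \<le> q" for i unfolding q_def by (rule Max_ge) auto
  have "q \<in> range (\<lambda>i. \<bar>p $ i\<bar>)" unfolding q_def by (rule Max_in) auto
  then obtain i where i: "q = \<bar>p $ i\<bar>" by auto
  have q0: "0 \<le> q" by (simp add: i)
  have d1: "1 \<le> real ?d" by (simp add: Suc_leI)
  have "norm p \<le> (\<Sum>i\<in>UNIV. \<bar>p $ i\<bar>)" by (rule norm_le_l1_cart)
  also have "\<dots> \<le> (\<Sum>i\<in>(UNIV :: 'd set). q)" by (intro sum_mono q)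
  finally have np: "1 + norm p \<le> real ?d * (1 + q)"
    using d1 unfolding sum_constant by (simp only: distrib_left mult_1_right)
  have lp: "1 \<le> (1 + q) ^ (2 * ?d) * lorentz p" by (rule one_le_power_lorentz[OF q])
  have pw: "(1 + q) ^ (2 * ?d + 1) * A \<le> 2 ^ (2 * ?d + 2) * T"
  proof -
    have "(1 + q) ^ (2 * ?d + 1) \<le> (2 * max 1 q) ^ (2 * ?d + 1)"
      using q0 by (intro power_mono) auto
    also have "\<dots> = 2 ^ (2 * ?d + 1) * max 1 q ^ (2 * ?d + 1)" by (rule power_mult_distrib)
    also have "\<dots> \<le> 2 ^ (2 * ?d + 1) * (1 + q ^ (2 * ?d + 1))"
      using q0 by (intro mult_left_mono) (auto simp: max_def)
    finally have "(1 + q) ^ (2 * ?d + 1) * A \<le> 2 ^ (2 * ?d + 1) * (1 + q ^ (2 * ?d + 1)) * A"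
      using A by (rule mult_right_mono)
    also have "\<dots> = 2 ^ (2 * ?d + 1) * (A + q ^ (2 * ?d + 1) * A)" by (simp add: algebra_simps)
    also have "\<dots> \<le> 2 ^ (2 * ?d + 1) * (T + T)"
      using K[of i] assms(2) by (intro mult_left_mono add_mono) (auto simp: i)
    finally show ?thesis by simp
  qed
  have "(1 + norm p) * A \<le> real ?d * (1 + q) * A * 1" using np A by (simp add: mult_right_mono)
  also have "\<dots> \<le> real ?d * (1 + q) * A * ((1 + q) ^ (2 * ?d) * lorentz p)"
    using A q0 by (intro mult_left_mono lp) auto
  also have "\<dots> = real ?d * lorentz p * ((1 + q) ^ (2 * ?d + 1) * A)" by simp
  also have "\<dots> \<le> real ?d * lorentz p * (2 ^ (2 * ?d + 2) * T)"
    by (intro mult_left_mono pw) auto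
  finally show ?thesis by (simp add: mult_ac)
qed

section \<open>Decay and Lipschitz bounds for the kernel\<close>

definition freq_ft :: "((real ^ 'd::finite) \<times> (real ^ 'd) \<Rightarrow> complex) \<Rightarrow> real ^ 'd \<Rightarrow> real ^ 'd \<Rightarrow> complex" where
  "freq_ft a x p = (\<integral>\<xi>. cis (p \<bullet> \<xi>) * a (x, \<xi>) \<partial>lborel)"

lemma partial_chain:
  fixes a :: "(real ^ 'd::finite) \<times> (real ^ 'd) \<Rightarrow> complex"
  assumes "a \<in> schwartz"
  shows "((\<lambda>t. iter_partial (replicate j (0, axis i 1)) a (x, \<xi> + t *\<^sub>R axis i 1)) has_vector_derivative
    iter_partial (replicate (Suc j) (0, axis i 1)) a (x, \<xi> + t *\<^sub>R axis i 1)) (at t)"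
proof -
  have "set (replicate j (0, axis i 1)) \<subseteq> (Basis :: ((real ^ 'd) \<times> (real ^ 'd)) set)"
    by (auto simp: Basis_prod_def)
  from vector_derivative_along_line[OF schwartz_has_derivative[OF assms this], of "(x, \<xi>)" "(0, axis i 1)" t]
  show ?thesis by simp
qed

lemma replicate_Basis: "set (replicate j (0, axis i 1)) \<subseteq> (Basis :: ((real ^ 'd::finite) \<times> (real ^ 'd)) set)"
  by (auto simp: Basis_prod_def)

lemma schwartz_section_measurable:
  fixes a :: "(real ^ 'd::finite) \<times> (real ^ 'd) \<Rightarrow> complex"
  assumes "a \<in> schwartz" "set bs \<subseteq> Basis"
  shows "(\<lambda>\<xi>. iter_partial bs a (x, \<xi>)) \<in> borel_measurable borel"
  by (rule borel_measurable_continuous_onI,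
      rule continuous_on_compose2[OF schwartz_continuous[OF assms]])
    (auto intro!: continuous_intros)

text \<open>Integrating by parts 2d + 1 times along each axis gives the decay; the power beyond the
  weight is spent in \<open>window_error\<close>. D does not depend on a, as boundedness uniform
  over sets of test functions requires. The order 2d + 2 leaves room for the additional position
  derivative in \<open>freq_ft_lipschitz\<close>.\<close>

lemma freq_ft_decay:
  "\<exists>D\<ge>0. \<forall>a\<in>schwartz. \<forall>(x :: real ^ 'd::finite) p.
    (1 + norm p) * norm (freq_ft a x p) \<le> D * schwartz_seminorm (2 * CARD('d) + 2) a * lorentz p"
proof (intro exI conjI ballI allI)
  let ?I = "\<integral>x. lorentz x \<partial>(lborel :: (real ^ 'd) measure)" and ?N = "2 * CARD('d) + 2"
  let ?D = "2 ^ (2 * CARD('d) + 2) * real CARD('d) * ?I"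
  show "0 \<le> ?D" by simp
  fix a :: "(real ^ 'd) \<times> (real ^ 'd) \<Rightarrow> complex" and x p :: "real ^ 'd"
  assume a: "a \<in> schwartz"
  let ?S = "schwartz_seminorm ?N a"
  have b: "norm (iter_partial bs a (x, \<xi>)) \<le> ?S * lorentz \<xi>" if "set bs \<subseteq> Basis" "length bs \<le> ?N" for bs \<xi>
    using schwartz_lorentz_bound[OF a that, of 0 x \<xi>] by simp
  have "\<bar>p \<bullet> axis i 1\<bar> ^ (2 * CARD('d) + 1) *
      norm (\<integral>\<xi>. cis (p \<bullet> \<xi>) * iter_partial (replicate 0 (0, axis i 1)) a (x, \<xi>) \<partial>lborel) \<le> ?S * ?I" for i
    by (rule iterated_by_parts_bound[where G="\<lambda>j \<xi>. iter_partial (replicate j (0, axis i 1)) a (x, \<xi>)",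
          OF partial_chain[OF a] _ b[OF replicate_Basis]
          schwartz_section_measurable[OF a replicate_Basis]]) auto
  then have "\<bar>p $ i\<bar> ^ (2 * CARD('d) + 1) * norm (freq_ft a x p) \<le> ?S * ?I" for i
    by (simp add: freq_ft_def inner_axis)
  moreover have "norm (freq_ft a x p) \<le> ?S * ?I"
    unfolding freq_ft_def using b[of "[]"] schwartz_section_measurable[OF a, of "[]"]
    by (intro norm_integral_cis_le) auto
  ultimately have "(1 + norm p) * norm (freq_ft a x p) \<le> 2 ^ (2 * CARD('d) + 2) * real CARD('d) * (?S * ?I) * lorentz p"
    by (intro lorentz_decay) auto
  then show "(1 + norm p) * norm (freq_ft a x p) \<le> ?D * ?S * lorentz p" by (simp add: mult_ac)
qed

text \<open>The derivative in direction (x - y, 0) is a combination of d partial derivatives with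
  coefficients of modulus at most norm (x - y). The strict bound on the length of \<open>bs\<close>
  makes room for this one derivative.\<close>

lemma schwartz_position_lipschitz:
  fixes a :: "(real ^ 'd::finite) \<times> (real ^ 'd) \<Rightarrow> complex"
  assumes a: "a \<in> schwartz" and bs: "set bs \<subseteq> Basis" "length bs < N" and N: "2 * CARD('d) \<le> N"
  shows "norm (iter_partial bs a (x, \<xi>) - iter_partial bs a (y, \<xi>))
    \<le> real CARD('d) * schwartz_seminorm N a * norm (x - y) * lorentz \<xi>"
proof -
  let ?f = "iter_partial bs a" and ?v = "x - y"
  let ?f' = "\<lambda>z. frechet_derivative ?f (at z)"
  have der: "(?f has_derivative ?f' z) (at z)" for z by (rule schwartz_has_derivative[OF a bs(1)])
  have B: "norm (?f' (z, \<xi>) (?v, 0)) \<le> real CARD('d) * schwartz_seminorm N a * norm (x - y) * lorentz \<xi>" for z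
  proof -
    have lin: "linear (?f' (z, \<xi>))" using der by (rule has_derivative_linear)
    have "(?v, 0) = (\<Sum>i\<in>UNIV. (?v $ i) *\<^sub>R (axis i 1, 0 :: real ^ 'd))"
    proof -
      have "(\<Sum>i\<in>UNIV. (?v $ i) *\<^sub>R (axis i 1, 0 :: real ^ 'd)) = (\<Sum>i\<in>UNIV. (?v $ i) *\<^sub>R axis i 1, 0)"
        by (simp add: scaleR_prod_def sum_prod)
      also have "(\<Sum>i\<in>UNIV. (?v $ i) *\<^sub>R axis i 1) = ?v"
        using basis_expansion[of ?v] unfolding scalar_mult_eq_scaleR .
      finally show ?thesis ..
    qed
    then have "?f' (z, \<xi>) (?v, 0) = (\<Sum>i\<in>UNIV. (?v $ i) *\<^sub>R ?f' (z, \<xi>) (axis i 1, 0))"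
      by (simp only: linear_sum[OF lin] linear_cmul[OF lin])
    also have "norm \<dots> \<le> (\<Sum>i\<in>(UNIV :: 'd set). norm ?v * (schwartz_seminorm N a * lorentz \<xi>))"
    proof (rule sum_norm_le)
      fix i
      have "norm (iter_partial ((axis i 1, 0) # bs) a (z, \<xi>)) \<le> schwartz_seminorm N a * lorentz \<xi>"
        using schwartz_lorentz_bound[OF a, of "(axis i 1, 0) # bs" N 0 z \<xi>] bs N
        by (auto simp: Basis_prod_def)
      then show "norm ((?v $ i) *\<^sub>R ?f' (z, \<xi>) (axis i 1, 0)) \<le> norm ?v * (schwartz_seminorm N a * lorentz \<xi>)"
        using component_le_norm_cart[of ?v i] by (simp del: vector_minus_component add: mult_mono)
    qed
    finally show ?thesis by (simp add: mult_ac)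
  qed
  have "norm (?f ((y, \<xi>) + 1 *\<^sub>R (?v, 0)) - ?f ((y, \<xi>) + 0 *\<^sub>R (?v, 0)))
     \<le> 1 * (real CARD('d) * schwartz_seminorm N a * norm (x - y) * lorentz \<xi>)"
    by (rule vector_derivative_increment_bound[OF _ vector_derivative_along_line[OF der]]) (use B in auto)
  then show ?thesis by simp
qed

text \<open>The integrations by parts are applied to the difference of two frequency sections of
  \<open>a\<close>, whose frequency derivatives are Lipschitz in the position.\<close>

lemma freq_ft_lipschitz:
  fixes a :: "(real ^ 'd::finite) \<times> (real ^ 'd) \<Rightarrow> complex"
  assumes a: "a \<in> schwartz"
  shows "\<exists>D\<ge>0. \<forall>x y p. norm (freq_ft a x p - freq_ft a y p) \<le> D * norm (x - y) * lorentz p"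
proof (intro exI conjI allI)
  let ?I = "\<integral>x. lorentz x \<partial>(lborel :: (real ^ 'd) measure)" and ?N = "2 * CARD('d) + 2"
  let ?S = "schwartz_seminorm ?N a"
  let ?D = "2 ^ (2 * CARD('d) + 2) * real CARD('d) * (real CARD('d) * ?S * ?I)"
  have S0: "0 \<le> ?S"
    using schwartz_seminorm_bound[OF a, of "[]" ?N 0] by (rule order_trans[rotated]) auto
  then show "0 \<le> ?D" by simp
  fix x y p :: "real ^ 'd"
  let ?e = "norm (freq_ft a x p - freq_ft a y p)"
  let ?C = "real CARD('d) * ?S * norm (x - y)"
  let ?G = "\<lambda>i j \<xi>. iter_partial (replicate j (0, axis i 1)) a (x, \<xi>) - iter_partial (replicate j (0, axis i 1)) a (y, \<xi>)"
  have int: "integrable lborel (\<lambda>\<xi>. cis (p \<bullet> \<xi>) * a (z, \<xi>))" for z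
  proof (rule integrable_lorentz_bounded[where C="?S"])
    show "(\<lambda>\<xi>. cis (p \<bullet> \<xi>) * a (z, \<xi>)) \<in> borel_measurable borel"
      using schwartz_section_measurable[OF a, of "[]" z]
      by (intro borel_measurable_times borel_measurable_continuous_onI[of "\<lambda>\<xi>. cis (p \<bullet> \<xi>)"] continuous_intros) auto
    show "norm (cis (p \<bullet> \<xi>) * a (z, \<xi>)) \<le> ?S * lorentz \<xi>" for \<xi>
      using schwartz_lorentz_bound[OF a, of "[]" ?N 0 z \<xi>] by (simp add: norm_mult)
  qed
  have diff: "freq_ft a x p - freq_ft a y p = (\<integral>\<xi>. cis (p \<bullet> \<xi>) * (a (x, \<xi>) - a (y, \<xi>)) \<partial>lborel)"
    unfolding freq_ft_def right_diff_distrib using int by simp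
  have b: "norm (iter_partial bs a (x, \<xi>) - iter_partial bs a (y, \<xi>)) \<le> ?C * lorentz \<xi>" if "set bs \<subseteq> Basis" "length bs < ?N" for bs \<xi>
    using schwartz_position_lipschitz[OF a that] by simp
  have "\<bar>p \<bullet> axis i 1\<bar> ^ (2 * CARD('d) + 1) * norm (\<integral>\<xi>. cis (p \<bullet> \<xi>) * ?G i 0 \<xi> \<partial>lborel) \<le> ?C * ?I" for i
    by (rule iterated_by_parts_bound[where G="?G i", OF has_vector_derivative_diff[OF partial_chain[OF a] partial_chain[OF a]]
          _ b[OF replicate_Basis] borel_measurable_diff[OF schwartz_section_measurable[OF a replicate_Basis]
            schwartz_section_measurable[OF a replicate_Basis]]]) auto
  then have "\<bar>p $ i\<bar> ^ (2 * CARD('d) + 1) * ?e \<le> ?C * ?I" for i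
    by (simp add: diff inner_axis)
  moreover have "?e \<le> ?C * ?I"
    unfolding diff using b[of "[]"] borel_measurable_diff[OF schwartz_section_measurable[OF a, of "[]" x] schwartz_section_measurable[OF a, of "[]" y]]
    by (intro norm_integral_cis_le) auto
  ultimately have *: "(1 + norm p) * ?e \<le> 2 ^ (2 * CARD('d) + 2) * real CARD('d) * (?C * ?I) * lorentz p"
    by (intro lorentz_decay) auto
  have "?e \<le> (1 + norm p) * ?e"
    by (simp add: distrib_right)
  with * show "?e \<le> ?D * norm (x - y) * lorentz p" by (simp add: mult_ac)
qed

section \<open>Kernel form of the distributions\<close>

text \<open>The bound is linear in the mean-square size t of R on one cell. Applied to the remainder
  of a Fourier series, it turns convergence in the cell into convergence of integrals against
  weighted functions on the whole space.\<close>

lemma periodic_L2_weighted: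
  fixes R f :: "real ^ 'd::finite \<Rightarrow> complex"
  assumes [measurable]: "R \<in> borel_measurable borel" "f \<in> borel_measurable borel"
    and per: "\<And>x n. R (x + (2 * pi) *\<^sub>R lattice_vec n) = R x"
    and f: "\<And>x. norm (f x) \<le> S * lorentz x" and S: "0 \<le> S"
    and c: "0 < c" and t: "0 < t"
    and R: "(\<integral>\<^sup>+x\<in>torus_cell. ennreal ((norm (R x))\<^sup>2) \<partial>lborel) \<le> ennreal (t\<^sup>2)"
  defines "I \<equiv> \<integral>x. lorentz x \<partial>(lborel :: (real ^ 'd) measure)"
  shows "integrable lborel (\<lambda>x. R (c *\<^sub>R x) * f x)"
    and "norm (\<integral>x. R (c *\<^sub>R x) * f x \<partial>lborel) \<le> S * t * (I + (1 + c) ^ CARD('d) / c ^ CARD('d)) / 2"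
proof -
  let ?K = "(1 + c) ^ CARD('d) / c ^ CARD('d)"
  let ?X = "S * t * (I + ?K) / 2"
  let ?q = "\<lambda>x. ennreal ((norm (R (c *\<^sub>R x)))\<^sup>2) * ennreal (lorentz x)"
  let ?n = "\<lambda>x. ennreal (norm (R (c *\<^sub>R x) * f x))"
  have K: "0 \<le> ?K" and I: "0 \<le> I" using c by (simp_all add: I_def)
  have nI: "(\<integral>\<^sup>+x. ennreal (lorentz x) \<partial>(lborel :: (real ^ 'd) measure)) = ennreal I"
    unfolding I_def by (rule nn_integral_eq_integral[OF integrable_lorentz]) auto
  have nR: "(\<integral>\<^sup>+x. ?q x \<partial>lborel) \<le> ennreal (?K * t\<^sup>2)"
  proof -
    have "(\<integral>\<^sup>+x. ?q x \<partial>lborel)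
        \<le> ennreal ?K * (\<integral>\<^sup>+x\<in>torus_cell. ennreal ((norm (R x))\<^sup>2) \<partial>lborel)"
      by (rule nn_integral_periodic_lorentz) (use per c in auto)
    also have "\<dots> \<le> ennreal ?K * ennreal (t\<^sup>2)" by (intro mult_left_mono R) auto
    finally show ?thesis using K by (subst ennreal_mult) auto
  qed
  have "(\<integral>\<^sup>+x. ?n x \<partial>lborel)
     \<le> (\<integral>\<^sup>+x. ennreal (S * t / 2) * ennreal (lorentz x) + ennreal (S / (2 * t)) * (?q x) \<partial>lborel)"
  proof (rule nn_integral_mono)
    fix x
    let ?r = "norm (R (c *\<^sub>R x))"
    \<comment> \<open>The linear term is split at scale t: the constant part is integrated against
      the weight, the square against the periodic bound, and both contributions are of order
      t.\<close>
    have r: "?r \<le> t / 2 + ?r\<^sup>2 / (2 * t)"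
      using am_gm_weighted[OF t, of 1 ?r] by (simp add: add_divide_distrib)
    have "norm (R (c *\<^sub>R x) * f x) \<le> ?r * (S * lorentz x)"
      unfolding norm_mult by (intro mult_left_mono f) auto
    also have "\<dots> \<le> (t / 2 + ?r\<^sup>2 / (2 * t)) * (S * lorentz x)"
      using S by (intro mult_right_mono r) auto
    also have "\<dots> = S * t / 2 * lorentz x + S / (2 * t) * (?r\<^sup>2 * lorentz x)"
      by (simp add: algebra_simps)
    finally have "?n x \<le> ennreal (S * t / 2 * lorentz x + S / (2 * t) * (?r\<^sup>2 * lorentz x))"
      by (rule ennreal_leI)
    also have "\<dots> = ennreal (S * t / 2) * ennreal (lorentz x) + ennreal (S / (2 * t)) * (ennreal (?r\<^sup>2) * ennreal (lorentz x))"
    proof -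
      have "ennreal (a * b + e * (q * b)) = ennreal a * ennreal b + ennreal e * (ennreal q * ennreal b)"
        if "0 \<le> a" "0 \<le> b" "0 \<le> e" "0 \<le> q" for a b e q
        using that by (simp add: ennreal_mult ennreal_plus)
      note eq = this
      show ?thesis by (rule eq) (use S t in auto)
    qed
    finally show "?n x \<le> ennreal (S * t / 2) * ennreal (lorentz x) + ennreal (S / (2 * t)) * (ennreal (?r\<^sup>2) * ennreal (lorentz x))" .
  qed
  also have "\<dots> = ennreal (S * t / 2) * ennreal I + ennreal (S / (2 * t)) * (\<integral>\<^sup>+x. ?q x \<partial>lborel)"
    by (subst nn_integral_add) (auto simp: nn_integral_cmult nI)
  also have "\<dots> \<le> ennreal (S * t / 2) * ennreal I + ennreal (S / (2 * t)) * ennreal (?K * t\<^sup>2)"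
    by (intro add_left_mono mult_left_mono nR) auto
  also have "\<dots> = ennreal ?X"
  proof -
    have "ennreal a * ennreal b + ennreal e * ennreal q = ennreal (a * b + e * q)"
      if "0 \<le> a" "0 \<le> b" "0 \<le> e" "0 \<le> q" for a b e q
      using that by (simp add: ennreal_mult ennreal_plus)
    note eq = this
    have "ennreal (S * t / 2) * ennreal I + ennreal (S / (2 * t)) * ennreal (?K * t\<^sup>2)
      = ennreal (S * t / 2 * I + S / (2 * t) * (?K * t\<^sup>2))"
      by (rule eq) (use S t I mult_nonneg_nonneg[OF K zero_le_power2[of t]] in auto)
    also have "S / (2 * t) * (k * t\<^sup>2) = S * t / 2 * k" for k using t by (simp add: power2_eq_square)
    finally show ?thesis by (simp add: algebra_simps add_divide_distrib)
  qed
  finally have *: "(\<integral>\<^sup>+x. ?n x \<partial>lborel) \<le> ennreal ?X" .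
  show int: "integrable lborel (\<lambda>x. R (c *\<^sub>R x) * f x)"
    by (rule integrableI_bounded) (use * le_less_trans[OF *] in auto)
  have "ennreal (norm (\<integral>x. R (c *\<^sub>R x) * f x \<partial>lborel)) \<le> ennreal ?X"
    using integral_norm_bound_ennreal[OF int] * by (rule order_trans)
  moreover have "0 \<le> ?X" using S t I K by simp
  ultimately show "norm (\<integral>x. R (c *\<^sub>R x) * f x \<partial>lborel) \<le> ?X" by (simp only: ennreal_le_iff)
qed

definition symbol_coeff :: "(int ^ 'd::finite \<Rightarrow> complex) \<Rightarrow> real \<Rightarrow> ((real ^ 'd) \<times> (real ^ 'd) \<Rightarrow> complex) \<Rightarrow> real ^ 'd \<Rightarrow> int ^ 'd \<Rightarrow> complex" where
  "symbol_coeff U c a x m = (\<integral>\<xi>. dft U (c *\<^sub>R \<xi>) * cis (lattice_vec m \<bullet> (c *\<^sub>R \<xi>)) * a (x, \<xi>) \<partial>lborel)"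

lemma schwartz_seminorm_nonneg:
  assumes "a \<in> schwartz" shows "0 \<le> schwartz_seminorm N a"
  using schwartz_seminorm_bound[OF assms, of "[]" N 0] by (rule order_trans[rotated]) auto

text \<open>\<open>dft U\<close> is only a mean-square limit, so the series cannot be inserted
  pointwise. The difference from a partial sum is periodic and small on the cell, and
  \<open>periodic_L2_weighted\<close> applies to it with the character absorbed into f.\<close>

lemma
  fixes a :: "(real ^ 'd::finite) \<times> (real ^ 'd) \<Rightarrow> complex"
  assumes U: "U \<in> discrete_L2" and a: "a \<in> schwartz" and c: "0 < c"
  shows symbol_coeff_integrable: "integrable lborel (\<lambda>\<xi>. dft U (c *\<^sub>R \<xi>) * cis (lattice_vec m \<bullet> (c *\<^sub>R \<xi>)) * a (x, \<xi>))"
    and symbol_coeff_tendsto: "((\<lambda>B. \<Sum>n\<in>B. U n * freq_ft a x (c *\<^sub>R lattice_vec (m - n))) \<longlongrightarrow> symbol_coeff U c a x m) (finite_subsets_at_top UNIV)"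
proof -
  let ?F = "dft U" and ?S = "schwartz_seminorm (2 * CARD('d)) a"
  define f where "f \<xi> = cis (lattice_vec m \<bullet> (c *\<^sub>R \<xi>)) * a (x, \<xi>)" for \<xi>
  have [measurable]: "(\<lambda>\<xi>. a (x, \<xi>)) \<in> borel_measurable borel"
    using schwartz_section_measurable[OF a, of "[]"] by simp
  have [measurable]: "f \<in> borel_measurable borel"
    using borel_measurable_character[of "c *\<^sub>R lattice_vec m"] unfolding f_def by simp
  have ab: "norm (a (x, \<xi>)) \<le> ?S * lorentz \<xi>" for \<xi>
    using schwartz_lorentz_bound[OF a, of "[]" "2 * CARD('d)" 0 x \<xi>] by simp
  then have fb: "norm (f \<xi>) \<le> ?S * lorentz \<xi>" for \<xi> by (simp add: f_def norm_mult)
  have S0: "0 \<le> ?S" by (rule schwartz_seminorm_nonneg[OF a])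
  have dft: "is_dft U ?F" by (rule is_dft_dft[OF U])
  then have [measurable]: "?F \<in> borel_measurable borel" by (simp add: is_dft_def)
  have Fper: "?F (\<xi> + (2 * pi) *\<^sub>R lattice_vec n) = ?F \<xi>" for \<xi> n using dft by (simp add: is_dft_def)
  have lim: "((\<lambda>A. \<integral>\<^sup>+\<xi>\<in>torus_cell. ennreal ((norm (?F \<xi> - trig_sum U A \<xi>))\<^sup>2) \<partial>lborel) \<longlongrightarrow> 0) (finite_subsets_at_top UNIV)"
    using dft by (simp add: is_dft_def trig_sum_def)
  let ?r = "\<lambda>B \<xi>. (?F (c *\<^sub>R \<xi>) - trig_sum U B (c *\<^sub>R \<xi>)) * f \<xi>"
  define L where "L = ?S * ((\<integral>x. lorentz x \<partial>(lborel :: (real ^ 'd) measure)) + (1 + c) ^ CARD('d) / c ^ CARD('d)) / 2"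
  have L0: "0 \<le> L" unfolding L_def using S0 c by simp
  have ev: "\<forall>\<^sub>F B in finite_subsets_at_top UNIV. integrable lborel (?r B) \<and> norm (integral\<^sup>L lborel (?r B)) \<le> t * L" if t: "0 < t" for t
  proof -
    have "\<forall>\<^sub>F A in finite_subsets_at_top UNIV. (\<integral>\<^sup>+\<xi>\<in>torus_cell. ennreal ((norm (?F \<xi> - trig_sum U A \<xi>))\<^sup>2) \<partial>lborel) < ennreal (t\<^sup>2)"
      using t by (intro order_tendstoD(2)[OF lim]) auto
    then show ?thesis
    proof eventually_elim
      case (elim A)
      have p: "?F (\<xi> + (2 * pi) *\<^sub>R lattice_vec n) - trig_sum U A (\<xi> + (2 * pi) *\<^sub>R lattice_vec n) = ?F \<xi> - trig_sum U A \<xi>" for \<xi> n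
        by (simp only: Fper trig_sum_periodic)
      from periodic_L2_weighted[of "\<lambda>\<xi>. ?F \<xi> - trig_sum U A \<xi>" f, OF _ _ p fb S0 c t less_imp_le[OF elim]]
      show ?case by (simp add: L_def mult_ac)
    qed
  qed
  have ti: "integrable lborel (\<lambda>\<xi>. trig_sum U B (c *\<^sub>R \<xi>) * f \<xi>)"
    and ts: "(\<integral>\<xi>. trig_sum U B (c *\<^sub>R \<xi>) * f \<xi> \<partial>lborel) = (\<Sum>n\<in>B. U n * freq_ft a x (c *\<^sub>R lattice_vec (m - n)))" for B
  proof -
    have eq: "trig_sum U B (c *\<^sub>R \<xi>) * f \<xi> = (\<Sum>n\<in>B. U n * (cis ((c *\<^sub>R lattice_vec (m - n)) \<bullet> \<xi>) * a (x, \<xi>)))" for \<xi>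
    proof -
      have "cis (- (lattice_vec n \<bullet> (c *\<^sub>R \<xi>))) * cis (lattice_vec m \<bullet> (c *\<^sub>R \<xi>)) = cis ((c *\<^sub>R lattice_vec (m - n)) \<bullet> \<xi>)" for n
        by (simp add: cis_mult lattice_vec_diff inner_diff_left right_diff_distrib)
      then show ?thesis unfolding trig_sum_def f_def
        by (simp only: sum_distrib_right mult.assoc[symmetric]) (simp only: mult.assoc)
    qed
    have i: "integrable lborel (\<lambda>\<xi>. cis (p \<bullet> \<xi>) * a (x, \<xi>))" for p
      by (rule integrable_lorentz_bounded[where C="?S"]) (use ab in \<open>auto simp: norm_mult\<close>)
    show "integrable lborel (\<lambda>\<xi>. trig_sum U B (c *\<^sub>R \<xi>) * f \<xi>)" unfolding eq
      by (intro Bochner_Integration.integrable_sum integrable_mult_right i)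
    show "(\<integral>\<xi>. trig_sum U B (c *\<^sub>R \<xi>) * f \<xi> \<partial>lborel) = (\<Sum>n\<in>B. U n * freq_ft a x (c *\<^sub>R lattice_vec (m - n)))"
      unfolding eq freq_ft_def
      by (subst Bochner_Integration.integral_sum) (intro integrable_mult_right i, simp only: integral_mult_right_zero)
  qed
  \<comment> \<open>One finite set with integrable remainder suffices: adding back the trigonometric
    sum recovers the full integrand.\<close>
  have Fi: "integrable lborel (\<lambda>\<xi>. ?F (c *\<^sub>R \<xi>) * f \<xi>)"
  proof -
    obtain B where "integrable lborel (?r B)"
      using eventually_happens'[OF finite_subsets_at_top_neq_bot ev[OF zero_less_one]] by blast
    from Bochner_Integration.integrable_add[OF this ti[of B]] show ?thesis
      by (simp add: left_diff_distrib)
  qed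
  show "integrable lborel (\<lambda>\<xi>. dft U (c *\<^sub>R \<xi>) * cis (lattice_vec m \<bullet> (c *\<^sub>R \<xi>)) * a (x, \<xi>))"
    using Fi unfolding f_def by (simp add: mult.assoc)
  have co: "symbol_coeff U c a x m = (\<integral>\<xi>. ?F (c *\<^sub>R \<xi>) * f \<xi> \<partial>lborel)"
    unfolding symbol_coeff_def f_def by (simp add: mult.assoc)
  show "((\<lambda>B. \<Sum>n\<in>B. U n * freq_ft a x (c *\<^sub>R lattice_vec (m - n))) \<longlongrightarrow> symbol_coeff U c a x m) (finite_subsets_at_top UNIV)"
  proof (rule tendstoI)
    fix e :: real assume e: "0 < e"
    \<comment> \<open>The summand 1 covers the case \<open>L = 0\<close>.\<close>
    define t where "t = e / (L + 1)"
    have t: "0 < t" "t * L < e" unfolding t_def using e L0 by (auto simp: field_simps)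
    from ev[OF t(1)] show "\<forall>\<^sub>F B in finite_subsets_at_top UNIV. dist (\<Sum>n\<in>B. U n * freq_ft a x (c *\<^sub>R lattice_vec (m - n))) (symbol_coeff U c a x m) < e"
    proof eventually_elim
      case (elim B)
      have "symbol_coeff U c a x m - (\<Sum>n\<in>B. U n * freq_ft a x (c *\<^sub>R lattice_vec (m - n))) = integral\<^sup>L lborel (?r B)"
        unfolding co ts[symmetric] left_diff_distrib by (rule Bochner_Integration.integral_diff[symmetric, OF Fi ti])
      then show ?case using elim t by (simp add: dist_norm norm_minus_commute)
    qed
  qed
qed

section \<open>Bounds and truncation of the double series\<close>

lemma schur_kernel:
  fixes V W :: "int ^ 'd::finite \<Rightarrow> complex"
  assumes k: "\<And>m n. k m n \<le> T * lorentz (c *\<^sub>R lattice_vec (m - n))" and T: "0 \<le> T"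
    and fin: "finite P" "finite B" and c: "0 < c" and t: "0 < t"
    and s: "(\<Sum>m\<in>P. (norm (V m))\<^sup>2) \<le> s" "(\<Sum>n\<in>B. (norm (W n))\<^sup>2) \<le> s'"
  shows "c ^ CARD('d) * (\<Sum>m\<in>P. \<Sum>n\<in>B. norm (V m) * norm (W n) * k m n)
    \<le> T * (c + pi) ^ CARD('d) / 2 * (t * s + s' / t)"
proof -
  let ?w = "\<lambda>m n. lorentz (c *\<^sub>R lattice_vec (m - n))"
  have "c ^ CARD('d) * (\<Sum>m\<in>P. \<Sum>n\<in>B. norm (V m) * norm (W n) * k m n)
    \<le> c ^ CARD('d) * (\<Sum>m\<in>P. \<Sum>n\<in>B. norm (V m) * norm (W n) * (T * ?w m n))"
    using c by (intro mult_left_mono sum_mono k) auto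
  also have "\<dots> = T * (c ^ CARD('d) * (\<Sum>m\<in>P. \<Sum>n\<in>B. \<bar>norm (V m)\<bar> * \<bar>norm (W n)\<bar> * ?w m n))"
    by (simp add: sum_distrib_left mult_ac)
  also have "\<dots> \<le> T * ((c + pi) ^ CARD('d) / 2 * (t * (\<Sum>m\<in>P. (norm (V m))\<^sup>2) + (\<Sum>n\<in>B. (norm (W n))\<^sup>2) / t))"
    by (intro mult_left_mono schur_lorentz fin c t T)
  also have "\<dots> \<le> T * ((c + pi) ^ CARD('d) / 2 * (t * s + s' / t))"
    using s t c T by (intro mult_left_mono add_mono divide_right_mono) auto
  finally show ?thesis by simp
qed

lemma discrete_L2_sum_le:
  assumes "U \<in> discrete_L2" "finite P"
  shows "(\<Sum>m\<in>P. (norm (U m))\<^sup>2) \<le> (\<Sum>\<^sub>\<infinity>m. (norm (U m))\<^sup>2)"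
  using assms by (intro finite_sum_le_infsum) (auto simp: discrete_L2_def)

lemma tendsto_double_sum:
  fixes a :: "(real ^ 'd::finite) \<times> (real ^ 'd) \<Rightarrow> complex"
  assumes "U \<in> discrete_L2" "a \<in> schwartz" "0 < c"
  shows "((\<lambda>B. \<Sum>m\<in>P. cnj (U m) * (\<Sum>n\<in>B. U n * freq_ft a (h *\<^sub>R lattice_vec m) (c *\<^sub>R lattice_vec (m - n))))
    \<longlongrightarrow> (\<Sum>m\<in>P. cnj (U m) * symbol_coeff U c a (h *\<^sub>R lattice_vec m) m)) (finite_subsets_at_top UNIV)"
  by (intro tendsto_sum tendsto_mult_left symbol_coeff_tendsto assms)

text \<open>Schur's test bounds finite double sums. With P fixed, the inner sums over B converge to
  the coefficients, and the bound, which does not depend on B, survives the limit.\<close>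

lemma symbol_coeff_abs_sum_bound:
  fixes a :: "(real ^ 'd::finite) \<times> (real ^ 'd) \<Rightarrow> complex"
  assumes U: "U \<in> discrete_L2" and a: "a \<in> schwartz" and c: "0 < c"
    and T: "0 \<le> T" "\<And>x p. norm (freq_ft a x p) \<le> T * lorentz p" and P: "finite P"
  shows "c ^ CARD('d) * (\<Sum>m\<in>P. norm (cnj (U m) * symbol_coeff U c a (h *\<^sub>R lattice_vec m) m))
    \<le> T * (c + pi) ^ CARD('d) * (\<Sum>\<^sub>\<infinity>m. (norm (U m))\<^sup>2)"
proof (rule tendsto_upperbound)
  let ?z = "\<lambda>B m. cnj (U m) * (\<Sum>n\<in>B. U n * freq_ft a (h *\<^sub>R lattice_vec m) (c *\<^sub>R lattice_vec (m - n)))"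
  let ?s = "\<Sum>\<^sub>\<infinity>m. (norm (U m))\<^sup>2"
  show "((\<lambda>B. c ^ CARD('d) * (\<Sum>m\<in>P. norm (?z B m)))
    \<longlongrightarrow> c ^ CARD('d) * (\<Sum>m\<in>P. norm (cnj (U m) * symbol_coeff U c a (h *\<^sub>R lattice_vec m) m))) (finite_subsets_at_top UNIV)"
    by (intro tendsto_sum tendsto_mult_left tendsto_norm symbol_coeff_tendsto U a c)
  show "\<forall>\<^sub>F B in finite_subsets_at_top UNIV. c ^ CARD('d) * (\<Sum>m\<in>P. norm (?z B m))
      \<le> T * (c + pi) ^ CARD('d) * ?s"
  proof (rule eventually_finite_subsets_at_top_weakI)
    fix B :: "(int ^ 'd) set" assume B: "finite B"
    let ?k = "\<lambda>m n. norm (freq_ft a (h *\<^sub>R lattice_vec m) (c *\<^sub>R lattice_vec (m - n)))"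
    have "(\<Sum>m\<in>P. norm (?z B m))
      \<le> (\<Sum>m\<in>P. \<Sum>n\<in>B. norm (U m) * norm (U n) * ?k m n)"
    proof (rule sum_mono)
      fix m
      have "norm (?z B m)
        \<le> norm (U m) * (\<Sum>n\<in>B. norm (U n) * ?k m n)"
        unfolding norm_mult complex_mod_cnj by (intro mult_left_mono order_trans[OF norm_sum]) (auto simp: norm_mult)
      then show "norm (?z B m)
        \<le> (\<Sum>n\<in>B. norm (U m) * norm (U n) * ?k m n)" by (simp add: sum_distrib_left mult.assoc)
    qed
    then have "c ^ CARD('d) * (\<Sum>m\<in>P. norm (?z B m))
      \<le> c ^ CARD('d) * (\<Sum>m\<in>P. \<Sum>n\<in>B. norm (U m) * norm (U n) * ?k m n)"
      using c by (intro mult_left_mono) auto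
    also have "\<dots> \<le> T * (c + pi) ^ CARD('d) / 2 * (1 * ?s + ?s / 1)"
      by (rule schur_kernel) (use T P B c U discrete_L2_sum_le in auto)
    finally show "c ^ CARD('d) * (\<Sum>m\<in>P. norm (?z B m))
      \<le> T * (c + pi) ^ CARD('d) * ?s" by simp
  qed
qed simp

lemma
  fixes a :: "(real ^ 'd::finite) \<times> (real ^ 'd) \<Rightarrow> complex"
  assumes U: "U \<in> discrete_L2" and a: "a \<in> schwartz" and c: "0 < c"
    and T: "0 \<le> T" "\<And>x p. norm (freq_ft a x p) \<le> T * lorentz p"
  shows symbol_coeff_summable: "(\<lambda>m. norm (cnj (U m) * symbol_coeff U c a (h *\<^sub>R lattice_vec m) m)) summable_on UNIV"
    and symbol_coeff_infsum_bound: "c ^ CARD('d) * norm (\<Sum>\<^sub>\<infinity>m. cnj (U m) * symbol_coeff U c a (h *\<^sub>R lattice_vec m) m)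
      \<le> T * (c + pi) ^ CARD('d) * (\<Sum>\<^sub>\<infinity>m. (norm (U m))\<^sup>2)"
proof -
  let ?f = "\<lambda>m. cnj (U m) * symbol_coeff U c a (h *\<^sub>R lattice_vec m) m"
  let ?X = "T * (c + pi) ^ CARD('d) * (\<Sum>\<^sub>\<infinity>m. (norm (U m))\<^sup>2)"
  have b: "(\<Sum>m\<in>P. norm (?f m)) \<le> ?X / c ^ CARD('d)" if "finite P" for P
    using symbol_coeff_abs_sum_bound[OF U a c T that, of h] c by (simp add: pos_le_divide_eq mult.commute)
  show s: "(\<lambda>m. norm (?f m)) summable_on UNIV"
    by (rule nonneg_bdd_above_summable_on) (auto intro!: bdd_aboveI2[where M="?X / c ^ CARD('d)"] b)
  have "norm (infsum ?f UNIV) \<le> (\<Sum>\<^sub>\<infinity>m. norm (?f m))" by (rule norm_infsum_bound[OF s])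
  also have "\<dots> \<le> ?X / c ^ CARD('d)" by (rule infsum_le_finite_sums[OF s]) (rule b)
  finally show "c ^ CARD('d) * norm (infsum ?f UNIV) \<le> ?X"
    using c by (simp add: pos_le_divide_eq mult.commute)
qed

definition truncated_form ::
  "(int ^ 'd::finite) set \<Rightarrow> (int ^ 'd \<Rightarrow> complex) \<Rightarrow> real \<Rightarrow> real \<Rightarrow> ((real ^ 'd) \<times> (real ^ 'd) \<Rightarrow> complex) \<Rightarrow> complex" where
  "truncated_form B U h c a = (\<Sum>m\<in>B. \<Sum>n\<in>B. cnj (U m) * U n * freq_ft a (h *\<^sub>R lattice_vec m) (c *\<^sub>R lattice_vec (m - n)))"

text \<open>Removing the block B \<times> B leaves rows outside B, and rows in B with columns
  outside B. In either piece one factor of U is a tail of norm at most \<open>\<tau>\<close>, so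
  Schur's test gives an error of order \<open>\<tau>\<close>.\<close>

lemma truncation_error:
  fixes a :: "(real ^ 'd::finite) \<times> (real ^ 'd) \<Rightarrow> complex"
  assumes U: "U \<in> discrete_L2" and a: "a \<in> schwartz" and c: "0 < c"
    and T: "0 \<le> T" "\<And>x p. norm (freq_ft a x p) \<le> T * lorentz p"
    and B: "finite B" and \<tau>: "0 < \<tau>"
    and tail: "\<And>A. finite A \<Longrightarrow> A \<inter> B = {} \<Longrightarrow> (\<Sum>n\<in>A. (norm (U n))\<^sup>2) \<le> \<tau>\<^sup>2"
  shows "c ^ CARD('d) * norm ((\<Sum>\<^sub>\<infinity>m. cnj (U m) * symbol_coeff U c a (h *\<^sub>R lattice_vec m) m) - truncated_form B U h c a)
    \<le> T * (c + pi) ^ CARD('d) * \<tau> * (1 + (\<Sum>\<^sub>\<infinity>m. (norm (U m))\<^sup>2))"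
proof -
  let ?s = "\<Sum>\<^sub>\<infinity>m. (norm (U m))\<^sup>2"
  let ?X = "T * (c + pi) ^ CARD('d) * \<tau> * (1 + ?s)"
  let ?A = "\<lambda>m n. freq_ft a (h *\<^sub>R lattice_vec m) (c *\<^sub>R lattice_vec (m - n))"
  let ?k = "\<lambda>m n. norm (?A m n)"
  let ?e = "\<lambda>P Q. norm ((\<Sum>m\<in>P. cnj (U m) * (\<Sum>n\<in>Q. U n * ?A m n)) - truncated_form B U h c a)"
  let ?f = "\<lambda>m. cnj (U m) * symbol_coeff U c a (h *\<^sub>R lattice_vec m) m"
  have k: "?k m n \<le> T * lorentz (c *\<^sub>R lattice_vec (m - n))" for m n by (rule T)
  have fin: "c ^ CARD('d) * ?e P Q \<le> ?X"
    if PQ: "finite P" "finite Q" "B \<subseteq> P" "B \<subseteq> Q" for P Q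
  proof -
    have "(\<Sum>m\<in>P. cnj (U m) * (\<Sum>n\<in>Q. U n * ?A m n)) = (\<Sum>m\<in>P. \<Sum>n\<in>Q. cnj (U m) * U n * ?A m n)"
      by (simp add: sum_distrib_left mult.assoc)
    also have "\<dots> = (\<Sum>m\<in>P - B. \<Sum>n\<in>Q. cnj (U m) * U n * ?A m n) + (\<Sum>m\<in>B. \<Sum>n\<in>Q. cnj (U m) * U n * ?A m n)"
      using PQ by (intro sum.subset_diff) auto
    also have "(\<Sum>m\<in>B. \<Sum>n\<in>Q. cnj (U m) * U n * ?A m n)
        = (\<Sum>m\<in>B. \<Sum>n\<in>Q - B. cnj (U m) * U n * ?A m n) + truncated_form B U h c a"
      unfolding truncated_form_def sum.distrib[symmetric]
      using PQ by (intro sum.cong refl sum.subset_diff) auto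
    finally have "?e P Q
      = norm ((\<Sum>m\<in>P - B. \<Sum>n\<in>Q. cnj (U m) * U n * ?A m n) + (\<Sum>m\<in>B. \<Sum>n\<in>Q - B. cnj (U m) * U n * ?A m n))"
      by simp
    also have "\<dots> \<le> (\<Sum>m\<in>P - B. \<Sum>n\<in>Q. norm (U m) * norm (U n) * ?k m n) + (\<Sum>m\<in>B. \<Sum>n\<in>Q - B. norm (U m) * norm (U n) * ?k m n)"
      by (intro order_trans[OF norm_triangle_ineq] add_mono order_trans[OF norm_sum] sum_mono) (auto simp: norm_mult)
    finally have "c ^ CARD('d) * ?e P Q
      \<le> c ^ CARD('d) * ((\<Sum>m\<in>P - B. \<Sum>n\<in>Q. norm (U m) * norm (U n) * ?k m n) + (\<Sum>m\<in>B. \<Sum>n\<in>Q - B. norm (U m) * norm (U n) * ?k m n))"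
      using c by (intro mult_left_mono) auto
    \<comment> \<open>The Schur parameter is 1 / \<open>\<tau>\<close> where the tail is in the rows
      and \<open>\<tau>\<close> where it is in the columns. Each choice yields \<open>\<tau>\<close>
      times 1 plus the full sum.\<close>
    also have "\<dots> \<le> T * (c + pi) ^ CARD('d) / 2 * (1 / \<tau> * \<tau>\<^sup>2 + ?s / (1 / \<tau>))
        + T * (c + pi) ^ CARD('d) / 2 * (\<tau> * ?s + \<tau>\<^sup>2 / \<tau>)"
      unfolding distrib_left[of "c ^ CARD('d)"]
      by (intro add_mono schur_kernel k T(1) tail discrete_L2_sum_le U c)
        (use PQ B \<tau> in \<open>auto intro: finite_subset\<close>)
    also have "\<dots> = ?X" using \<tau> by (simp add: power2_eq_square field_simps)
    finally show ?thesis .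
  qed
  \<comment> \<open>The columns go to the limit first, with the rows fixed; the rows follow
    below.\<close>
  have fin2: "c ^ CARD('d) * norm ((\<Sum>m\<in>P. ?f m) - truncated_form B U h c a) \<le> ?X"
    if P: "finite P" "B \<subseteq> P" for P
  proof (rule tendsto_upperbound)
    show "((\<lambda>Q. c ^ CARD('d) * ?e P Q)
      \<longlongrightarrow> c ^ CARD('d) * norm ((\<Sum>m\<in>P. ?f m) - truncated_form B U h c a)) (finite_subsets_at_top UNIV)"
      by (intro tendsto_mult_left tendsto_norm tendsto_diff tendsto_const tendsto_double_sum U a c)
    show "\<forall>\<^sub>F Q in finite_subsets_at_top UNIV. c ^ CARD('d) * ?e P Q \<le> ?X"
      unfolding eventually_finite_subsets_at_top using fin P B by (intro exI[of _ B]) auto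
  qed simp
  show ?thesis
  proof (rule tendsto_upperbound)
    have "?f summable_on UNIV" by (rule abs_summable_summable[OF symbol_coeff_summable[OF U a c T]])
    then have "((\<lambda>P. \<Sum>m\<in>P. ?f m) \<longlongrightarrow> infsum ?f UNIV) (finite_subsets_at_top UNIV)"
      by (simp add: has_sum_def[symmetric])
    then show "((\<lambda>P. c ^ CARD('d) * norm ((\<Sum>m\<in>P. ?f m) - truncated_form B U h c a))
      \<longlongrightarrow> c ^ CARD('d) * norm (infsum ?f UNIV - truncated_form B U h c a)) (finite_subsets_at_top UNIV)"
      by (intro tendsto_mult_left tendsto_norm tendsto_diff tendsto_const)
    show "\<forall>\<^sub>F P in finite_subsets_at_top UNIV. c ^ CARD('d) * norm ((\<Sum>m\<in>P. ?f m) - truncated_form B U h c a) \<le> ?X"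
      unfolding eventually_finite_subsets_at_top using fin2 B by (intro exI[of _ B]) auto
  qed simp
qed

section \<open>Size and linearity of the distributions\<close>

text \<open>The prefactor is split so that h^d joins the squared norm of U and (h /
  \<open>\<epsilon>\<close>)^d normalises the lattice sums in Schur's test.\<close>

lemma M_distr_eq_symbol_coeff:
  fixes a :: "(real ^ 'd::finite) \<times> (real ^ 'd) \<Rightarrow> complex"
  assumes "0 < \<epsilon>"
  shows "M_distr h \<epsilon> U a = of_real (h ^ CARD('d) / (2 * pi) ^ CARD('d)) *
    (of_real ((h / \<epsilon>) ^ CARD('d)) * (\<Sum>\<^sub>\<infinity>m. cnj (U m) * symbol_coeff U (h / \<epsilon>) a (h *\<^sub>R lattice_vec m) m))"
proof -
  have "h ^ (2 * CARD('d)) / (2 * pi * \<epsilon>) ^ CARD('d) = h ^ CARD('d) / (2 * pi) ^ CARD('d) * (h / \<epsilon>) ^ CARD('d)"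
    by (simp only: mult_2 power_add power_mult_distrib power_divide times_divide_times_eq)
  then show ?thesis unfolding M_distr_def symbol_coeff_def by (simp only: of_real_mult mult.assoc)
qed

lemma discrete_norm_sq:
  fixes U :: "int ^ 'd::finite \<Rightarrow> complex"
  assumes "0 \<le> h"
  shows "(discrete_norm h U)\<^sup>2 = h ^ CARD('d) * (\<Sum>\<^sub>\<infinity>n. (norm (U n))\<^sup>2)"
  unfolding discrete_norm_def using assms by (simp add: infsum_nonneg)

lemma discrete_norm_nonneg: "0 \<le> h \<Longrightarrow> 0 \<le> discrete_norm h U"
  unfolding discrete_norm_def by (simp add: infsum_nonneg)

lemma M_distr_bound:
  fixes a :: "(real ^ 'd::finite) \<times> (real ^ 'd) \<Rightarrow> complex"
  assumes h: "0 < h" and \<epsilon>: "0 < \<epsilon>" and U: "U \<in> discrete_L2" and a: "a \<in> schwartz"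
    and T: "0 \<le> T" "\<And>x p. norm (freq_ft a x p) \<le> T * lorentz p"
  shows "norm (M_distr h \<epsilon> U a) \<le> (discrete_norm h U)\<^sup>2 / (2 * pi) ^ CARD('d) * (T * (h / \<epsilon> + pi) ^ CARD('d))"
proof -
  have c: "0 < h / \<epsilon>" using h \<epsilon> by simp
  have "norm (M_distr h \<epsilon> U a) = h ^ CARD('d) / (2 * pi) ^ CARD('d) *
     ((h / \<epsilon>) ^ CARD('d) * norm (\<Sum>\<^sub>\<infinity>m. cnj (U m) * symbol_coeff U (h / \<epsilon>) a (h *\<^sub>R lattice_vec m) m))"
    unfolding M_distr_eq_symbol_coeff[OF \<epsilon>] using h \<epsilon> by (simp add: norm_mult norm_power norm_divide)
  also have "\<dots> \<le> h ^ CARD('d) / (2 * pi) ^ CARD('d) * (T * (h / \<epsilon> + pi) ^ CARD('d) * (\<Sum>\<^sub>\<infinity>m. (norm (U m))\<^sup>2))"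
    using h by (intro mult_left_mono symbol_coeff_infsum_bound U a c T) auto
  finally show ?thesis using h by (simp add: discrete_norm_sq mult_ac)
qed

text \<open>Divergent integrals and sums default to 0, so additivity rests on integrability in the
  frequency and summability over the lattice.\<close>

lemma M_distr_add:
  fixes f g :: "(real ^ 'd::finite) \<times> (real ^ 'd) \<Rightarrow> complex"
  assumes h: "0 < h" and \<epsilon>: "0 < \<epsilon>" and U: "U \<in> discrete_L2" and f: "f \<in> schwartz" and g: "g \<in> schwartz"
  shows "M_distr h \<epsilon> U (\<lambda>x. f x + g x) = M_distr h \<epsilon> U f + M_distr h \<epsilon> U g"
proof -
  have c: "0 < h / \<epsilon>" using h \<epsilon> by simp
  have co: "symbol_coeff U (h / \<epsilon>) (\<lambda>x. f x + g x) x m = symbol_coeff U (h / \<epsilon>) f x m + symbol_coeff U (h / \<epsilon>) g x m" for x m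
    unfolding symbol_coeff_def distrib_left
    by (rule Bochner_Integration.integral_add[OF symbol_coeff_integrable[OF U f c] symbol_coeff_integrable[OF U g c]])
  have sm: "(\<lambda>m. cnj (U m) * symbol_coeff U (h / \<epsilon>) a (h *\<^sub>R lattice_vec m) m) summable_on UNIV" if a: "a \<in> schwartz" for a
  proof -
    obtain D where D: "0 \<le> D" "\<And>x p. (1 + norm p) * norm (freq_ft a x p) \<le> D * schwartz_seminorm (2 * CARD('d) + 2) a * lorentz p"
      using freq_ft_decay[where 'd='d] a by blast
    have "norm (freq_ft a x p) \<le> D * schwartz_seminorm (2 * CARD('d) + 2) a * lorentz p" for x p
      using D(2)[of p x] by (rule order_trans[rotated]) (simp add: distrib_right)
    then show ?thesis
      using D(1) schwartz_seminorm_nonneg[OF a]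
      by (intro abs_summable_summable[OF symbol_coeff_summable[OF U a c, where T="D * schwartz_seminorm (2 * CARD('d) + 2) a"]]) auto
  qed
  show ?thesis unfolding M_distr_eq_symbol_coeff[OF \<epsilon>] co distrib_left
    by (subst infsum_add[OF sm[OF f] sm[OF g]]) (simp add: distrib_left)
qed

lemma M_distr_cmult:
  "M_distr h \<epsilon> U (\<lambda>x. k * f x) = k * M_distr h \<epsilon> U f"
proof -
  have "(\<integral>\<xi>. F \<xi> * G \<xi> * (k * f (x, \<xi>)) \<partial>lborel) = k * (\<integral>\<xi>. F \<xi> * G \<xi> * f (x, \<xi>) \<partial>lborel)" for F G x
    by (simp add: mult.left_commute)
  then show ?thesis unfolding M_distr_def
    by (simp add: mult.left_commute[of _ k] infsum_cmult_right')
qed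

section \<open>Positive approximation by window functions\<close>

text \<open>A compactly supported window with Lipschitz constant 1 / \<open>\<delta>\<close>. It is
  left unnormalised; the integral of its square is divided out in \<open>husimi\<close>.\<close>

definition tent :: "real \<Rightarrow> 'a::real_normed_vector \<Rightarrow> real" where
  "tent \<delta> x = max 0 (1 - norm x / \<delta>)"

lemma tent_nonneg [simp]: "0 \<le> tent \<delta> x"
  by (simp add: tent_def)

lemma tent_le_1: "0 < \<delta> \<Longrightarrow> tent \<delta> x \<le> 1"
  by (simp add: tent_def)

lemma tent_sq_le: "0 < \<delta> \<Longrightarrow> (tent \<delta> x)\<^sup>2 \<le> tent \<delta> x"
  unfolding power2_eq_square using tent_le_1[of \<delta> x] by (intro mult_left_le) auto

lemma tent_eq_0: "0 < \<delta> \<Longrightarrow> \<delta> \<le> norm x \<Longrightarrow> tent \<delta> x = 0"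
  by (simp add: tent_def)

lemma tent_lipschitz:
  assumes "0 < \<delta>" shows "\<bar>tent \<delta> x - tent \<delta> y\<bar> \<le> norm (x - y) / \<delta>"
proof -
  have "\<bar>tent \<delta> x - tent \<delta> y\<bar> \<le> \<bar>norm x / \<delta> - norm y / \<delta>\<bar>"
    unfolding tent_def by linarith
  also have "\<dots> = \<bar>norm x - norm y\<bar> / \<delta>" using assms by (simp add: diff_divide_distrib[symmetric] abs_divide)
  also have "\<dots> \<le> norm (x - y) / \<delta>" using assms norm_triangle_ineq3 by (intro divide_right_mono) auto
  finally show ?thesis .
qed

lemma continuous_on_tent: "continuous_on S (tent \<delta>)"
  unfolding tent_def divide_inverse by (intro continuous_intros)

lemma borel_measurable_tent [measurable]: "tent \<delta> \<in> borel_measurable borel"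
  by (rule borel_measurable_continuous_onI[OF continuous_on_tent])

lemma integrable_tent:
  assumes "0 < \<delta>" shows "integrable lborel (tent \<delta> :: 'a::euclidean_space \<Rightarrow> real)"
proof -
  have "integrable lborel (\<lambda>x :: 'a. indicator (cball 0 \<delta>) x *\<^sub>R tent \<delta> x)"
    by (rule borel_integrable_compact) (auto intro: continuous_on_tent)
  moreover have "(\<lambda>x :: 'a. indicator (cball 0 \<delta>) x *\<^sub>R tent \<delta> x) = tent \<delta>"
    using assms by (auto simp: fun_eq_iff indicator_def tent_eq_0)
  ultimately show ?thesis by simp
qed

lemma integrable_tent_translate:
  fixes v :: "'a::euclidean_space"
  assumes "0 < \<delta>" shows "integrable lborel (\<lambda>y. tent \<delta> (y - v))"
proof -
  have "(\<integral>\<^sup>+y. ennreal (tent \<delta> (y - v)) \<partial>lborel) = (\<integral>\<^sup>+y. ennreal (tent \<delta> (y :: 'a)) \<partial>lborel)"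
    using nn_integral_lborel_translate[of "\<lambda>y. ennreal (tent \<delta> y)" "- v"] by simp
  also have "\<dots> < \<infinity>" using nn_integral_eq_integral[OF integrable_tent[where 'a='a, OF assms]] by simp
  finally show ?thesis by (intro integrableI_nonneg) auto
qed

lemma integrable_tent_sq:
  assumes "0 < \<delta>" shows "integrable lborel (\<lambda>x :: 'a::euclidean_space. (tent \<delta> x)\<^sup>2)"
  by (rule Bochner_Integration.integrable_bound[OF integrable_tent[OF assms]])
    (auto intro!: AE_I2 tent_sq_le assms)

lemma lborel_integral_scaleR:
  fixes f :: "'a::euclidean_space \<Rightarrow> real"
  assumes [measurable]: "f \<in> borel_measurable borel" and c: "0 < c"
  shows "(\<integral>x. f x \<partial>lborel) = c ^ DIM('a) * (\<integral>x. f (c *\<^sub>R x) \<partial>lborel)"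
proof -
  have "(\<integral>x. f x \<partial>lborel) = (\<integral>x. f x \<partial>density (distr lborel borel (\<lambda>x :: 'a. 0 + c *\<^sub>R x)) (\<lambda>_. ennreal (\<bar>c\<bar> ^ DIM('a))))"
    using c by (subst lborel_affine[of c 0]) (auto simp: ennreal_power)
  also have "\<dots> = c ^ DIM('a) * (\<integral>x. f (c *\<^sub>R x) \<partial>lborel)"
    using c by (subst integral_density) (auto simp: integral_distr)
  finally show ?thesis .
qed

text \<open>Both integrals scale like \<open>\<delta>\<close>^d, so their quotient depends on the
  space alone. It enters the error because the offset of two windows is weighed by the tent itself,
  whereas the normalisation uses its square.\<close>

definition tent_ratio :: "'a::euclidean_space itself \<Rightarrow> real" where
  "tent_ratio _ = (\<integral>x. tent 1 (x :: 'a) \<partial>lborel) / (\<integral>x. (tent 1 (x :: 'a))\<^sup>2 \<partial>lborel)"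

lemma tent_scale: "0 < \<delta> \<Longrightarrow> tent \<delta> (\<delta> *\<^sub>R x) = tent 1 x"
  by (simp add: tent_def)

lemma integral_tent_sq_pos:
  assumes "0 < \<delta>" shows "0 < (\<integral>x. (tent \<delta> (x :: 'a::euclidean_space))\<^sup>2 \<partial>lborel)"
proof -
  \<comment> \<open>On the ball of half the radius the tent is at least 1/2, hence its square at
    least 1/4.\<close>
  have "0 < 1 / 4 * measure lborel (ball (0 :: 'a) (\<delta> / 2))"
    using assms content_ball_pos[of "\<delta> / 2" "0 :: 'a"] by simp
  also have "\<dots> = (\<integral>x. 1 / 4 * indicator (ball (0 :: 'a) (\<delta> / 2)) x \<partial>lborel)" by simp
  also have "\<dots> \<le> (\<integral>x. (tent \<delta> (x :: 'a))\<^sup>2 \<partial>lborel)"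
  proof (rule integral_mono)
    show "integrable lborel (\<lambda>x :: 'a. 1 / 4 * indicator (ball 0 (\<delta> / 2)) x :: real)"
      using emeasure_bounded_finite[OF bounded_ball, of "0 :: 'a" "\<delta> / 2"] by (intro integrable_mult_right integrable_real_indicator) auto
    fix x :: 'a
    show "1 / 4 * indicator (ball 0 (\<delta> / 2)) x \<le> (tent \<delta> x)\<^sup>2"
    proof (cases "x \<in> ball 0 (\<delta> / 2)")
      case True
      then have "1 / 2 \<le> tent \<delta> x" using assms by (simp add: tent_def field_simps)
      then have "(1 / 2)\<^sup>2 \<le> (tent \<delta> x)\<^sup>2" by (intro power_mono) auto
      then show ?thesis using True by (simp add: power2_eq_square)
    qed simp
  qed (rule integrable_tent_sq[OF assms])
  finally show ?thesis .
qed

lemma integral_tent_eq: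
  assumes "0 < \<delta>"
  shows "(\<integral>x. tent \<delta> (x :: 'a::euclidean_space) \<partial>lborel) = tent_ratio TYPE('a) * (\<integral>x. (tent \<delta> (x :: 'a))\<^sup>2 \<partial>lborel)"
proof -
  have "(\<integral>x. tent \<delta> (x :: 'a) \<partial>lborel) = \<delta> ^ DIM('a) * (\<integral>x. tent 1 (x :: 'a) \<partial>lborel)"
    using assms by (subst lborel_integral_scaleR[of _ \<delta>]) (auto simp: tent_scale)
  moreover have "(\<integral>x. (tent \<delta> (x :: 'a))\<^sup>2 \<partial>lborel) = \<delta> ^ DIM('a) * (\<integral>x. (tent 1 (x :: 'a))\<^sup>2 \<partial>lborel)"
    using assms by (subst lborel_integral_scaleR[of _ \<delta>]) (auto simp: tent_scale)
  ultimately show ?thesis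
    using integral_tent_sq_pos[of 1, where 'a='a] by (simp add: tent_ratio_def)
qed

lemma tent_ratio_nonneg: "0 \<le> tent_ratio TYPE('a::euclidean_space)"
  unfolding tent_ratio_def by simp

section \<open>The positive densities and their mass\<close>

text \<open>A spectrogram: the squared modulus of the windowed Fourier sum of U around the position
  \<open>fst z\<close>. The constant is the prefactor of the kernel form divided by the squared
  mean-square norm of the window.\<close>

definition husimi ::
  "(int ^ 'd::finite) set \<Rightarrow> (int ^ 'd \<Rightarrow> complex) \<Rightarrow> real \<Rightarrow> real \<Rightarrow> real \<Rightarrow> (real ^ 'd) \<times> (real ^ 'd) \<Rightarrow> real" where
  "husimi B U h c \<delta> z =
     h ^ CARD('d) * c ^ CARD('d) / ((2 * pi) ^ CARD('d) * (\<integral>x. (tent \<delta> (x :: real ^ 'd))\<^sup>2 \<partial>lborel)) *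
     (norm (trig_sum (\<lambda>m. U m * of_real (tent \<delta> (fst z - h *\<^sub>R lattice_vec m))) B (c *\<^sub>R snd z)))\<^sup>2"

lemma husimi_nonneg: "0 < h \<Longrightarrow> 0 < c \<Longrightarrow> 0 \<le> husimi B U h c \<delta> z"
  unfolding husimi_def by (intro mult_nonneg_nonneg divide_nonneg_nonneg) auto

lemma borel_measurable_husimi [measurable]: "husimi B U h c \<delta> \<in> borel_measurable borel"
proof (rule borel_measurable_continuous_onI)
  have "continuous_on UNIV (\<lambda>z. tent \<delta> (fst z - h *\<^sub>R lattice_vec m))" for m
    by (rule continuous_on_compose2[OF continuous_on_tent[of UNIV]]) (auto intro!: continuous_intros)
  then show "continuous_on UNIV (husimi B U h c \<delta>)"
    unfolding husimi_def trig_sum_def by (intro continuous_intros)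
qed

lemma borel_measurable_lorentz_snd [measurable]:
  "(\<lambda>z :: (real ^ 'd::finite) \<times> (real ^ 'd). lorentz (snd z)) \<in> borel_measurable borel"
  by (rule borel_measurable_continuous_onI[OF continuous_on_lorentz_snd])

lemma borel_measurable_tent_fst [measurable]:
  "(\<lambda>z :: (real ^ 'd::finite) \<times> (real ^ 'd). tent \<delta> (fst z - v)) \<in> borel_measurable borel"
  by (rule borel_measurable_continuous_onI, rule continuous_on_compose2[OF continuous_on_tent[of UNIV]])
    (auto intro!: continuous_intros)

lemma nn_integral_tent_sq_translate:
  fixes v :: "'a::euclidean_space"
  assumes "0 < \<delta>"
  shows "(\<integral>\<^sup>+y. ennreal ((tent \<delta> (y - v))\<^sup>2) \<partial>lborel) = ennreal (\<integral>x. (tent \<delta> (x :: 'a))\<^sup>2 \<partial>lborel)"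
proof -
  have "(\<integral>\<^sup>+y. ennreal ((tent \<delta> (y - v))\<^sup>2) \<partial>lborel) = (\<integral>\<^sup>+y. ennreal ((tent \<delta> (y :: 'a))\<^sup>2) \<partial>lborel)"
    using nn_integral_lborel_translate[of "\<lambda>y. ennreal ((tent \<delta> y)\<^sup>2)" "- v"] by simp
  then show ?thesis using nn_integral_eq_integral[OF integrable_tent_sq[OF assms]] by simp
qed

text \<open>For fixed position the density is periodic in the rescaled frequency. The weighted
  periodic bound and Parseval reduce its integral to a sum over the lattice, whose windows then
  integrate to \<open>\<theta>\<close> each. The factors c^d, (2 pi)^d and \<open>\<theta>\<close>
  of the prefactor all cancel, so the bound is uniform.\<close>

lemma husimi_mass:
  fixes U :: "int ^ 'd::finite \<Rightarrow> complex"
  assumes h: "0 < h" and c: "0 < c" "c \<le> c0" and \<delta>: "0 < \<delta>" and B: "finite B"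
  shows "(\<integral>\<^sup>+z. ennreal (lorentz (snd z) * husimi B U h c \<delta> z) \<partial>lborel)
    \<le> ennreal ((1 + c0) ^ CARD('d) * (h ^ CARD('d) * (\<Sum>m\<in>B. (norm (U m))\<^sup>2)))"
proof -
  define \<theta> where "\<theta> = (\<integral>x. (tent \<delta> (x :: real ^ 'd))\<^sup>2 \<partial>lborel)"
  have \<theta>: "0 < \<theta>" unfolding \<theta>_def by (rule integral_tent_sq_pos[OF \<delta>])
  define C where "C = h ^ CARD('d) * c ^ CARD('d) / ((2 * pi) ^ CARD('d) * \<theta>)"
  have C: "0 \<le> C" unfolding C_def using h c \<theta> by simp
  let ?W = "\<lambda>y m. U m * of_real (tent \<delta> (y - h *\<^sub>R lattice_vec m))"
  let ?K = "h ^ CARD('d) * (1 + c0) ^ CARD('d)"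
  let ?q = "\<lambda>y \<xi>. ennreal ((norm (trig_sum (?W y) B (c *\<^sub>R \<xi>)))\<^sup>2) * ennreal (lorentz \<xi>)"
  let ?b = "\<lambda>m y. ennreal (?K / \<theta> * (norm (U m))\<^sup>2) * ennreal ((tent \<delta> (y - h *\<^sub>R lattice_vec m))\<^sup>2)"
  have inner: "(\<integral>\<^sup>+\<xi>. ennreal (lorentz \<xi> * husimi B U h c \<delta> (y, \<xi>)) \<partial>lborel)
     \<le> (\<Sum>m\<in>B. ?b m y)" for y
  proof -
    have "(\<integral>\<^sup>+\<xi>. ennreal (lorentz \<xi> * husimi B U h c \<delta> (y, \<xi>)) \<partial>lborel)
      = (\<integral>\<^sup>+\<xi>. ennreal C * (?q y \<xi>) \<partial>lborel)"
    proof (rule nn_integral_cong)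
      fix \<xi> :: "real ^ 'd"
      have "ennreal (b * (C * q)) = ennreal C * (ennreal q * ennreal b)" if "0 \<le> b" "0 \<le> q" for b q
        using that C by (simp add: ennreal_mult mult_ac)
      then show "ennreal (lorentz \<xi> * husimi B U h c \<delta> (y, \<xi>))
        = ennreal C * (?q y \<xi>)"
        unfolding husimi_def C_def[symmetric] \<theta>_def[symmetric] by simp
    qed
    also have "\<dots> = ennreal C * (\<integral>\<^sup>+\<xi>. ?q y \<xi> \<partial>lborel)"
      by (rule nn_integral_cmult) measurable
    also have "\<dots> \<le> ennreal C * (ennreal ((1 + c0) ^ CARD('d) / c ^ CARD('d)) *
        (\<integral>\<^sup>+x\<in>torus_cell. ennreal ((norm (trig_sum (?W y) B x))\<^sup>2) \<partial>lborel))"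
      by (intro mult_left_mono nn_integral_periodic_lorentz) (use c in \<open>auto simp: trig_sum_periodic\<close>)
    also have "\<dots> = ennreal C * (ennreal ((1 + c0) ^ CARD('d) / c ^ CARD('d)) *
        ennreal ((2 * pi) ^ CARD('d) * (\<Sum>m\<in>B. (norm (?W y m))\<^sup>2)))"
      by (simp only: parseval_trig_sum[OF B])
    also have "\<dots> = ennreal (C * ((1 + c0) ^ CARD('d) / c ^ CARD('d) * ((2 * pi) ^ CARD('d) * (\<Sum>m\<in>B. (norm (?W y m))\<^sup>2))))"
    proof -
      have eq: "ennreal b * (ennreal q * ennreal r) = ennreal (b * (q * r))" if "0 \<le> b" "0 \<le> q" "0 \<le> r" for b q r
        using that by (simp add: ennreal_mult)
      show ?thesis by (rule eq) (use C c in \<open>auto intro!: mult_nonneg_nonneg sum_nonneg\<close>)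
    qed
    also have "C * ((1 + c0) ^ CARD('d) / c ^ CARD('d) * ((2 * pi) ^ CARD('d) * s)) = ?K / \<theta> * s" for s
      unfolding C_def using c \<theta> by simp
    also have "ennreal (?K / \<theta> * (\<Sum>m\<in>B. (norm (?W y m))\<^sup>2))
      = (\<Sum>m\<in>B. ?b m y)"
    proof -
      have "?b m y
        = ennreal (?K / \<theta> * (norm (?W y m))\<^sup>2)" for m
        using h c \<theta> by (subst ennreal_mult[symmetric]) (auto simp: norm_mult power_mult_distrib mult_ac)
      then show ?thesis using h c \<theta> by (simp add: sum_ennreal sum_distrib_left)
    qed
    finally show ?thesis .
  qed
  have "(\<integral>\<^sup>+z. ennreal (lorentz (snd z) * husimi B U h c \<delta> z) \<partial>lborel)
    = (\<integral>\<^sup>+y. \<integral>\<^sup>+\<xi>. ennreal (lorentz \<xi> * husimi B U h c \<delta> (y, \<xi>)) \<partial>lborel \<partial>lborel)"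
    using lborel.nn_integral_fst[of "\<lambda>z. ennreal (lorentz (snd z) * husimi B U h c \<delta> z)" lborel]
      borel_measurable_lorentz_snd by (simp add: lborel_prod)
  also have "\<dots> \<le> (\<integral>\<^sup>+y. (\<Sum>m\<in>B. ?b m y) \<partial>lborel)"
    by (intro nn_integral_mono inner)
  also have "\<dots> = (\<Sum>m\<in>B. ennreal (?K / \<theta> * (norm (U m))\<^sup>2) * ennreal \<theta>)"
    by (subst nn_integral_sum) (auto simp: nn_integral_cmult nn_integral_tent_sq_translate[OF \<delta>] \<theta>_def)
  also have "\<dots> = (\<Sum>m\<in>B. ennreal (?K * (norm (U m))\<^sup>2))"
    using \<theta> h c by (intro sum.cong refl) (simp add: ennreal_mult[symmetric])
  also have "\<dots> = ennreal ((1 + c0) ^ CARD('d) * (h ^ CARD('d) * (\<Sum>m\<in>B. (norm (U m))\<^sup>2)))"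
    using h c by (subst sum_ennreal) (auto simp: sum_distrib_left mult_ac)
  finally show ?thesis .
qed

lemma continuous_on_freq_ft:
  assumes "a \<in> schwartz" shows "continuous_on UNIV (\<lambda>y. freq_ft a y p)"
proof -
  obtain D where D: "0 \<le> D" "\<And>x y p. norm (freq_ft a x p - freq_ft a y p) \<le> D * norm (x - y) * lorentz p"
    using freq_ft_lipschitz[OF assms] by blast
  have "(D * lorentz p)-lipschitz_on UNIV (\<lambda>y. freq_ft a y p)"
    by (rule lipschitz_onI) (use D in \<open>auto simp: dist_norm mult_ac\<close>)
  then show ?thesis by (rule lipschitz_on_continuous_on)
qed

section \<open>Comparison of the densities with the kernel form\<close>

text \<open>The tent dominates in position and the Lorentz weight in frequency, which justifies
  Fubini.\<close>

lemma
  fixes a :: "(real ^ 'd::finite) \<times> (real ^ 'd) \<Rightarrow> complex"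
  assumes a: "a \<in> schwartz" and [measurable]: "w \<in> borel_measurable borel"
    and w: "\<And>y. \<bar>w y\<bar> \<le> tent \<delta> (y - v)" and \<delta>: "0 < \<delta>"
  shows integrable_windowed: "integrable lborel (\<lambda>z. of_real (w (fst z)) * (cis (p \<bullet> snd z) * a z))"
    and integral_windowed: "(\<integral>z. of_real (w (fst z)) * (cis (p \<bullet> snd z) * a z) \<partial>lborel) = (\<integral>y. of_real (w y) * freq_ft a y p \<partial>lborel)"
proof -
  let ?S = "schwartz_seminorm (2 * CARD('d)) a"
  let ?f = "\<lambda>z. of_real (w (fst z)) * (cis (p \<bullet> snd z) * a z)"
  have [measurable]: "a \<in> borel_measurable borel"
    using schwartz_continuous[OF a, of "[]"] by (auto intro: borel_measurable_continuous_onI)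
  have mc: "(\<lambda>z :: (real ^ 'd) \<times> (real ^ 'd). cis (p \<bullet> snd z)) \<in> borel_measurable borel"
    by (intro borel_measurable_continuous_onI continuous_intros)
  have mf: "?f \<in> borel_measurable borel"
  proof -
    have "(fst :: (real ^ 'd) \<times> (real ^ 'd) \<Rightarrow> real ^ 'd) \<in> borel \<rightarrow>\<^sub>M borel"
      by (intro borel_measurable_continuous_onI continuous_intros)
    then have "(\<lambda>z :: (real ^ 'd) \<times> (real ^ 'd). w (fst z)) \<in> borel_measurable borel"
      by (rule measurable_compose) simp
    then show ?thesis using mc by (intro borel_measurable_times borel_measurable_of_real) auto
  qed
  have b: "norm (?f (y, \<xi>)) \<le> tent \<delta> (y - v) * (?S * lorentz \<xi>)" for y \<xi>
    using schwartz_lorentz_bound[OF a, of "[]" "2 * CARD('d)" 0 y \<xi>] w[of y]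
    by (auto simp: norm_mult intro!: mult_mono)
  have tv: "integrable lborel (\<lambda>y. tent \<delta> (y - v))" by (rule integrable_tent_translate[OF \<delta>])
  have fi: "integrable (lborel \<Otimes>\<^sub>M lborel) ?f"
  proof (rule Bochner_Integration.integrable_bound)
    show "integrable (lborel \<Otimes>\<^sub>M lborel) (\<lambda>z :: (real ^ 'd) \<times> (real ^ 'd). tent \<delta> (fst z - v) * (?S * lorentz (snd z)))"
    proof (rule lborel_pair.Fubini_integrable)
      show "integrable lborel (\<lambda>y. \<integral>\<xi>. norm (tent \<delta> (fst (y, \<xi>) - v) * (?S * lorentz (snd (y, \<xi> :: real ^ 'd)))) \<partial>lborel)"
        using tv schwartz_seminorm_nonneg[OF a] by (simp add: abs_mult)
      show "AE y in lborel. integrable lborel (\<lambda>\<xi>. tent \<delta> (fst (y, \<xi>) - v) * (?S * lorentz (snd (y, \<xi> :: real ^ 'd))))"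
        by (intro AE_I2, unfold fst_conv snd_conv) (intro integrable_mult_right integrable_lorentz)
    qed (simp add: lborel_prod)
    show "AE z in lborel \<Otimes>\<^sub>M lborel. norm (?f z) \<le> norm (tent \<delta> (fst z - v) * (?S * lorentz (snd z)))"
    proof (rule AE_I2)
      fix z :: "(real ^ 'd) \<times> (real ^ 'd)"
      obtain y \<xi> where "z = (y, \<xi>)" by fastforce
      then show "norm (?f z) \<le> norm (tent \<delta> (fst z - v) * (?S * lorentz (snd z)))"
        using b[of y \<xi>] by (simp only: fst_conv snd_conv real_norm_def abs_ge_self[THEN order_trans[rotated]])
    qed
  qed (use mf in \<open>simp add: lborel_prod\<close>)
  then show "integrable lborel ?f" by (simp only: lborel_prod)
  have "(\<integral>z. ?f z \<partial>lborel) = (\<integral>y. \<integral>\<xi>. ?f (y, \<xi>) \<partial>lborel \<partial>lborel)"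
    using lborel_pair.integral_fst'[OF fi] by (simp only: lborel_prod)
  then show "(\<integral>z. ?f z \<partial>lborel) = (\<integral>y. of_real (w y) * freq_ft a y p \<partial>lborel)"
    by (simp add: freq_ft_def)
qed

text \<open>In the expanded square the pair (m, n) carries the phase of frequency c (m - n);
  integrating the frequency variable turns it into the kernel at that point.\<close>

lemma
  fixes a :: "(real ^ 'd::finite) \<times> (real ^ 'd) \<Rightarrow> complex"
  assumes a: "a \<in> schwartz" and \<delta>: "0 < \<delta>"
  defines "\<theta> \<equiv> \<integral>x. (tent \<delta> (x :: real ^ 'd))\<^sup>2 \<partial>lborel"
  shows integral_husimi: "(\<integral>z. a z * of_real (husimi B U h c \<delta> z) \<partial>lborel)
    = of_real (h ^ CARD('d) * c ^ CARD('d) / (2 * pi) ^ CARD('d)) *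
      (\<Sum>m\<in>B. \<Sum>n\<in>B. cnj (U m) * U n * (of_real (1 / \<theta>) *
        (\<integral>y. of_real (tent \<delta> (y - h *\<^sub>R lattice_vec m) * tent \<delta> (y - h *\<^sub>R lattice_vec n)) *
          freq_ft a y (c *\<^sub>R lattice_vec (m - n)) \<partial>lborel)))"
proof -
  let ?C = "h ^ CARD('d) * c ^ CARD('d) / ((2 * pi) ^ CARD('d) * \<theta>)"
  let ?t = "\<lambda>m y. tent \<delta> (y - h *\<^sub>R lattice_vec m)"
  let ?g = "\<lambda>m n z. of_real (?t m (fst z) * ?t n (fst z)) * (cis ((c *\<^sub>R lattice_vec (m - n)) \<bullet> snd z) * a z)"
  have w: "\<bar>?t m y * ?t n y\<bar> \<le> ?t m y" for m n y
    using tent_le_1[OF \<delta>, of "y - h *\<^sub>R lattice_vec n"] by (simp add: abs_mult mult_left_le)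
  have gi: "integrable lborel (?g m n)" for m n
    by (rule integrable_windowed[OF a _ w \<delta>]) measurable
  have gI: "(\<integral>z. ?g m n z \<partial>lborel) = (\<integral>y. of_real (?t m y * ?t n y) * freq_ft a y (c *\<^sub>R lattice_vec (m - n)) \<partial>lborel)" for m n
    by (rule integral_windowed[OF a _ w \<delta>]) measurable
  have pt: "a z * of_real (husimi B U h c \<delta> z) = (\<Sum>m\<in>B. \<Sum>n\<in>B. (of_real ?C * (cnj (U m) * U n)) * ?g m n z)" for z
  proof -
    let ?T = "trig_sum (\<lambda>m. U m * of_real (?t m (fst z))) B (c *\<^sub>R snd z)"
    have "of_real ((norm ?T)\<^sup>2) = ?T * cnj ?T" by (rule complex_norm_square)
    also have "\<dots> = cnj ?T * ?T" by (rule mult.commute)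
    also have "\<dots> = (\<Sum>m\<in>B. \<Sum>n\<in>B. (cnj (U m) * U n) * (of_real (?t m (fst z) * ?t n (fst z)) *
        (cis (lattice_vec m \<bullet> (c *\<^sub>R snd z)) * cis (- (lattice_vec n \<bullet> (c *\<^sub>R snd z))))))"
      unfolding trig_sum_def cnj_sum sum_product by (simp add: cis_cnj mult_ac)
    also have "\<dots> = (\<Sum>m\<in>B. \<Sum>n\<in>B. (cnj (U m) * U n) * (of_real (?t m (fst z) * ?t n (fst z)) *
        cis ((c *\<^sub>R lattice_vec (m - n)) \<bullet> snd z)))"
      by (simp add: cis_mult lattice_vec_diff inner_diff_left right_diff_distrib)
    finally have T: "of_real ((norm ?T)\<^sup>2) = (\<Sum>m\<in>B. \<Sum>n\<in>B. (cnj (U m) * U n) * (of_real (?t m (fst z) * ?t n (fst z)) *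
        cis ((c *\<^sub>R lattice_vec (m - n)) \<bullet> snd z)))" .
    show ?thesis unfolding husimi_def \<theta>_def[symmetric] of_real_mult[of ?C] T sum_distrib_left
      by (intro sum.cong refl) (simp only: mult_ac)
  qed
  have "(\<integral>z. a z * of_real (husimi B U h c \<delta> z) \<partial>lborel)
     = (\<Sum>m\<in>B. \<Sum>n\<in>B. (of_real ?C * (cnj (U m) * U n)) * (\<integral>z. ?g m n z \<partial>lborel))"
    unfolding pt
    by (subst Bochner_Integration.integral_sum, intro Bochner_Integration.integrable_sum integrable_mult_right gi,
        subst Bochner_Integration.integral_sum, intro integrable_mult_right gi, simp only: integral_mult_right_zero)
  also have "?C = h ^ CARD('d) * c ^ CARD('d) / (2 * pi) ^ CARD('d) * (1 / \<theta>)" by simp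
  finally show ?thesis unfolding gI of_real_mult[of "h ^ CARD('d) * c ^ CARD('d) / (2 * pi) ^ CARD('d)"] sum_distrib_left
    by (simp only: mult_ac)
qed

text \<open>Two replacements are made. Moving the second window from v to u costs norm (u - v) /
  \<open>\<delta>\<close>, at most \<open>\<epsilon>\<close> norm p / \<open>\<delta>\<close>, and
  the spare power of decay absorbs norm p. Replacing the position y by u costs at most the Lipschitz
  constant times \<open>\<delta>\<close>, the radius of the window.\<close>

lemma window_error:
  fixes a :: "(real ^ 'd::finite) \<times> (real ^ 'd) \<Rightarrow> complex"
  assumes a: "a \<in> schwartz" and \<delta>: "0 < \<delta>"
    and D1: "0 \<le> D1" "\<And>x p. (1 + norm p) * norm (freq_ft a x p) \<le> D1 * lorentz p"
    and D2: "0 \<le> D2" "\<And>x y p. norm (freq_ft a x p - freq_ft a y p) \<le> D2 * norm (x - y) * lorentz p"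
    and uv: "norm (u - v) \<le> \<epsilon> * norm p" and \<epsilon>: "0 \<le> \<epsilon>"
  defines "\<theta> \<equiv> \<integral>x. (tent \<delta> (x :: real ^ 'd))\<^sup>2 \<partial>lborel"
  shows "norm (of_real (1 / \<theta>) * (\<integral>y. of_real (tent \<delta> (y - u) * tent \<delta> (y - v)) * freq_ft a y p \<partial>lborel) - freq_ft a u p)
    \<le> (D1 * tent_ratio TYPE(real ^ 'd) * (\<epsilon> / \<delta>) + D2 * \<delta>) * lorentz p"
proof -
  have \<theta>: "0 < \<theta>" unfolding \<theta>_def by (rule integral_tent_sq_pos[OF \<delta>])
  let ?s = "\<lambda>y. tent \<delta> (y - u)" and ?t = "\<lambda>y. tent \<delta> (y - v)"
  have [measurable]: "(\<lambda>y. freq_ft a y p) \<in> borel_measurable borel"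
    by (rule borel_measurable_continuous_onI[OF continuous_on_freq_ft[OF a]])
  have tr: "(\<integral>y. f (y - u) \<partial>lborel) = (\<integral>y. f y \<partial>lborel)" if "f \<in> borel_measurable borel" for f :: "real ^ 'd \<Rightarrow> real"
    using lborel_integral_translate[OF that, of "- u"] by simp
  have is1: "integrable lborel ?s"
    by (rule integrable_tent_translate[OF \<delta>])
  have is2: "integrable lborel (\<lambda>y. (?s y)\<^sup>2)"
    by (rule Bochner_Integration.integrable_bound[OF is1]) (auto intro!: AE_I2 tent_sq_le \<delta>)
  have I1: "(\<integral>y. ?s y \<partial>lborel) = tent_ratio TYPE(real ^ 'd) * \<theta>"
    unfolding \<theta>_def integral_tent_eq[OF \<delta>, symmetric] by (rule tr) simp
  have I2: "(\<integral>y. (?s y)\<^sup>2 \<partial>lborel) = \<theta>"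
    unfolding \<theta>_def by (rule tr[of "\<lambda>y. (tent \<delta> y)\<^sup>2"]) simp
  have pb: "norm (freq_ft a y p) \<le> D1 * lorentz p" "norm p * norm (freq_ft a y p) \<le> D1 * lorentz p" for y
  proof -
    have "norm (freq_ft a y p) + norm p * norm (freq_ft a y p) \<le> D1 * lorentz p"
      using D1(2)[of p y] by (simp add: distrib_right)
    moreover have "0 \<le> norm p * norm (freq_ft a y p)" "0 \<le> norm (freq_ft a y p)" by simp_all
    ultimately show "norm (freq_ft a y p) \<le> D1 * lorentz p" "norm p * norm (freq_ft a y p) \<le> D1 * lorentz p"
      by linarith+
  qed
  \<comment> \<open>The subtracted term integrates to \<open>\<theta>\<close> times the kernel at u,
    so the error is exactly the integral of \<open>?F\<close> divided by
    \<open>\<theta>\<close>.\<close>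
  let ?F = "\<lambda>y. of_real (?s y * ?t y) * freq_ft a y p - of_real ((?s y)\<^sup>2) * freq_ft a u p"
  let ?G = "\<lambda>y. (\<epsilon> / \<delta> * (D1 * lorentz p)) * ?s y + (D2 * \<delta> * lorentz p) * (?s y)\<^sup>2"
  have i1: "integrable lborel (\<lambda>y. of_real (?s y * ?t y) * freq_ft a y p)"
  proof (rule Bochner_Integration.integrable_bound[OF integrable_mult_right[OF is1, of "D1 * lorentz p"]])
    show "AE y in lborel. norm (of_real (?s y * ?t y) * freq_ft a y p) \<le> norm (D1 * lorentz p * ?s y)"
    proof (rule AE_I2)
      fix y
      have "norm (of_real (?s y * ?t y) * freq_ft a y p) = ?s y * (?t y * norm (freq_ft a y p))"
        by (simp add: norm_mult)
      also have "\<dots> \<le> ?s y * (1 * (D1 * lorentz p))"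
        using pb(1)[of y] tent_le_1[OF \<delta>, of "y - v"] by (intro mult_mono mult_left_mono) auto
      also have "\<dots> \<le> norm (D1 * lorentz p * ?s y)" by (simp add: mult_ac)
      finally show "norm (of_real (?s y * ?t y) * freq_ft a y p) \<le> norm (D1 * lorentz p * ?s y)" .
    qed
  qed measurable
  have i2: "integrable lborel (\<lambda>y. of_real ((?s y)\<^sup>2) * freq_ft a u p)"
    by (intro integrable_mult_left integrable_of_real is2)
  have pt: "norm (?F y) \<le> ?G y" for y
  proof -
    have "?F y = of_real (?s y * (?t y - ?s y)) * freq_ft a y p + of_real ((?s y)\<^sup>2) * (freq_ft a y p - freq_ft a u p)"
      by (simp add: algebra_simps power2_eq_square)
    then have "norm (?F y) \<le> ?s y * (\<bar>?t y - ?s y\<bar> * norm (freq_ft a y p)) + (?s y)\<^sup>2 * norm (freq_ft a y p - freq_ft a u p)"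
      by (simp only:) (rule order_trans[OF norm_triangle_ineq],
          simp only: norm_mult norm_of_real abs_mult abs_of_nonneg[OF tent_nonneg] abs_of_nonneg[OF zero_le_power2] mult.assoc order_refl)
    also have "?s y * (\<bar>?t y - ?s y\<bar> * norm (freq_ft a y p)) \<le> ?s y * (\<epsilon> / \<delta> * (D1 * lorentz p))"
    proof (rule mult_left_mono)
      have "\<bar>?t y - ?s y\<bar> \<le> norm (u - v) / \<delta>" using tent_lipschitz[OF \<delta>, of "y - v" "y - u"] by simp
      also have "\<dots> \<le> \<epsilon> * norm p / \<delta>" using uv \<delta> by (intro divide_right_mono) auto
      finally have "\<bar>?t y - ?s y\<bar> * norm (freq_ft a y p) \<le> \<epsilon> * norm p / \<delta> * norm (freq_ft a y p)"
        by (rule mult_right_mono) simp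
      also have "\<dots> = \<epsilon> / \<delta> * (norm p * norm (freq_ft a y p))" by simp
      also have "\<dots> \<le> \<epsilon> / \<delta> * (D1 * lorentz p)" using \<epsilon> \<delta> by (intro mult_left_mono pb) auto
      finally show "\<bar>?t y - ?s y\<bar> * norm (freq_ft a y p) \<le> \<epsilon> / \<delta> * (D1 * lorentz p)" .
    qed simp
    also have "(?s y)\<^sup>2 * norm (freq_ft a y p - freq_ft a u p) \<le> (?s y)\<^sup>2 * (D2 * \<delta> * lorentz p)"
    proof (cases "norm (y - u) \<le> \<delta>")
      case True
      have "norm (freq_ft a y p - freq_ft a u p) \<le> D2 * norm (y - u) * lorentz p" by (rule D2)
      also have "\<dots> \<le> D2 * \<delta> * lorentz p" using True D2(1) by (intro mult_right_mono mult_left_mono) auto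
      finally show ?thesis by (intro mult_left_mono) auto
    next
      case False
      then have "?s y = 0" using \<delta> by (intro tent_eq_0) auto
      then show ?thesis by simp
    qed
    finally show ?thesis by (simp add: mult_ac)
  qed
  have "of_real (1 / \<theta>) * (\<integral>y. of_real (?s y * ?t y) * freq_ft a y p \<partial>lborel) - freq_ft a u p
      = of_real (1 / \<theta>) * (\<integral>y. ?F y \<partial>lborel)"
  proof -
    have "(\<integral>y. of_real ((?s y)\<^sup>2) * freq_ft a u p \<partial>lborel) = of_real \<theta> * freq_ft a u p"
      unfolding integral_mult_left_zero integral_complex_of_real I2 ..
    then have "(\<integral>y. ?F y \<partial>lborel) = (\<integral>y. of_real (?s y * ?t y) * freq_ft a y p \<partial>lborel) - of_real \<theta> * freq_ft a u p"
      by (simp only: Bochner_Integration.integral_diff[OF i1 i2])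
    then show ?thesis using \<theta> by (simp add: right_diff_distrib)
  qed
  then have "norm (of_real (1 / \<theta>) * (\<integral>y. of_real (?s y * ?t y) * freq_ft a y p \<partial>lborel) - freq_ft a u p)
      = 1 / \<theta> * norm (\<integral>y. ?F y \<partial>lborel)"
    using \<theta> by (simp add: norm_mult norm_divide)
  also have "\<dots> \<le> 1 / \<theta> * (\<integral>y. ?G y \<partial>lborel)"
    using \<theta> pt i1 i2 is1 is2
    by (intro mult_left_mono Bochner_Integration.integral_norm_bound_integral
        Bochner_Integration.integrable_diff Bochner_Integration.integrable_add integrable_mult_right) auto
  also have "(\<integral>y. ?G y \<partial>lborel) = (\<epsilon> / \<delta> * (D1 * lorentz p)) * (tent_ratio TYPE(real ^ 'd) * \<theta>) + (D2 * \<delta> * lorentz p) * \<theta>"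
    using is1 is2 by (simp add: I1 I2)
  also have "1 / \<theta> * (e * (r * \<theta>) + f * \<theta>) = e * r + f" for e r f
    using \<theta> by (simp add: field_simps)
  finally show ?thesis by (simp add: algebra_simps)
qed

text \<open>The window error bounds the difference of the two kernels by a small multiple of the
  Lorentz weight, and Schur's test converts this into a bound on the forms.\<close>

lemma husimi_error:
  fixes a :: "(real ^ 'd::finite) \<times> (real ^ 'd) \<Rightarrow> complex"
  assumes U: "U \<in> discrete_L2" and a: "a \<in> schwartz" and h: "0 < h" and \<epsilon>: "0 < \<epsilon>" and \<delta>: "0 < \<delta>" and B: "finite B"
    and D1: "0 \<le> D1" "\<And>x p. (1 + norm p) * norm (freq_ft a x p) \<le> D1 * lorentz p"
    and D2: "0 \<le> D2" "\<And>x y p. norm (freq_ft a x p - freq_ft a y p) \<le> D2 * norm (x - y) * lorentz p"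
  shows "norm ((\<integral>z. a z * of_real (husimi B U h (h / \<epsilon>) \<delta> z) \<partial>lborel)
      - of_real (h ^ CARD('d) / (2 * pi) ^ CARD('d)) * (of_real ((h / \<epsilon>) ^ CARD('d)) * truncated_form B U h (h / \<epsilon>) a))
    \<le> (discrete_norm h U)\<^sup>2 / (2 * pi) ^ CARD('d) *
      ((D1 * tent_ratio TYPE(real ^ 'd) * (\<epsilon> / \<delta>) + D2 * \<delta>) * (h / \<epsilon> + pi) ^ CARD('d))"
proof -
  let ?c = "h / \<epsilon>" and ?s = "\<Sum>\<^sub>\<infinity>m. (norm (U m))\<^sup>2"
  have c: "0 < ?c" using h \<epsilon> by simp
  let ?\<theta> = "\<integral>x. (tent \<delta> (x :: real ^ 'd))\<^sup>2 \<partial>lborel"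
  let ?X = "D1 * tent_ratio TYPE(real ^ 'd) * (\<epsilon> / \<delta>) + D2 * \<delta>"
  have X: "0 \<le> ?X" using D1 D2 \<epsilon> \<delta> tent_ratio_nonneg[where 'a="real ^ 'd"] by simp
  let ?A = "\<lambda>m n. of_real (1 / ?\<theta>) * (\<integral>y. of_real (tent \<delta> (y - h *\<^sub>R lattice_vec m) * tent \<delta> (y - h *\<^sub>R lattice_vec n)) *
          freq_ft a y (?c *\<^sub>R lattice_vec (m - n)) \<partial>lborel)"
  let ?P = "\<lambda>m n. freq_ft a (h *\<^sub>R lattice_vec m) (?c *\<^sub>R lattice_vec (m - n))"
  let ?k = "\<lambda>m n. norm (?A m n - ?P m n)"
  have k: "?k m n \<le> ?X * lorentz (?c *\<^sub>R lattice_vec (m - n))" for m n :: "int ^ 'd"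
  proof (rule window_error[OF a \<delta> D1 D2])
    \<comment> \<open>With p = (h / \<open>\<epsilon>\<close>)(m - n), the distance of the window
      centres is exactly \<open>\<epsilon>\<close> times norm p.\<close>
    have "norm (h *\<^sub>R lattice_vec m - h *\<^sub>R lattice_vec n :: real ^ 'd) = h * norm (lattice_vec (m - n) :: real ^ 'd)"
      unfolding lattice_vec_diff scaleR_right_diff_distrib[symmetric] using h by simp
    also have "\<dots> = \<epsilon> * norm (?c *\<^sub>R lattice_vec (m - n) :: real ^ 'd)" using h \<epsilon> by simp
    finally show "norm (h *\<^sub>R lattice_vec m - h *\<^sub>R lattice_vec n :: real ^ 'd) \<le> \<epsilon> * norm (?c *\<^sub>R lattice_vec (m - n) :: real ^ 'd)"
      by simp
  qed (use \<epsilon> in simp)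
  have e: "(\<integral>z. a z * of_real (husimi B U h ?c \<delta> z) \<partial>lborel)
      - of_real (h ^ CARD('d) / (2 * pi) ^ CARD('d)) * (of_real (?c ^ CARD('d)) * truncated_form B U h ?c a)
    = of_real (h ^ CARD('d) * ?c ^ CARD('d) / (2 * pi) ^ CARD('d)) * (\<Sum>m\<in>B. \<Sum>n\<in>B. cnj (U m) * U n * (?A m n - ?P m n))"
  proof -
    have "of_real (h ^ CARD('d) / (2 * pi) ^ CARD('d)) * (of_real (?c ^ CARD('d)) * z)
      = complex_of_real (h ^ CARD('d) * ?c ^ CARD('d) / (2 * pi) ^ CARD('d)) * z" for z
      by (simp only: of_real_mult[symmetric] mult.assoc[symmetric] times_divide_eq_left)
    then show ?thesis
      unfolding integral_husimi[OF a \<delta>] truncated_form_def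
      by (simp only: right_diff_distrib sum_subtractf)
  qed
  have "norm (\<Sum>m\<in>B. \<Sum>n\<in>B. cnj (U m) * U n * (?A m n - ?P m n)) \<le> (\<Sum>m\<in>B. \<Sum>n\<in>B. norm (U m) * norm (U n) * ?k m n)"
    by (intro order_trans[OF norm_sum] sum_mono) (simp add: norm_mult)
  then have "norm (of_real (h ^ CARD('d) * ?c ^ CARD('d) / (2 * pi) ^ CARD('d)) * (\<Sum>m\<in>B. \<Sum>n\<in>B. cnj (U m) * U n * (?A m n - ?P m n)))
    \<le> h ^ CARD('d) * ?c ^ CARD('d) / (2 * pi) ^ CARD('d) * (\<Sum>m\<in>B. \<Sum>n\<in>B. norm (U m) * norm (U n) * ?k m n)"
    unfolding norm_mult norm_of_real using h c by (intro mult_mono) auto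
  also have "\<dots> = h ^ CARD('d) / (2 * pi) ^ CARD('d) * (?c ^ CARD('d) * (\<Sum>m\<in>B. \<Sum>n\<in>B. norm (U m) * norm (U n) * ?k m n))"
    by (simp only: mult.assoc[symmetric] times_divide_eq_left)
  also have "\<dots> \<le> h ^ CARD('d) / (2 * pi) ^ CARD('d) * (?X * (?c + pi) ^ CARD('d) / 2 * (1 * ?s + ?s / 1))"
    using h by (intro mult_left_mono schur_kernel k X B c discrete_L2_sum_le U) auto
  also have "\<dots> = (discrete_norm h U)\<^sup>2 / (2 * pi) ^ CARD('d) * (?X * (?c + pi) ^ CARD('d))"
    using h by (simp add: discrete_norm_sq)
  finally show ?thesis unfolding e .
qed

section \<open>Convergence to a measure\<close>

text \<open>The truncated form is the intermediate term: the window error is measured on the finite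
  block, and the truncation error accounts for the rest.\<close>

lemma M_distr_husimi_error:
  fixes a :: "(real ^ 'd::finite) \<times> (real ^ 'd) \<Rightarrow> complex"
  assumes U: "U \<in> discrete_L2" and a: "a \<in> schwartz" and h: "0 < h" and \<epsilon>: "0 < \<epsilon>" and \<delta>: "0 < \<delta>"
    and B: "finite B" and \<tau>: "0 < \<tau>"
    and tail: "\<And>A. finite A \<Longrightarrow> A \<inter> B = {} \<Longrightarrow> (\<Sum>n\<in>A. (norm (U n))\<^sup>2) \<le> \<tau>\<^sup>2"
    and c0: "h / \<epsilon> \<le> c0" and C: "discrete_norm h U \<le> C"
    and D1: "0 \<le> D1" "\<And>x p. (1 + norm p) * norm (freq_ft a x p) \<le> D1 * lorentz p"
    and D2: "0 \<le> D2" "\<And>x y p. norm (freq_ft a x p - freq_ft a y p) \<le> D2 * norm (x - y) * lorentz p"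
  shows "norm ((\<integral>z. a z * of_real (husimi B U h (h / \<epsilon>) \<delta> z) \<partial>lborel) - M_distr h \<epsilon> U a)
    \<le> (c0 + pi) ^ CARD('d) / (2 * pi) ^ CARD('d) *
      (C\<^sup>2 * (D1 * tent_ratio TYPE(real ^ 'd) * (\<epsilon> / \<delta>) + D2 * \<delta>) + D1 * \<tau> * (h ^ CARD('d) + C\<^sup>2))"
proof -
  let ?c = "h / \<epsilon>" and ?s = "\<Sum>\<^sub>\<infinity>m. (norm (U m))\<^sup>2" and ?p = "(2 * pi) ^ CARD('d)"
  let ?X = "D1 * tent_ratio TYPE(real ^ 'd) * (\<epsilon> / \<delta>) + D2 * \<delta>"
  let ?k = "h ^ CARD('d) / ?p" and ?t = "truncated_form B U h ?c a"
  let ?M = "\<Sum>\<^sub>\<infinity>m. cnj (U m) * symbol_coeff U ?c a (h *\<^sub>R lattice_vec m) m"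
  have c: "0 < ?c" using h \<epsilon> by simp
  have X: "0 \<le> ?X" using D1 D2 \<epsilon> \<delta> tent_ratio_nonneg[where 'a="real ^ 'd"] by simp
  have kap: "(?c + pi) ^ CARD('d) \<le> (c0 + pi) ^ CARD('d)" using c c0 by (intro power_mono) auto
  have "0 \<le> discrete_norm h U" using h by (intro discrete_norm_nonneg) simp
  then have dn: "(discrete_norm h U)\<^sup>2 \<le> C\<^sup>2" using C by (intro power_mono)
  have T: "norm (freq_ft a x p) \<le> D1 * lorentz p" for x p
    using D1(2)[of p x] by (rule order_trans[rotated]) (simp add: distrib_right)
  have 1: "norm ((\<integral>z. a z * of_real (husimi B U h ?c \<delta> z) \<partial>lborel) - of_real ?k * (of_real (?c ^ CARD('d)) * ?t))
    \<le> C\<^sup>2 / ?p * (?X * (c0 + pi) ^ CARD('d))"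
    by (rule order_trans[OF husimi_error[OF U a h \<epsilon> \<delta> B D1 D2]])
      (use X kap dn c in \<open>intro mult_mono divide_right_mono mult_left_mono; simp\<close>)
  have "norm (of_real ?k * (of_real (?c ^ CARD('d)) * ?t) - M_distr h \<epsilon> U a)
      = norm (of_real ?k * (of_real (?c ^ CARD('d)) * (?M - ?t)))"
    unfolding M_distr_eq_symbol_coeff[OF \<epsilon>] by (subst norm_minus_commute) (simp only: right_diff_distrib)
  also have "\<dots> = ?k * (?c ^ CARD('d) * norm (?M - ?t))"
    unfolding norm_mult norm_of_real using h c by simp
  also have "\<dots> \<le> ?k * (D1 * (?c + pi) ^ CARD('d) * \<tau> * (1 + ?s))"
    using h by (intro mult_left_mono truncation_error[OF U a c D1(1) T B \<tau> tail]) auto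
  \<comment> \<open>Multiplying 1 + \<open>?s\<close> by h^d gives h^d plus the squared discrete
    norm.\<close>
  also have "\<dots> = (?c + pi) ^ CARD('d) / ?p * (D1 * \<tau> * (h ^ CARD('d) + (discrete_norm h U)\<^sup>2))"
    using h by (simp add: discrete_norm_sq algebra_simps)
  also have "\<dots> \<le> (c0 + pi) ^ CARD('d) / ?p * (D1 * \<tau> * (h ^ CARD('d) + C\<^sup>2))"
    using dn kap D1(1) \<tau> h c c0 by (intro mult_mono divide_right_mono mult_left_mono add_left_mono) auto
  finally have 2: "norm (of_real ?k * (of_real (?c ^ CARD('d)) * ?t) - M_distr h \<epsilon> U a)
    \<le> (c0 + pi) ^ CARD('d) / ?p * (D1 * \<tau> * (h ^ CARD('d) + C\<^sup>2))" .
  have "norm ((\<integral>z. a z * of_real (husimi B U h ?c \<delta> z) \<partial>lborel) - M_distr h \<epsilon> U a)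
     \<le> C\<^sup>2 / ?p * (?X * (c0 + pi) ^ CARD('d)) + (c0 + pi) ^ CARD('d) / ?p * (D1 * \<tau> * (h ^ CARD('d) + C\<^sup>2))"
    using norm_diff_triangle_le[OF 1 2] .
  also have "C\<^sup>2 / ?p * (?X * (c0 + pi) ^ CARD('d)) = (c0 + pi) ^ CARD('d) / ?p * (C\<^sup>2 * ?X)" by simp
  finally show ?thesis by (simp only: distrib_left)
qed

section \<open>Removing the weight\<close>

text \<open>Dividing by the weight uses up 2d powers of decay, and one more power makes the quotient
  vanish at infinity. It is therefore a valid test function for
  \<open>vague_compactness\<close>.\<close>

lemma schwartz_over_lorentz:
  fixes a :: "(real ^ 'd::finite) \<times> (real ^ 'd) \<Rightarrow> complex"
  assumes a: "a \<in> schwartz"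
  defines "f \<equiv> \<lambda>z. a z / of_real (lorentz (snd z))"
  shows "continuous_on UNIV f" and "(f \<longlongrightarrow> 0) at_infinity" and "\<exists>S. \<forall>z. norm (f z) \<le> S"
proof -
  let ?S = "schwartz_seminorm (2 * CARD('d) + 1) a"
  have "lorentz x \<noteq> 0" for x :: "real ^ 'd" using lorentz_pos[of x] by simp
  then show "continuous_on UNIV f"
    unfolding f_def using schwartz_continuous[OF a, of "[]"] continuous_on_lorentz_snd
    by (intro continuous_on_divide continuous_on_of_real) auto
  have b: "norm (f z) \<le> ?S / (1 + norm z)" for z
  proof -
    obtain x \<xi> where z: "z = (x, \<xi>)" by fastforce
    have "(1 + norm z) * norm (a z) \<le> ?S * lorentz \<xi>"
      using schwartz_lorentz_bound[OF a, of "[]" "2 * CARD('d) + 1" 1 x \<xi>] by (simp add: z)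
    moreover have "0 < 1 + norm z" by (simp add: add_pos_nonneg)
    ultimately have "norm (a z) / lorentz \<xi> \<le> ?S / (1 + norm z)"
      using lorentz_pos[of \<xi>] by (simp add: field_simps)
    then show ?thesis by (simp add: f_def z norm_divide)
  qed
  show "(f \<longlongrightarrow> 0) at_infinity"
  proof (rule Lim_null_comparison)
    show "\<forall>\<^sub>F z in at_infinity. norm (f z) \<le> ?S / (1 + norm z)" using b by simp
    have "filterlim (\<lambda>z :: (real ^ 'd) \<times> (real ^ 'd). 1 + norm z) at_infinity at_infinity"
      by (intro filterlim_at_top_imp_at_infinity filterlim_tendsto_add_at_top[OF tendsto_const] filterlim_norm_at_top)
    then show "((\<lambda>z :: (real ^ 'd) \<times> (real ^ 'd). ?S / (1 + norm z)) \<longlongrightarrow> 0) at_infinity"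
      by (rule tendsto_divide_0[OF tendsto_const])
  qed
  have "?S / (1 + norm z) \<le> ?S" for z :: "(real ^ 'd) \<times> (real ^ 'd)"
    using schwartz_seminorm_nonneg[OF a, of "2 * CARD('d) + 1"] by (simp add: divide_le_eq add_pos_nonneg mult_le_cancel_left1)
  then show "\<exists>S. \<forall>z. norm (f z) \<le> S" using b order_trans by blast
qed

text \<open>The reciprocal weight is continuous but unbounded: the new measure is finite on compact
  sets and possibly infinite in total, while Schwartz functions stay integrable because their
  quotients by the weight are bounded.\<close>

lemma radon_measure_density_lorentz:
  fixes \<nu> :: "((real ^ 'd::finite) \<times> (real ^ 'd)) measure"
  assumes \<nu>: "finite_measure \<nu>" and sets: "sets \<nu> = sets borel"
  defines "\<mu> \<equiv> density \<nu> (\<lambda>z. ennreal (1 / lorentz (snd z)))"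
  shows "radon_measure \<mu>"
    and "a \<in> schwartz \<Longrightarrow> integrable \<mu> a"
    and "a \<in> schwartz \<Longrightarrow> (\<integral>z. a z \<partial>\<mu>) = (\<integral>z. a z / of_real (lorentz (snd z)) \<partial>\<nu>)"
proof -
  interpret finite_measure \<nu> by (rule \<nu>)
  note [measurable_cong] = sets
  let ?g = "\<lambda>z :: (real ^ 'd) \<times> (real ^ 'd). 1 / lorentz (snd z)"
  have [measurable]: "?g \<in> borel_measurable borel" by measurable
  show "radon_measure \<mu>"
    unfolding radon_measure_def
  proof (intro conjI allI impI)
    show "sets \<mu> = sets borel" by (simp add: \<mu>_def sets)
    fix K :: "((real ^ 'd) \<times> (real ^ 'd)) set" assume K: "compact K"
    have "lorentz x \<noteq> 0" for x :: "real ^ 'd" using lorentz_pos[of x] by simp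
    then have "continuous_on K ?g"
      by (intro continuous_on_divide continuous_on_const continuous_on_subset[OF continuous_on_lorentz_snd]) auto
    then have "bounded (?g ` K)" using K by (intro compact_imp_bounded compact_continuous_image)
    then obtain R where R: "\<And>z. z \<in> K \<Longrightarrow> norm (?g z) \<le> R" by (auto simp: bounded_iff)
    have Ks: "K \<in> sets \<nu>" unfolding sets using K by (intro borel_compact)
    have "emeasure \<mu> K = (\<integral>\<^sup>+z. ennreal (?g z) * indicator K z \<partial>\<nu>)"
      unfolding \<mu>_def using Ks by (subst emeasure_density) auto
    also have "\<dots> \<le> (\<integral>\<^sup>+z. ennreal R \<partial>\<nu>)"
    proof (rule nn_integral_mono)
      fix z
      show "ennreal (?g z) * indicator K z \<le> ennreal R"
        using R[of z] by (cases "z \<in> K") (auto intro!: ennreal_leI)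
    qed
    also have "\<dots> < \<infinity>" by (simp add: emeasure_eq_measure ennreal_mult_less_top)
    finally show "emeasure \<mu> K < \<infinity>" .
  qed
  assume a: "a \<in> schwartz"
  have [measurable]: "a \<in> borel_measurable borel"
    using schwartz_continuous[OF a, of "[]"] by (auto intro: borel_measurable_continuous_onI)
  have eq: "?g z *\<^sub>R a z = a z / of_real (lorentz (snd z))" for z
    by (simp add: scaleR_complex_conv)
  obtain S where S: "\<And>z. norm (a z / of_real (lorentz (snd z))) \<le> S"
    using schwartz_over_lorentz(3)[OF a] by blast
  have "integrable \<nu> (\<lambda>z. ?g z *\<^sub>R a z)"
    unfolding eq by (rule integrable_const_bound[where B=S]) (use S in auto)
  then show "integrable \<mu> a" unfolding \<mu>_def by (subst integrable_density) auto
  show "(\<integral>z. a z \<partial>\<mu>) = (\<integral>z. a z / of_real (lorentz (snd z)) \<partial>\<nu>)"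
    unfolding \<mu>_def by (subst integral_density) (auto simp: eq)
qed

text \<open>The constant in \<open>freq_ft_decay\<close> is uniform in a, so a single seminorm
  dominates all pairings with a factor E that depends on neither k nor a.\<close>

lemma bounded_M_distr:
  fixes U :: "nat \<Rightarrow> int ^ 'd::finite \<Rightarrow> complex"
  assumes h: "\<And>k. 0 < h k" and \<epsilon>: "\<And>k. 0 < \<epsilon> k" and c0: "\<And>k. h k / \<epsilon> k \<le> c0"
    and U: "\<And>k. U k \<in> discrete_L2" and C: "\<And>k. discrete_norm (h k) (U k) \<le> C"
  shows "bounded_distributions (\<lambda>k. M_distr (h k) (\<epsilon> k) (U k))"
proof -
  let ?N = "2 * CARD('d) + 2"
  obtain D where D: "0 \<le> D" "\<And>a (x :: real ^ 'd) p. a \<in> schwartz \<Longrightarrow>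
      (1 + norm p) * norm (freq_ft a x p) \<le> D * schwartz_seminorm ?N a * lorentz p"
    using freq_ft_decay[where 'd='d] by blast
  define E where "E = C\<^sup>2 / (2 * pi) ^ CARD('d) * (D * (c0 + pi) ^ CARD('d))"
  have b: "norm (M_distr (h k) (\<epsilon> k) (U k) a) \<le> E * schwartz_seminorm ?N a" if a: "a \<in> schwartz" for a k
  proof -
    let ?S = "schwartz_seminorm ?N a"
    have S: "0 \<le> ?S" by (rule schwartz_seminorm_nonneg[OF a])
    have c: "0 < h k / \<epsilon> k" using h[of k] \<epsilon>[of k] by simp
    have "norm (freq_ft a x p) \<le> D * ?S * lorentz p" for x p
      using D(2)[OF a, of p x] by (rule order_trans[rotated]) (simp add: distrib_right)
    then have "norm (M_distr (h k) (\<epsilon> k) (U k) a)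
      \<le> (discrete_norm (h k) (U k))\<^sup>2 / (2 * pi) ^ CARD('d) * (D * ?S * (h k / \<epsilon> k + pi) ^ CARD('d))"
      using D(1) S by (intro M_distr_bound h \<epsilon> U a) auto
    also have "\<dots> \<le> C\<^sup>2 / (2 * pi) ^ CARD('d) * (D * ?S * (c0 + pi) ^ CARD('d))"
    proof (intro mult_mono divide_right_mono power_mono mult_left_mono add_right_mono c0 C)
      show "0 \<le> discrete_norm (h k) (U k)" using h[of k] by (intro discrete_norm_nonneg) simp
    qed (use D(1) S c in auto)
    finally show ?thesis by (simp add: E_def mult_ac)
  qed
  show ?thesis
    unfolding bounded_distributions_def tempered_distribution_def
  proof (intro conjI allI ballI impI)
    show "\<exists>N C. \<forall>f\<in>schwartz. norm (M_distr (h k) (\<epsilon> k) (U k) f) \<le> C * schwartz_seminorm N f" for k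
      using b by blast
    fix B :: "((real ^ 'd) \<times> (real ^ 'd) \<Rightarrow> complex) set" assume "schwartz_bounded B"
    then have B: "B \<subseteq> schwartz" "bounded (schwartz_seminorm ?N ` B)" by (auto simp: schwartz_bounded_def)
    obtain R where R: "\<And>a. a \<in> B \<Longrightarrow> norm (schwartz_seminorm ?N a) \<le> R"
      using B(2) by (auto simp: bounded_iff)
    have E: "0 \<le> E"
    proof -
      have "0 < h 0 / \<epsilon> 0" using h[of 0] \<epsilon>[of 0] by simp
      then have "0 \<le> c0" using c0[of 0] by simp
      then show ?thesis unfolding E_def using D(1) by simp
    qed
    have "norm (M_distr (h k) (\<epsilon> k) (U k) a) \<le> E * R" if "a \<in> B" for k a
    proof -
      have "E * schwartz_seminorm ?N a \<le> E * R" using R[OF that] E by (intro mult_left_mono) auto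
      with b[of a k] B(1) that show ?thesis by (meson order_trans subsetD)
    qed
    then show "\<exists>C. \<forall>k. \<forall>a\<in>B. norm (M_distr (h k) (\<epsilon> k) (U k) a) \<le> C" by blast
  qed (use h \<epsilon> U in \<open>auto intro: M_distr_add M_distr_cmult\<close>)
qed

section \<open>Boundedness and representation of limits by a measure\<close>

theorem proposition1p8:
  fixes h \<epsilon> :: "nat \<Rightarrow> real"
    and U :: "nat \<Rightarrow> int ^ 'd::finite \<Rightarrow> complex"
  assumes "scale h" and "scale \<epsilon>"
    and "bounded (range (\<lambda>k. h k / \<epsilon> k))"
    and "h_bounded h U"
  shows "bounded_distributions (\<lambda>k. M_distr (h k) (\<epsilon> k) (U k)) \<and>
    (\<forall>r :: nat \<Rightarrow> nat. strict_mono r \<longrightarrow>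
       weakly_convergent_distributions (\<lambda>n. M_distr (h (r n)) (\<epsilon> (r n)) (U (r n))) \<longrightarrow>
       (\<exists>\<mu> :: ((real ^ 'd) \<times> (real ^ 'd)) measure. radon_measure \<mu> \<and>
          (\<forall>a\<in>schwartz. integrable \<mu> a \<and>
             (\<lambda>n. M_distr (h (r n)) (\<epsilon> (r n)) (U (r n)) a) \<longlonglongrightarrow> (\<integral>z. a z \<partial>\<mu>))))"
proof (intro conjI allI impI)
  let ?d = "CARD('d)"
  have h: "0 < h k" and \<epsilon>: "0 < \<epsilon> k" for k using assms(1,2) by (auto simp: scale_def)
  have h0: "h \<longlonglongrightarrow> 0" and \<epsilon>0: "\<epsilon> \<longlonglongrightarrow> 0" using assms(1,2) by (auto simp: scale_def)
  have c: "0 < h k / \<epsilon> k" for k using h[of k] \<epsilon>[of k] by simp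
  obtain c0 where "\<And>k. norm (h k / \<epsilon> k) \<le> c0" using assms(3) by (auto simp: bounded_iff)
  then have c0: "h k / \<epsilon> k \<le> c0" for k by (metis abs_ge_self order_trans real_norm_def)
  have U: "U k \<in> discrete_L2" for k using assms(4) by (simp add: h_bounded_def)
  obtain C where C: "\<And>k. discrete_norm (h k) (U k) \<le> C" using assms(4) by (auto simp: h_bounded_def)
  show "bounded_distributions (\<lambda>k. M_distr (h k) (\<epsilon> k) (U k))"
    by (rule bounded_M_distr[OF h \<epsilon> c0 U C])
  fix r :: "nat \<Rightarrow> nat"
  assume r: "strict_mono r" and w: "weakly_convergent_distributions (\<lambda>n. M_distr (h (r n)) (\<epsilon> (r n)) (U (r n)))"
  then obtain T0 where T0: "\<And>a. a \<in> schwartz \<Longrightarrow> (\<lambda>n. M_distr (h (r n)) (\<epsilon> (r n)) (U (r n)) a) \<longlonglongrightarrow> T0 a"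
    unfolding weakly_convergent_distributions_def by blast
  \<comment> \<open>The truncation parameter of \<open>truncation_error\<close> is taken to be
    \<open>\<epsilon> k\<close>, so the truncation error vanishes in the limit.\<close>
  have "\<exists>B. finite B \<and> (\<forall>A. finite A \<longrightarrow> A \<inter> B = {} \<longrightarrow> (\<Sum>n\<in>A. (norm (U k n))\<^sup>2) \<le> (\<epsilon> k)\<^sup>2)" for k
    using discrete_L2_tail[OF U[of k], of "(\<epsilon> k)\<^sup>2"] \<epsilon>[of k] by (metis zero_less_power)
  then obtain B where B: "\<And>k. finite (B k)"
    "\<And>k A. finite A \<Longrightarrow> A \<inter> B k = {} \<Longrightarrow> (\<Sum>n\<in>A. (norm (U k n))\<^sup>2) \<le> (\<epsilon> k)\<^sup>2"
    by metis
  define \<rho> where "\<rho> k = husimi (B k) (U k) (h k) (h k / \<epsilon> k) (sqrt (\<epsilon> k))" for k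
  have [measurable]: "\<rho> k \<in> borel_measurable borel" for k unfolding \<rho>_def by simp
  have \<rho>0: "0 \<le> \<rho> k z" for k z unfolding \<rho>_def by (rule husimi_nonneg[OF h c])
  \<comment> \<open>The frequency weight gives these measures a common mass bound, the hypothesis of
    \<open>vague_compactness\<close>.\<close>
  define \<nu>s where "\<nu>s k = density lborel (\<lambda>z. ennreal (lorentz (snd z) * \<rho> k z))" for k
  have mass: "emeasure (\<nu>s k) UNIV \<le> ennreal ((1 + c0) ^ ?d * C\<^sup>2)" for k
  proof -
    have "emeasure (\<nu>s k) UNIV = (\<integral>\<^sup>+z. ennreal (lorentz (snd z) * \<rho> k z) \<partial>lborel)"
      unfolding \<nu>s_def by (subst emeasure_density) auto
    also have "\<dots> \<le> ennreal ((1 + c0) ^ ?d * (h k ^ ?d * (\<Sum>m\<in>B k. (norm (U k m))\<^sup>2)))"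
      unfolding \<rho>_def by (rule husimi_mass) (use h c c0 \<epsilon> B in auto)
    also have "\<dots> \<le> ennreal ((1 + c0) ^ ?d * C\<^sup>2)"
    proof (intro ennreal_leI mult_left_mono)
      have "h k ^ ?d * (\<Sum>m\<in>B k. (norm (U k m))\<^sup>2) \<le> (discrete_norm (h k) (U k))\<^sup>2"
        using h[of k] by (subst discrete_norm_sq) (auto intro!: mult_left_mono discrete_L2_sum_le U B)
      also have "\<dots> \<le> C\<^sup>2"
      proof (rule power_mono[OF C])
        show "0 \<le> discrete_norm (h k) (U k)" using h[of k] by (intro discrete_norm_nonneg) simp
      qed
      finally show "h k ^ ?d * (\<Sum>m\<in>B k. (norm (U k m))\<^sup>2) \<le> C\<^sup>2" .
      show "0 \<le> (1 + c0) ^ ?d" using c[of k] c0[of k] by simp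
    qed
    finally show ?thesis .
  qed
  have err: "(\<lambda>k. (\<integral>z. a z * of_real (\<rho> k z) \<partial>lborel) - M_distr (h k) (\<epsilon> k) (U k) a) \<longlonglongrightarrow> 0"
    if a: "a \<in> schwartz" for a
  proof -
    obtain D where D: "0 \<le> D" "\<And>(x :: real ^ 'd) p.
        (1 + norm p) * norm (freq_ft a x p) \<le> D * schwartz_seminorm (2 * ?d + 2) a * lorentz p"
      using freq_ft_decay[where 'd='d] a by blast
    define D1 where "D1 = D * schwartz_seminorm (2 * ?d + 2) a"
    have D1: "0 \<le> D1" unfolding D1_def using D(1) schwartz_seminorm_nonneg[OF a] by simp
    obtain D2 where D2: "0 \<le> D2" "\<And>x y p. norm (freq_ft a x p - freq_ft a y p) \<le> D2 * norm (x - y) * lorentz p"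
      using freq_ft_lipschitz[OF a] by blast
    let ?b = "\<lambda>k. (c0 + pi) ^ ?d / (2 * pi) ^ ?d *
      (C\<^sup>2 * (D1 * tent_ratio TYPE(real ^ 'd) * sqrt (\<epsilon> k) + D2 * sqrt (\<epsilon> k)) + D1 * \<epsilon> k * (h k ^ ?d + C\<^sup>2))"
    show ?thesis
    proof (rule Lim_null_comparison[OF always_eventually], rule allI)
      fix k
      have "norm ((\<integral>z. a z * of_real (\<rho> k z) \<partial>lborel) - M_distr (h k) (\<epsilon> k) (U k) a)
        \<le> (c0 + pi) ^ ?d / (2 * pi) ^ ?d *
          (C\<^sup>2 * (D1 * tent_ratio TYPE(real ^ 'd) * (\<epsilon> k / sqrt (\<epsilon> k)) + D2 * sqrt (\<epsilon> k)) + D1 * \<epsilon> k * (h k ^ ?d + C\<^sup>2))"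
        unfolding \<rho>_def
        by (rule M_distr_husimi_error[OF U a h \<epsilon> _ B(1) \<epsilon> B(2) c0 C D1 _ D2])
          (use \<epsilon> D(2) in \<open>auto simp: D1_def\<close>)
      also have "\<epsilon> k / sqrt (\<epsilon> k) = sqrt (\<epsilon> k)" using \<epsilon>[of k] by (simp add: real_div_sqrt)
      finally show "norm ((\<integral>z. a z * of_real (\<rho> k z) \<partial>lborel) - M_distr (h k) (\<epsilon> k) (U k) a) \<le> ?b k" .
    next
      have "?b \<longlonglongrightarrow> (c0 + pi) ^ ?d / (2 * pi) ^ ?d *
        (C\<^sup>2 * (D1 * tent_ratio TYPE(real ^ 'd) * sqrt 0 + D2 * sqrt 0) + D1 * 0 * (0 ^ ?d + C\<^sup>2))"
        by (intro tendsto_intros h0 \<epsilon>0)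
      then show "?b \<longlonglongrightarrow> 0" by simp
    qed
  qed
  obtain s \<nu> where s: "strict_mono s" and \<nu>: "finite_measure \<nu>" "sets \<nu> = sets borel"
    and lim: "\<And>f :: (real ^ 'd) \<times> (real ^ 'd) \<Rightarrow> complex. continuous_on UNIV f \<Longrightarrow> (f \<longlongrightarrow> 0) at_infinity \<Longrightarrow>
       (\<lambda>n. \<integral>z. f z \<partial>\<nu>s (r (s n))) \<longlonglongrightarrow> (\<integral>z. f z \<partial>\<nu>)"
  \<comment> \<open>Compactness is applied along the given subsequence \<open>r\<close>, so the
    vague limit exists along \<open>r \<circ> s\<close> only.\<close>
  proof (rule vague_compactness[of "\<lambda>n. \<nu>s (r n)"])
    show "sets (\<nu>s (r n)) = sets borel" for n by (simp add: \<nu>s_def)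
  qed (use mass in auto)
  define \<mu> where "\<mu> = density \<nu> (\<lambda>z. ennreal (1 / lorentz (snd z)))"
  show "\<exists>\<mu> :: ((real ^ 'd) \<times> (real ^ 'd)) measure. radon_measure \<mu> \<and>
          (\<forall>a\<in>schwartz. integrable \<mu> a \<and>
             (\<lambda>n. M_distr (h (r n)) (\<epsilon> (r n)) (U (r n)) a) \<longlonglongrightarrow> (\<integral>z. a z \<partial>\<mu>))"
  proof (intro exI[of _ \<mu>] conjI ballI)
    show "radon_measure \<mu>" unfolding \<mu>_def by (rule radon_measure_density_lorentz(1)[OF \<nu>])
    fix a :: "(real ^ 'd) \<times> (real ^ 'd) \<Rightarrow> complex" assume a: "a \<in> schwartz"
    show "integrable \<mu> a" unfolding \<mu>_def by (rule radon_measure_density_lorentz(2)[OF \<nu> a])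
    have [measurable]: "a \<in> borel_measurable borel"
      using schwartz_continuous[OF a, of "[]"] by (auto intro: borel_measurable_continuous_onI)
    let ?f = "\<lambda>z. a z / of_real (lorentz (snd z))"
    have "(\<integral>z. ?f z \<partial>\<nu>s k) = (\<integral>z. a z * of_real (\<rho> k z) \<partial>lborel)" for k
    proof -
      \<comment> \<open>The weight in the measure cancels the one in the test function.\<close>
      have "(lorentz (snd z) * \<rho> k z) *\<^sub>R ?f z = a z * of_real (\<rho> k z)" for z
        using lorentz_pos[of "snd z"] by (simp add: scaleR_complex_conv)
      then show ?thesis unfolding \<nu>s_def
        by (subst integral_density) (auto simp: \<rho>0)
    qed
    with lim[OF schwartz_over_lorentz(1,2)[OF a]]
    have "(\<lambda>n. \<integral>z. a z * of_real (\<rho> (r (s n)) z) \<partial>lborel) \<longlonglongrightarrow> (\<integral>z. ?f z \<partial>\<nu>)" by simp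
    moreover have "strict_mono (r \<circ> s)" using r s by (rule strict_mono_o)
    from LIMSEQ_subseq_LIMSEQ[OF err[OF a] this]
    have "(\<lambda>n. (\<integral>z. a z * of_real (\<rho> (r (s n)) z) \<partial>lborel)
        - M_distr (h (r (s n))) (\<epsilon> (r (s n))) (U (r (s n))) a) \<longlonglongrightarrow> 0" by (simp add: o_def)
    ultimately have "(\<lambda>n. M_distr (h (r (s n))) (\<epsilon> (r (s n))) (U (r (s n))) a) \<longlonglongrightarrow> (\<integral>z. ?f z \<partial>\<nu>) - 0"
      using tendsto_diff by fastforce
    moreover have "(\<lambda>n. M_distr (h (r (s n))) (\<epsilon> (r (s n))) (U (r (s n))) a) \<longlonglongrightarrow> T0 a"
      using LIMSEQ_subseq_LIMSEQ[OF T0[OF a] s] by (simp add: o_def)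
    \<comment> \<open>By hypothesis the pairings converge along all of \<open>r\<close>; their limit
      is identified along the further subsequence \<open>s\<close>, and so the measure represents it
      along \<open>r\<close> itself.\<close>
    ultimately have "T0 a = (\<integral>z. ?f z \<partial>\<nu>)" using LIMSEQ_unique by fastforce
    also have "\<dots> = (\<integral>z. a z \<partial>\<mu>)"
      unfolding \<mu>_def by (rule radon_measure_density_lorentz(3)[OF \<nu> a, symmetric])
    finally show "(\<lambda>n. M_distr (h (r n)) (\<epsilon> (r n)) (U (r n)) a) \<longlonglongrightarrow> (\<integral>z. a z \<partial>\<mu>)"
      using T0[OF a] by simp
  qed
qed

end
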